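(* Let $\Bbbk$ be a field of characteristic zero and let $A$ be an infinite-dimensional finitely generated $\Bbbk$-algebra (not necessarily commutative). Then the universal enveloping algebra $U(\operatorname{Der}(A))$ is not noetherian. Furthermore, $U(\operatorname{Inn}(A))$ is not noetherian whenever $\operatorname{Inn}(A)$ is infinite-dimensional.
   Context: $\Bbbk$-algebras are associative with identity. (In)finite-dimensional means (in)finite-dimensional as a $\Bbbk$-vector space. A ring is called noetherian if it is both left and right noetherian. A derivation of $A$ is a $\Bbbk$-linear map $d\colon A\to A$ with $d(ab)=d(a)b+a\,d(b)$ for all $a,b\in A$. $\operatorname{Der}(A)$ is the Lie algebra over $\Bbbk$ of all derivations of $A$, with bracket $[d_1,d_2]=d_1\circ d_2-d_2\circ d_1$. $\operatorname{Inn}(A)$ is the Lie ideal of $\operatorname{Der}(A)$ consisting of the inner derivations $\operatorname{ad}_a\colon b\mapsto ab-ba$, $a\in A$. $U(\mathfrak g)$ denotes the universal enveloping algebra over $\Bbbk$ of a Lie algebra $\mathfrak g$. *)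

theory Defs
  imports
    Complex_Main
    "HOL-Algebra.QuotRing"
    "HOL-Library.Poly_Mapping"
    "HOL-Library.Function_Algebras"
begin

section \<open>Vector spaces and associative algebras\<close>

definition (in vector_space) fin_dim :: "'b set \<Rightarrow> bool"
  where "fin_dim V \<longleftrightarrow> (\<exists>B. finite B \<and> span B = V)"

locale assoc_algebra = vector_space scale
  for scale :: "'k::field \<Rightarrow> 'a::ring_1 \<Rightarrow> 'a" +
  assumes scale_mult_left: "scale c a * b = scale c (a * b)"
    and scale_mult_right: "a * scale c b = scale c (a * b)"
begin

definition subalgebra :: "'a set \<Rightarrow> bool"
  where "subalgebra B \<longleftrightarrow> subspace B \<and> 1 \<in> B \<and> (\<forall>a\<in>B. \<forall>b\<in>B. a * b \<in> B)"

definition finitely_generated :: bool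
  where "finitely_generated \<longleftrightarrow> (\<exists>S. finite S \<and> subalgebra hull S = UNIV)"

end

section \<open>Lie algebras of derivations\<close>

text \<open>A Lie algebra is a subspace \<open>L\<close> of an ambient vector space, with a bracket that only
  matters on \<open>L\<close>.\<close>

locale lie_algebra = vector_space scale
  for scale :: "'k::field \<Rightarrow> 'g::ab_group_add \<Rightarrow> 'g" +
  fixes bracket :: "'g \<Rightarrow> 'g \<Rightarrow> 'g" and L :: "'g set"
  assumes L_subspace: "subspace L"
    and bracket_closed: "\<lbrakk>x \<in> L; y \<in> L\<rbrakk> \<Longrightarrow> bracket x y \<in> L"
    and bracket_add_left: "\<lbrakk>x \<in> L; y \<in> L; z \<in> L\<rbrakk> \<Longrightarrow> bracket (x + y) z = bracket x z + bracket y z"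
    and bracket_add_right: "\<lbrakk>x \<in> L; y \<in> L; z \<in> L\<rbrakk> \<Longrightarrow> bracket x (y + z) = bracket x y + bracket x z"
    and bracket_scale_left: "\<lbrakk>x \<in> L; y \<in> L\<rbrakk> \<Longrightarrow> bracket (scale c x) y = scale c (bracket x y)"
    and bracket_scale_right: "\<lbrakk>x \<in> L; y \<in> L\<rbrakk> \<Longrightarrow> bracket x (scale c y) = scale c (bracket x y)"
    and bracket_self: "x \<in> L \<Longrightarrow> bracket x x = 0"
    and jacobi: "\<lbrakk>x \<in> L; y \<in> L; z \<in> L\<rbrakk> \<Longrightarrow>
      bracket x (bracket y z) + bracket y (bracket z x) + bracket z (bracket x y) = 0"

text \<open>Addition and subtraction of maps are the pointwise operations of
  \<open>HOL-Library.Function_Algebras\<close>.\<close>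

definition fun_scale :: "('k \<Rightarrow> 'a \<Rightarrow> 'a) \<Rightarrow> 'k \<Rightarrow> ('a \<Rightarrow> 'a) \<Rightarrow> ('a \<Rightarrow> 'a)"
  where "fun_scale scale c f = (\<lambda>x. scale c (f x))"

definition commutator :: "('a \<Rightarrow> 'a::ab_group_add) \<Rightarrow> ('a \<Rightarrow> 'a) \<Rightarrow> ('a \<Rightarrow> 'a)"
  where "commutator f g = (f \<circ> g) - (g \<circ> f)"

definition ad :: "'a::ring_1 \<Rightarrow> 'a \<Rightarrow> 'a"
  where "ad a = (\<lambda>b. a * b - b * a)"

definition Der :: "('k::field \<Rightarrow> 'a::ring_1 \<Rightarrow> 'a) \<Rightarrow> ('a \<Rightarrow> 'a) set"
  where "Der scale =
    {d. Vector_Spaces.linear scale scale d \<and> (\<forall>a b. d (a * b) = d a * b + a * d b)}"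

definition Inn :: "('a::ring_1 \<Rightarrow> 'a) set"
  where "Inn = range ad"

context assoc_algebra
begin

lemma vector_space_fun_scale: "vector_space (fun_scale scale)"
  by unfold_locales
    (auto simp: fun_scale_def fun_eq_iff scale_right_distrib scale_left_distrib)

sublocale maps: vector_space "fun_scale scale"
  by (rule vector_space_fun_scale)

lemma DerI:
  assumes "\<And>a b. d (a + b) = d a + d b" "\<And>c a. d (scale c a) = scale c (d a)"
    "\<And>a b. d (a * b) = d a * b + a * d b"
  shows "d \<in> Der scale"
proof -
  have "Vector_Spaces.linear scale scale d"
    by unfold_locales (rule assms)+
  then show ?thesis using assms(3) by (simp add: Der_def)
qed

lemma DerD:
  assumes "d \<in> Der scale"
  shows "d (a + b) = d a + d b" "d (scale c a) = scale c (d a)"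
    "d (a * b) = d a * b + a * d b" "d (a - b) = d a - d b" "d 0 = 0"
proof -
  interpret Vector_Spaces.linear scale scale d
    using assms by (simp add: Der_def)
  show "d (a + b) = d a + d b" "d (scale c a) = scale c (d a)"
    "d (a - b) = d a - d b" "d 0 = 0"
    by (rule add scale diff zero)+
  show "d (a * b) = d a * b + a * d b"
    using assms by (simp add: Der_def)
qed

lemma commutator_Der:
  "\<lbrakk>d \<in> Der scale; e \<in> Der scale\<rbrakk> \<Longrightarrow> commutator d e \<in> Der scale"
  by (rule DerI)
    (simp_all add: commutator_def DerD scale_right_diff_distrib algebra_simps)

lemma lie_algebra_Der_subspace:
  assumes "maps.subspace L" "L \<subseteq> Der scale" "\<And>d e. \<lbrakk>d \<in> L; e \<in> L\<rbrakk> \<Longrightarrow> commutator d e \<in> L"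
  shows "lie_algebra (fun_scale scale) commutator L"
proof
  have D: "d \<in> L \<Longrightarrow> d \<in> Der scale" for d using assms(2) by blast
  show "maps.subspace L" by fact
  fix d e f c assume d: "d \<in> L"
  show "commutator d d = 0"
    by (simp add: commutator_def)
  assume e: "e \<in> L"
  note d' = DerD[OF D[OF d]] and e' = DerD[OF D[OF e]]
  show "commutator d e \<in> L" using assms(3) d e .
  show "commutator (fun_scale scale c d) e = fun_scale scale c (commutator d e)"
    "commutator d (fun_scale scale c e) = fun_scale scale c (commutator d e)"
    by (auto simp: commutator_def fun_scale_def fun_eq_iff d' e' scale_right_diff_distrib)
  assume f: "f \<in> L"
  note f' = DerD[OF D[OF f]]
  show "commutator (d + e) f = commutator d f + commutator e f"
    "commutator d (e + f) = commutator d e + commutator d f"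
    "commutator d (commutator e f) + commutator e (commutator f d)
      + commutator f (commutator d e) = 0"
    by (auto simp: commutator_def fun_eq_iff d' e' f')
qed

lemma ad_Der: "ad a \<in> Der scale"
  by (rule DerI)
    (simp_all add: ad_def scale_mult_left scale_mult_right scale_right_diff_distrib algebra_simps)

lemma commutator_ad: "d \<in> Der scale \<Longrightarrow> commutator d (ad a) = ad (d a)"
  by (auto simp: commutator_def ad_def fun_eq_iff DerD algebra_simps)

theorem lie_algebra_Der: "lie_algebra (fun_scale scale) commutator (Der scale)"
proof (rule lie_algebra_Der_subspace)
  show "maps.subspace (Der scale)"
    by (rule maps.subspaceI; rule DerI)
      (simp_all add: DerD fun_scale_def scale_right_distrib scale_left_commute
        scale_mult_left scale_mult_right algebra_simps)
qed (auto intro: commutator_Der)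

theorem lie_algebra_Inn: "lie_algebra (fun_scale scale) commutator Inn"
proof (rule lie_algebra_Der_subspace)
  show "maps.subspace Inn"
  proof (rule maps.subspaceI)
    have "0 = ad 0" by (simp add: ad_def fun_eq_iff)
    then show "0 \<in> Inn" unfolding Inn_def by blast
  next
    fix x y :: "'a \<Rightarrow> 'a" assume "x \<in> Inn" "y \<in> Inn"
    then obtain a b where "x = ad a" "y = ad b" by (auto simp: Inn_def)
    then have "x + y = ad (a + b)" by (simp add: ad_def fun_eq_iff algebra_simps)
    then show "x + y \<in> Inn" by (simp add: Inn_def)
  next
    fix c and x :: "'a \<Rightarrow> 'a" assume "x \<in> Inn"
    then obtain a where "x = ad a" by (auto simp: Inn_def)
    then have "fun_scale scale c x = ad (scale c a)"
      by (simp add: ad_def fun_scale_def fun_eq_iff scale_mult_left scale_mult_right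
          scale_right_diff_distrib)
    then show "fun_scale scale c x \<in> Inn" by (simp add: Inn_def)
  qed
  show "Inn \<subseteq> Der scale" by (auto simp: Inn_def ad_Der)
  show "commutator d e \<in> Inn" if "d \<in> Inn" "e \<in> Inn" for d e :: "'a \<Rightarrow> 'a"
    using that by (auto simp: Inn_def commutator_ad[OF ad_Der])
qed

end

section \<open>The universal enveloping algebra\<close>

text \<open>Words form a monoid under concatenation. It is written additively because
  \<^typ>\<open>'m::monoid_add \<Rightarrow>\<^sub>0 'k::ring_1\<close>, with the convolution product, is the monoid ring
  of \<open>'m\<close> over \<open>'k\<close>.\<close>

datatype 'g free_monoid = Word (letters: "'g list")

instantiation free_monoid :: (type) monoid_add
begin

definition "0 = Word []"
definition "u + v = Word (letters u @ letters v)"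

instance
  by standard (simp_all add: zero_free_monoid_def plus_free_monoid_def)

end

lemma letters_add [simp]: "letters (u + v) = letters u @ letters v"
  by (simp add: plus_free_monoid_def)

lemma letters_zero [simp]: "letters 0 = []"
  by (simp add: zero_free_monoid_def)

text \<open>The free associative unital \<open>'k\<close>-algebra on the set \<open>X\<close>.\<close>

definition free_algebra :: "'g set \<Rightarrow> ('g free_monoid \<Rightarrow>\<^sub>0 'k::field) ring"
  where "free_algebra X =
    \<lparr>carrier = {p. \<forall>w\<in>Poly_Mapping.keys p. set (letters w) \<subseteq> X},
     mult = (*), one = 1, zero = 0, add = (+)\<rparr>"

definition gen :: "'g \<Rightarrow> 'g free_monoid \<Rightarrow>\<^sub>0 'k::field"
  where "gen x = Poly_Mapping.single (Word [x]) 1"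

text \<open>The first two families of relations turn the free algebra on the underlying set of \<open>L\<close>
  into the tensor algebra of the vector space \<open>L\<close>; the third one is
  \<open>x \<otimes> y - y \<otimes> x = [x, y]\<close>. The factor \<open>Poly_Mapping.single 0 c\<close> is the scalar \<open>c\<close>.\<close>

definition uea_relations ::
  "('k::field \<Rightarrow> 'g::ab_group_add \<Rightarrow> 'g) \<Rightarrow> ('g \<Rightarrow> 'g \<Rightarrow> 'g) \<Rightarrow> 'g set \<Rightarrow> ('g free_monoid \<Rightarrow>\<^sub>0 'k) set"
  where "uea_relations scale bracket L =
    {gen (x + y) - gen x - gen y | x y. x \<in> L \<and> y \<in> L} \<union>
    {gen (scale c x) - Poly_Mapping.single 0 c * gen x | c x. x \<in> L} \<union>
    {gen x * gen y - gen y * gen x - gen (bracket x y) | x y. x \<in> L \<and> y \<in> L}"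

definition uea ::
  "('k::field \<Rightarrow> 'g::ab_group_add \<Rightarrow> 'g) \<Rightarrow> ('g \<Rightarrow> 'g \<Rightarrow> 'g) \<Rightarrow> 'g set
    \<Rightarrow> ('g free_monoid \<Rightarrow>\<^sub>0 'k) set ring"
  where "uea scale bracket L =
    free_algebra L Quot (Idl\<^bsub>free_algebra L\<^esub> (uea_relations scale bracket L))"

lemma ring_free_algebra: "ring (free_algebra X :: ('g free_monoid \<Rightarrow>\<^sub>0 'k::field) ring)"
proof (rule ringI)
  let ?F = "free_algebra X :: ('g free_monoid \<Rightarrow>\<^sub>0 'k::field) ring"
  have ops: "x \<oplus>\<^bsub>?F\<^esub> y = x + y" "x \<otimes>\<^bsub>?F\<^esub> y = x * y" "\<zero>\<^bsub>?F\<^esub> = 0" "\<one>\<^bsub>?F\<^esub> = 1" for x y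
    by (simp_all add: free_algebra_def)
  have add: "p + q \<in> carrier ?F" if "p \<in> carrier ?F" "q \<in> carrier ?F" for p q
    using that keys_add[of p q] by (auto simp: free_algebra_def dest!: subsetD)
  have mult: "p * q \<in> carrier ?F" if "p \<in> carrier ?F" "q \<in> carrier ?F" for p q
    using that keys_mult[of p q] by (fastforce simp: free_algebra_def)
  have minus: "- p \<in> carrier ?F" if "p \<in> carrier ?F" for p
    using that by (simp add: free_algebra_def)
  have one: "1 \<in> carrier ?F"
    by (simp add: free_algebra_def)
  have zero: "0 \<in> carrier ?F"
    by (simp add: free_algebra_def)
  show "abelian_group ?F"
  proof (rule abelian_groupI)
    fix x assume "x \<in> carrier ?F"
    then show "\<exists>y\<in>carrier ?F. y \<oplus>\<^bsub>?F\<^esub> x = \<zero>\<^bsub>?F\<^esub>"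
      using minus by (intro bexI[of _ "- x"]) (simp_all add: ops)
  qed (simp_all add: ops add zero ac_simps)
  show "monoid ?F"
    by (rule monoidI) (simp_all add: ops mult one mult.assoc)
  fix x y z assume "x \<in> carrier ?F" "y \<in> carrier ?F" "z \<in> carrier ?F"
  show "(x \<oplus>\<^bsub>?F\<^esub> y) \<otimes>\<^bsub>?F\<^esub> z = x \<otimes>\<^bsub>?F\<^esub> z \<oplus>\<^bsub>?F\<^esub> y \<otimes>\<^bsub>?F\<^esub> z"
    unfolding ops by (rule distrib_right)
  show "z \<otimes>\<^bsub>?F\<^esub> (x \<oplus>\<^bsub>?F\<^esub> y) = z \<otimes>\<^bsub>?F\<^esub> x \<oplus>\<^bsub>?F\<^esub> z \<otimes>\<^bsub>?F\<^esub> y"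
    unfolding ops by (rule distrib_left)
qed

lemma (in lie_algebra) ring_uea: "ring (uea scale bracket L)"
proof -
  let ?F = "free_algebra L :: ('g free_monoid \<Rightarrow>\<^sub>0 'k) ring"
  interpret F: ring ?F by (rule ring_free_algebra)
  have gen: "gen x \<in> carrier ?F" if "x \<in> L" for x
    using that by (simp add: free_algebra_def gen_def)
  have diff: "p - q \<in> carrier ?F" if "p \<in> carrier ?F" "q \<in> carrier ?F" for p q
  proof -
    have "- q \<in> carrier ?F" using that by (simp add: free_algebra_def)
    from F.a_closed[OF that(1) this] show ?thesis by (simp add: free_algebra_def)
  qed
  have mult: "p * q \<in> carrier ?F" if "p \<in> carrier ?F" "q \<in> carrier ?F" for p q
    using F.m_closed[OF that] by (simp add: free_algebra_def)
  have const: "Poly_Mapping.single 0 c \<in> carrier ?F" for c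
    by (simp add: free_algebra_def)
  have "uea_relations scale bracket L \<subseteq> carrier ?F"
    unfolding uea_relations_def
    by (auto intro!: diff mult gen const bracket_closed
        subspace_add[OF L_subspace] subspace_scale[OF L_subspace])
  then show ?thesis
    unfolding uea_def by (intro ideal.quotient_is_ring F.genideal_ideal)
qed

section \<open>Noetherian rings\<close>

text \<open>The locale \<open>noetherian_ring\<close> of HOL-Algebra only constrains two-sided ideals, so it is not
  the right notion for noncommutative rings.\<close>

definition left_ideal :: "'a set \<Rightarrow> ('a, 'b) ring_scheme \<Rightarrow> bool"
  where "left_ideal I R \<longleftrightarrow> additive_subgroup I R \<and> (\<forall>r\<in>carrier R. \<forall>a\<in>I. r \<otimes>\<^bsub>R\<^esub> a \<in> I)"

definition right_ideal :: "'a set \<Rightarrow> ('a, 'b) ring_scheme \<Rightarrow> bool"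
  where "right_ideal I R \<longleftrightarrow> additive_subgroup I R \<and> (\<forall>r\<in>carrier R. \<forall>a\<in>I. a \<otimes>\<^bsub>R\<^esub> r \<in> I)"

definition left_noetherian :: "('a, 'b) ring_scheme \<Rightarrow> bool"
  where "left_noetherian R \<longleftrightarrow>
    (\<forall>I :: nat \<Rightarrow> 'a set. (\<forall>n. left_ideal (I n) R) \<and> (\<forall>n. I n \<subseteq> I (Suc n)) \<longrightarrow>
      (\<exists>N. \<forall>n\<ge>N. I n = I N))"

definition right_noetherian :: "('a, 'b) ring_scheme \<Rightarrow> bool"
  where "right_noetherian R \<longleftrightarrow>
    (\<forall>I :: nat \<Rightarrow> 'a set. (\<forall>n. right_ideal (I n) R) \<and> (\<forall>n. I n \<subseteq> I (Suc n)) \<longrightarrow>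
      (\<exists>N. \<forall>n\<ge>N. I n = I N))"

definition noetherian :: "('a, 'b) ring_scheme \<Rightarrow> bool"
  where "noetherian R \<longleftrightarrow> left_noetherian R \<and> right_noetherian R"

end

(* U(G) is free over U(H) for a Lie subalgebra H of G. Hence an H-module with a sequence of elements
   of U(H) whose images are finite-dimensional but add up to an infinite-dimensional space yields an
   infinite ascending chain of right ideals of U(G). Applied to extensions of the trivial H-module by a
   1-cocycle with values in V, this excludes in particular infinite-dimensional abelian H.

   If Inn(A) is infinite-dimensional, then A, modulo its center, contains an infinite-dimensional
   commuting family (an infinite-dimensional algebra has an infinite-dimensional commutative
   subalgebra, Laffey); it can be chosen so that its inner derivations commute.

   If Inn(A) is finite-dimensional, then A is finite-dimensional modulo an ideal (the core) contained
   in the center. Noetherianity of the commutative quotient of A yields an element s of the core with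
   prime annihilator P and A s infinite-dimensional. The finitely generated domain A / P has positive
   transcendence degree, hence a nonzero derivation with values in A s, which is a derivation d of A.
   If s^2 = 0, then the derivations f d with f in the core commute. Otherwise the derivations f d with
   f in A s form a Lie algebra of Witt type, with the cocycle f d |-> d f. *)

theory Submission
  imports Defs "HOL-Library.Multiset" "HOL-Library.Product_Plus"
begin

section \<open>Dimension modulo a subspace\<close>

text \<open>An H-module V with a subspace V' gives the right ideal of all a in U(H) with a V inside
  V', because a b V lies in a V. Hence right ideals are used, and failure on one side suffices. That
  such chains stay strict in U(G) rests on linear independence of sorted words, for which a large
  enough module is needed. Since G consists of derivations, it acts by composition on the maps from
  A to A, and \<open>id\<close> is independent of G: forms on tensor powers, evaluated at (id, ...,
  id), separate sorted words. Characteristic zero keeps the multiplicities that occur there from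
  vanishing.

  The Witt-type case is the reason for cocycles. For A = k[x], two derivations f d/dx and g d/dx
  commute only if they are proportional, so abelian subalgebras do not suffice; in the extension, a
  suitable second-order element of U(H) retains only its leading coefficient.

  Quotients are never formed: finite dimension, commutation, idempotents and inverses are all taken
  modulo a subspace or ideal \<open>J\<close>, and \<open>fd_mod J B\<close> means that B has
  finite-dimensional span modulo \<open>span J\<close>.\<close>

definition (in vector_space) fd_mod :: "'b set \<Rightarrow> 'b set \<Rightarrow> bool"
  where "fd_mod J B \<longleftrightarrow> (\<exists>S. finite S \<and> B \<subseteq> span (S \<union> J))"

context vector_space
begin

lemma fd_modI: "finite S \<Longrightarrow> B \<subseteq> span (S \<union> J) \<Longrightarrow> fd_mod J B"
  unfolding fd_mod_def by blast

lemma fd_mod_finite: "finite B \<Longrightarrow> fd_mod J B"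
  by (rule fd_modI[of B]) (auto intro: span_base)

lemma fd_mod_self: "fd_mod J J"
  by (rule fd_modI[of "{}"]) (auto intro: span_base)

lemma fd_mod_mono: "fd_mod J B \<Longrightarrow> B' \<subseteq> B \<Longrightarrow> fd_mod J B'"
  unfolding fd_mod_def by blast

lemma fd_mod_span: "fd_mod J B \<Longrightarrow> fd_mod J (span B)"
  unfolding fd_mod_def by (meson span_minimal subspace_span)

lemma fd_mod_trans:
  assumes "fd_mod J B" "fd_mod K J" shows "fd_mod K B"
proof -
  obtain S T where S: "finite S" "B \<subseteq> span (S \<union> J)" and T: "finite T" "J \<subseteq> span (T \<union> K)"
    using assms unfolding fd_mod_def by blast
  have "S \<union> J \<subseteq> span (S \<union> T \<union> K)"
    using T(2) span_mono[of "T \<union> K" "S \<union> T \<union> K"] by (auto intro: span_base)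
  then have "span (S \<union> J) \<subseteq> span (S \<union> T \<union> K)"
    by (simp add: span_minimal)
  then show ?thesis using S T by (intro fd_modI[of "S \<union> T"]) auto
qed

lemma fd_mod_base_mono: "fd_mod J B \<Longrightarrow> J \<subseteq> K \<Longrightarrow> fd_mod K B"
  using fd_mod_trans fd_mod_mono[OF fd_mod_self] by blast

lemma fd_mod_UN:
  assumes "finite I" "\<And>i. i \<in> I \<Longrightarrow> fd_mod J (B i)" shows "fd_mod J (\<Union>i\<in>I. B i)"
proof -
  obtain S where S: "\<And>i. i \<in> I \<Longrightarrow> finite (S i) \<and> B i \<subseteq> span (S i \<union> J)"
    using assms(2) unfolding fd_mod_def by metis
  have "B i \<subseteq> span ((\<Union>i\<in>I. S i) \<union> J)" if "i \<in> I" for i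
    using S[OF that] span_mono[of "S i \<union> J" "(\<Union>i\<in>I. S i) \<union> J"] that by blast
  then show ?thesis using assms(1) S by (intro fd_modI[of "\<Union>i\<in>I. S i"]) auto
qed

lemma fd_mod_Un: "fd_mod J B \<Longrightarrow> fd_mod J C \<Longrightarrow> fd_mod J (B \<union> C)"
  using fd_mod_UN[of UNIV J "\<lambda>b. if b then B else C"] by (auto simp: UNIV_bool Un_commute)

text \<open>The vectors witnessing \<open>fd_mod\<close> may lie outside \<open>U\<close>. Induction
  on them: if \<open>U\<close> is not inside the span of the others, one element of \<open>U\<close>
  replaces the new vector, and subtracting multiples of it leads into the smaller space
  \<open>U'\<close>.\<close>

lemma fd_mod_basis:
  assumes "fd_mod J U" "subspace U"
  obtains T where "finite T" "T \<subseteq> U" "U \<subseteq> span (T \<union> J)"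
proof -
  have "\<exists>T. finite T \<and> T \<subseteq> U \<and> U \<subseteq> span (T \<union> J)"
    if "finite S" "U \<subseteq> span (S \<union> J)" "subspace U" for S U
    using that
  proof (induction S arbitrary: U rule: finite_induct)
    case empty
    then show ?case by (intro exI[of _ "{}"]) auto
  next
    case (insert s S)
    define U' where "U' = U \<inter> span (S \<union> J)"
    have U': "subspace U'" "U' \<subseteq> span (S \<union> J)"
      using insert.prems by (auto simp: U'_def subspace_inter)
    then obtain T where T: "finite T" "T \<subseteq> U'" "U' \<subseteq> span (T \<union> J)"
      using insert.IH[of U'] by blast
    show ?case
    proof (cases "U \<subseteq> span (S \<union> J)")
      case True
      then show ?thesis using T by (auto simp: U'_def Int_absorb2)
    next
      case False
      then obtain u where u: "u \<in> U" "u \<notin> span (S \<union> J)" by blast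
      obtain k where k: "u - scale k s \<in> span (S \<union> J)"
        using u insert.prems span_breakdown_eq[of u s "S \<union> J"] by auto
      have "k \<noteq> 0" using k u by auto
      have "v \<in> span (insert u T \<union> J)" if v: "v \<in> U" for v
      proof -
        obtain l where l: "v - scale l s \<in> span (S \<union> J)"
          using v insert.prems span_breakdown_eq[of v s "S \<union> J"] by auto
        have "(v - scale l s) - scale (l / k) (u - scale k s) \<in> span (S \<union> J)"
          by (rule span_diff[OF l span_scale[OF k]])
        then have "v - scale (l / k) u \<in> span (S \<union> J)"
          using \<open>k \<noteq> 0\<close> by (simp add: scale_right_diff_distrib)
        then have "v - scale (l / k) u \<in> U'"
          using u v insert.prems by (auto simp: U'_def intro!: subspace_diff subspace_scale)
        then have "v - scale (l / k) u \<in> span (T \<union> J)" using T by blast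
        then show ?thesis unfolding Un_insert_left span_breakdown_eq by blast
      qed
      then show ?thesis using T u by (intro exI[of _ "insert u T"]) (auto simp: U'_def)
    qed
  qed
  then show ?thesis using assms that unfolding fd_mod_def by blast
qed

lemma fin_dim_iff_fd_mod: "subspace V \<Longrightarrow> fin_dim V \<longleftrightarrow> fd_mod {} V"
proof
  assume V: "subspace V"
  assume "fin_dim V"
  then show "fd_mod {} V" unfolding fin_dim_def fd_mod_def by auto
next
  assume V: "subspace V"
  assume "fd_mod {} V"
  then obtain T where "finite T" "T \<subseteq> V" "V \<subseteq> span (T \<union> {})"
    using fd_mod_basis V by metis
  then show "fin_dim V" unfolding fin_dim_def using V span_minimal
    by (metis Un_empty_right subset_antisym)
qed

text \<open>Finitely many combinations of terms span the range modulo \<open>J\<close>. They involve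
  only terms below some \<open>N\<close>, so \<open>x N\<close> depends on its predecessors.
  Independent infinite sequences are refuted in this form.\<close>

lemma fd_mod_range_dependent:
  assumes "fd_mod J (range x)"
  shows "\<exists>n::nat. x n \<in> span (x ` {..<n} \<union> J)"
proof -
  obtain T where T: "finite T" "T \<subseteq> span (range x)" "span (range x) \<subseteq> span (T \<union> J)"
    using fd_mod_basis[OF fd_mod_span[OF assms] subspace_span] by metis
  have "\<exists>n. t \<in> span (x ` {..<n})" if "t \<in> span (range x)" for t
    using that
  proof (induction rule: span_induct_alt)
    case base
    then show ?case by (auto simp: span_zero)
  next
    case (step c y z)
    then obtain n m where "z \<in> span (x ` {..<n})" "y = x m" by auto
    moreover have "span (x ` {..<n}) \<subseteq> span (x ` {..<max n (Suc m)})"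
      by (rule span_mono) auto
    moreover have "x m \<in> span (x ` {..<max n (Suc m)})" by (rule span_base) auto
    ultimately have "z \<in> span (x ` {..<max n (Suc m)})" "y \<in> span (x ` {..<max n (Suc m)})"
      by blast+
    then show ?case by (meson span_add span_scale)
  qed
  then obtain n where n: "t \<in> span (x ` {..<n t})" if "t \<in> T" for t
    using T(2) by (metis subsetD)
  define N where "N = Max (insert 0 (n ` T))"
  have "T \<subseteq> span (x ` {..<N})"
  proof
    fix t assume t: "t \<in> T"
    then have "n t \<le> N" using T(1) by (simp add: N_def)
    then show "t \<in> span (x ` {..<N})"
      using n[OF t] span_mono[of "x ` {..<n t}" "x ` {..<N}"] by fastforce
  qed
  then have "T \<union> J \<subseteq> span (x ` {..<N} \<union> J)"
    using span_mono[of "x ` {..<N}" "x ` {..<N} \<union> J"] by (auto intro: span_base)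
  then have "span (T \<union> J) \<subseteq> span (x ` {..<N} \<union> J)" by (simp add: span_minimal)
  moreover have "x N \<in> span (range x)" by (simp add: span_base)
  ultimately show ?thesis using T(3) by blast
qed

end

context vector_space_pair
begin

lemma fd_mod_image:
  assumes "Vector_Spaces.linear s1 s2 f" "vs1.fd_mod J U" "f ` J \<subseteq> vs2.span K"
  shows "vs2.fd_mod K (f ` U)"
proof -
  obtain S where S: "finite S" "U \<subseteq> vs1.span (S \<union> J)"
    using assms(2) unfolding vs1.fd_mod_def by blast
  have "f ` U \<subseteq> f ` vs1.span (S \<union> J)" using S by blast
  also have "\<dots> = vs2.span (f ` S \<union> f ` J)"
    using linear_span_image[OF assms(1), of "S \<union> J"] by (simp add: image_Un)
  also have "\<dots> \<subseteq> vs2.span (f ` S \<union> K)"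
    using assms(3) vs2.span_mono[of K "f ` S \<union> K"]
    by (intro vs2.span_minimal) (auto intro: vs2.span_base)
  finally show ?thesis using S by (intro vs2.fd_modI[of "f ` S"]) auto
qed

text \<open>Rank-nullity for \<open>f\<close> read modulo \<open>J\<close>: lifts \<open>R\<close>
  of finitely many generators of the image, together with the part of \<open>U\<close> sent into
  \<open>span J\<close>, span \<open>U\<close>.\<close>

lemma fd_mod_kernel:
  assumes f: "Vector_Spaces.linear s1 s2 f" and U: "vs1.subspace U"
    and im: "vs2.fd_mod J (f ` U)" and ker: "vs1.fd_mod K {u \<in> U. f u \<in> vs2.span J}"
  shows "vs1.fd_mod K U"
proof -
  have "vs2.subspace (f ` U)" using linear_subspace_image[OF f U] .
  then obtain T where T: "finite T" "T \<subseteq> f ` U" "f ` U \<subseteq> vs2.span (T \<union> J)"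
    using vs2.fd_mod_basis[OF im] by metis
  then obtain R where R: "finite R" "R \<subseteq> U" "T = f ` R"
    using finite_subset_image by metis
  let ?N = "{u \<in> U. f u \<in> vs2.span J}"
  have "U \<subseteq> vs1.span (R \<union> ?N)"
  proof
    fix u assume u: "u \<in> U"
    then have "f u \<in> vs2.span (f ` R \<union> J)" using T R by blast
    then obtain a b where ab: "f u = a + b" "a \<in> vs2.span (f ` R)" "b \<in> vs2.span J"
      by (auto simp: vs2.span_Un)
    then obtain v where v: "v \<in> vs1.span R" "a = f v"
      using linear_span_image[OF f, of R] by blast
    then have "v \<in> U" using R U vs1.span_minimal by blast
    have "f (u - v) = b" using ab v linear_diff[OF f] by simp
    then have "u - v \<in> ?N" using ab u \<open>v \<in> U\<close> U by (simp add: vs1.subspace_diff)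
    then have "u - v \<in> vs1.span (R \<union> ?N)" "v \<in> vs1.span (R \<union> ?N)"
      using v vs1.span_mono[of R "R \<union> ?N"] by (auto intro: vs1.span_base)
    then show "u \<in> vs1.span (R \<union> ?N)" using vs1.span_add by fastforce
  qed
  then have "vs1.fd_mod ?N U" using R by (intro vs1.fd_modI)
  then show ?thesis using ker vs1.fd_mod_trans by blast
qed

end

section \<open>Enveloping algebras and the Poincare-Birkhoff-Witt theorem\<close>

definition word :: "'g list \<Rightarrow> 'g free_monoid \<Rightarrow>\<^sub>0 'k::field"
  where "word u = Poly_Mapping.single (Word u) 1"

definition pscale :: "'k::field \<Rightarrow> ('g free_monoid \<Rightarrow>\<^sub>0 'k) \<Rightarrow> 'g free_monoid \<Rightarrow>\<^sub>0 'k"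
  where "pscale c p = Poly_Mapping.single 0 c * p"

lemma gen_eq_word: "gen x = word [x]"
  by (simp add: gen_def word_def)

lemma word_append: "word (u @ v) = word u * word v"
  by (simp add: word_def mult_single plus_free_monoid_def)

lemma word_Nil: "word [] = 1"
  by (simp add: word_def flip: zero_free_monoid_def)

lemma word_Cons: "word (x # u) = gen x * word u"
  using word_append[of "[x]" u] by (simp add: gen_eq_word)

lemma lookup_pscale: "Poly_Mapping.lookup (pscale c p) w = c * Poly_Mapping.lookup p w"
  unfolding pscale_def mult_map_scale_conv_mult[symmetric]
  by (simp add: Poly_Mapping.map.rep_eq when_def)

lemma vector_space_pscale: "vector_space pscale"
  by unfold_locales
    (auto intro!: poly_mapping_eqI simp: lookup_pscale lookup_add algebra_simps)

lemma pscale_mult_left: "pscale c p * q = pscale c (p * q)"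
  by (simp add: pscale_def mult.assoc)

lemma poly_mapping_eq_sum_words:
  "q = (\<Sum>w\<in>Poly_Mapping.keys q. pscale (Poly_Mapping.lookup q w) (word (letters w)))"
  by (rule poly_mapping_eqI)
    (auto simp: lookup_sum lookup_pscale word_def lookup_single when_def in_keys_iff
      if_distrib[of "(*) _"] cong: if_cong)

lemma pscale_mult_right: "p * pscale c q = pscale c (p * q)"
proof -
  interpret vector_space pscale by (rule vector_space_pscale)
  have "pscale a (word u) * Poly_Mapping.single 0 c = Poly_Mapping.single 0 c * pscale a (word u)"
    for a and u :: "'a list"
    by (simp add: pscale_def word_def mult_single mult.commute)
  then have "p * Poly_Mapping.single 0 c = Poly_Mapping.single 0 c * p"
    by (subst (1 2) poly_mapping_eq_sum_words)
      (simp only: sum_distrib_left sum_distrib_right)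
  then show ?thesis by (simp add: pscale_def mult.assoc[symmetric])
qed

interpretation fa: vector_space pscale
  by (rule vector_space_pscale)

abbreviation free_carrier :: "'g set \<Rightarrow> ('g free_monoid \<Rightarrow>\<^sub>0 'k::field) set"
  where "free_carrier X \<equiv> carrier (free_algebra X)"

lemma free_algebra_simps [simp]:
  "monoid.mult (free_algebra X) = (*)" "one (free_algebra X) = 1"
  "zero (free_algebra X) = 0" "add (free_algebra X) = (+)"
  by (simp_all add: free_algebra_def fun_eq_iff)

lemma word_in_free: "word u \<in> free_carrier X \<longleftrightarrow> set u \<subseteq> X"
  by (simp add: free_algebra_def word_def)

lemma free_carrier_mono: "X \<subseteq> Y \<Longrightarrow> free_carrier X \<subseteq> free_carrier Y"
  by (auto simp: free_algebra_def)

lemma free_mult: "p \<in> free_carrier X \<Longrightarrow> q \<in> free_carrier X \<Longrightarrow> p * q \<in> free_carrier X"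
  using ring.ring_simprules(5)[OF ring_free_algebra[of X], of p q] by simp

lemma subspace_free:
  fixes X :: "'g set"
  shows "fa.subspace (free_carrier X :: ('g free_monoid \<Rightarrow>\<^sub>0 'k::field) set)"
proof (rule fa.subspaceI)
  show "0 \<in> free_carrier X" by (simp add: free_algebra_def)
  show "p + q \<in> free_carrier X" if "p \<in> free_carrier X" "q \<in> free_carrier X"
    for p q :: "'g free_monoid \<Rightarrow>\<^sub>0 'k"
    using ring.ring_simprules(1)[OF ring_free_algebra[of X] that] by simp
  show "pscale c p \<in> free_carrier X" if "p \<in> free_carrier X" for c and p :: "'g free_monoid \<Rightarrow>\<^sub>0 'k"
    unfolding pscale_def using that by (intro free_mult) (auto simp: free_algebra_def)
qed

lemma free_carrier_eq_span:
  fixes X :: "'g set"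
  shows "free_carrier X = (fa.span (word ` lists X) :: ('g free_monoid \<Rightarrow>\<^sub>0 'k::field) set)"
    (is "?F = ?S")
proof
  show "?S \<subseteq> ?F"
    by (intro fa.span_minimal subspace_free) (auto simp: word_in_free)
  show "?F \<subseteq> ?S"
  proof
    fix q :: "'g free_monoid \<Rightarrow>\<^sub>0 'k" assume q: "q \<in> free_carrier X"
    then have "word (letters w) \<in> word ` lists X" if "w \<in> Poly_Mapping.keys q" for w
      using that by (auto simp: free_algebra_def)
    then show "q \<in> ?S"
      by (subst poly_mapping_eq_sum_words) (intro fa.span_sum fa.span_scale fa.span_base)
  qed
qed

context lie_algebra
begin

definition uea_ideal :: "('g free_monoid \<Rightarrow>\<^sub>0 'k) set"
  where "uea_ideal = Idl\<^bsub>free_algebra L\<^esub> (uea_relations scale bracket L)"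

lemma gen_in_free: "x \<in> X \<Longrightarrow> gen x \<in> free_carrier X"
  by (simp add: gen_eq_word word_in_free)

lemma uea_relations_carrier: "uea_relations scale bracket L \<subseteq> free_carrier L"
  unfolding uea_relations_def
  by (auto intro!: fa.subspace_diff[OF subspace_free] free_mult gen_in_free bracket_closed
      subspace_add[OF L_subspace] subspace_scale[OF L_subspace]
      fa.subspace_scale[OF subspace_free] simp flip: pscale_def)

lemma ideal_uea_ideal: "ideal uea_ideal (free_algebra L)"
  unfolding uea_ideal_def
  by (rule ring.genideal_ideal[OF ring_free_algebra uea_relations_carrier])

lemma uea_relations_ideal: "uea_relations scale bracket L \<subseteq> uea_ideal"
  unfolding uea_ideal_def
  by (rule ring.genideal_self[OF ring_free_algebra uea_relations_carrier])

lemma uea_ideal_carrier: "uea_ideal \<subseteq> free_carrier L"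
  using additive_subgroup.a_subset[OF ideal.axioms(1)[OF ideal_uea_ideal]] .

lemma uea_ideal_mult:
  assumes "k \<in> uea_ideal" "p \<in> free_carrier L"
  shows "p * k \<in> uea_ideal" "k * p \<in> uea_ideal"
  using ideal.I_l_closed[OF ideal_uea_ideal assms] ideal.I_r_closed[OF ideal_uea_ideal assms]
  by simp_all

lemma subspace_uea_ideal: "fa.subspace uea_ideal"
proof (rule fa.subspaceI)
  interpret ideal uea_ideal "free_algebra L" by (rule ideal_uea_ideal)
  show "0 \<in> uea_ideal" using additive_subgroup.zero_closed[OF is_additive_subgroup] by simp
  show "p + q \<in> uea_ideal" if "p \<in> uea_ideal" "q \<in> uea_ideal" for p q
    using additive_subgroup.a_closed[OF is_additive_subgroup that] by simp
  show "pscale c p \<in> uea_ideal" if "p \<in> uea_ideal" for c p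
    unfolding pscale_def using that by (intro uea_ideal_mult) (auto simp: free_algebra_def)
qed

lemma uea_ideal_minimal:
  assumes "ideal I (free_algebra L)" "uea_relations scale bracket L \<subseteq> I"
  shows "uea_ideal \<subseteq> I"
  unfolding uea_ideal_def using assms ring.genideal_minimal[OF ring_free_algebra] by blast

end

text \<open>The larger ideal meets the smaller free algebra in an ideal that contains the relations
  of \<open>L\<close>. This makes U(L) \<rightarrow> U(L') well defined; its injectivity is a case
  of \<open>relatively_free\<close>.\<close>

lemma uea_ideal_mono:
  fixes scale :: "'k::field \<Rightarrow> 'g::ab_group_add \<Rightarrow> 'g"
  assumes "lie_algebra scale bracket L" "lie_algebra scale bracket L'" "L \<subseteq> L'"
  shows "lie_algebra.uea_ideal scale bracket L \<subseteq> lie_algebra.uea_ideal scale bracket L'"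
proof -
  interpret A: lie_algebra scale bracket L by fact
  interpret B: lie_algebra scale bracket L' by fact
  have sub: "free_carrier L \<subseteq> free_carrier L'" by (rule free_carrier_mono[OF assms(3)])
  interpret F: ring "free_algebra L" by (rule ring_free_algebra)
  interpret I: ideal B.uea_ideal "free_algebra L'" by (rule B.ideal_uea_ideal)
  have "ideal (B.uea_ideal \<inter> free_carrier L) (free_algebra L)"
  proof (rule idealI)
    show "subgroup (B.uea_ideal \<inter> free_carrier L) (add_monoid (free_algebra L))"
    proof (unfold_locales, goal_cases)
      case (2 x y)
      then show ?case
        using fa.subspace_add[OF B.subspace_uea_ideal, of x y] fa.subspace_add[OF subspace_free, of x L y]
        by simp
    next
      case (4 x)
      then have "x \<in> free_carrier L" by simp
      then have "inv\<^bsub>add_monoid (free_algebra L)\<^esub> x = - x"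
        using F.minus_equality[of "- x" x] fa.subspace_neg[OF subspace_free, of x L]
        by (simp add: a_inv_def)
      then show ?case
        using 4 fa.subspace_neg[OF B.subspace_uea_ideal, of x] fa.subspace_neg[OF subspace_free, of x L]
        by simp
    qed (auto intro: fa.subspace_0 subspace_free B.subspace_uea_ideal)
  next
    fix a x :: "'g free_monoid \<Rightarrow>\<^sub>0 'k"
    assume "a \<in> B.uea_ideal \<inter> free_carrier L" "x \<in> free_carrier L"
    then show "x \<otimes>\<^bsub>free_algebra L :: ('g free_monoid \<Rightarrow>\<^sub>0 'k) ring\<^esub> a \<in> B.uea_ideal \<inter> free_carrier L"
      "a \<otimes>\<^bsub>free_algebra L :: ('g free_monoid \<Rightarrow>\<^sub>0 'k) ring\<^esub> x \<in> B.uea_ideal \<inter> free_carrier L"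
      using sub B.uea_ideal_mult[of a x] by (auto simp: free_mult)
  qed (rule ring_free_algebra)
  moreover have "uea_relations scale bracket L \<subseteq> B.uea_ideal \<inter> free_carrier L"
  proof -
    have "uea_relations scale bracket L \<subseteq> uea_relations scale bracket L'"
      unfolding uea_relations_def using assms(3) by (intro Un_mono) blast+
    then show ?thesis using A.uea_relations_carrier B.uea_relations_ideal by blast
  qed
  ultimately show ?thesis using A.uea_ideal_minimal by blast
qed

section \<open>Modules over a Lie algebra and over its enveloping algebra\<close>

locale lie_representation = lie_algebra scale bracket L + V: vector_space vscale
  for scale :: "'k::field \<Rightarrow> 'g::ab_group_add \<Rightarrow> 'g" and bracket L
    and vscale :: "'k \<Rightarrow> 'v::ab_group_add \<Rightarrow> 'v" +
  fixes N :: "'v set" and \<rho> :: "'g \<Rightarrow> 'v \<Rightarrow> 'v"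
  assumes N_subspace: "V.subspace N"
    and rho_closed: "\<lbrakk>x \<in> L; v \<in> N\<rbrakk> \<Longrightarrow> \<rho> x v \<in> N"
    and rho_add: "\<lbrakk>x \<in> L; v \<in> N; u \<in> N\<rbrakk> \<Longrightarrow> \<rho> x (v + u) = \<rho> x v + \<rho> x u"
    and rho_scale: "\<lbrakk>x \<in> L; v \<in> N\<rbrakk> \<Longrightarrow> \<rho> x (vscale c v) = vscale c (\<rho> x v)"
    and rho_add_left: "\<lbrakk>x \<in> L; y \<in> L; v \<in> N\<rbrakk> \<Longrightarrow> \<rho> (x + y) v = \<rho> x v + \<rho> y v"
    and rho_scale_left: "\<lbrakk>x \<in> L; v \<in> N\<rbrakk> \<Longrightarrow> \<rho> (scale c x) v = vscale c (\<rho> x v)"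
    and rho_bracket: "\<lbrakk>x \<in> L; y \<in> L; v \<in> N\<rbrakk> \<Longrightarrow> \<rho> (bracket x y) v = \<rho> x (\<rho> y v) - \<rho> y (\<rho> x v)"
begin

text \<open>Words act by composition. The formula makes sense on all vectors, but products and
  relations are respected only on the carrier \<open>N\<close>, where the module laws hold;
  multilinear forms, the main instance, are a proper subspace of their function type.\<close>

definition act :: "('g free_monoid \<Rightarrow>\<^sub>0 'k) \<Rightarrow> 'v \<Rightarrow> 'v"
  where "act p v = (\<Sum>w\<in>Poly_Mapping.keys p.
    vscale (Poly_Mapping.lookup p w) (foldr \<rho> (letters w) v))"

lemma act_superset:
  assumes "finite W" "Poly_Mapping.keys p \<subseteq> W"
  shows "act p v = (\<Sum>w\<in>W. vscale (Poly_Mapping.lookup p w) (foldr \<rho> (letters w) v))"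
  unfolding act_def using assms
  by (intro sum.mono_neutral_left) (auto simp: in_keys_iff)

lemma act_add: "act (p + q) v = act p v + act q v"
proof -
  let ?W = "Poly_Mapping.keys p \<union> Poly_Mapping.keys q"
  have "Poly_Mapping.keys (p + q) \<subseteq> ?W" by (rule Poly_Mapping.keys_add)
  then show ?thesis
    by (subst (1 2 3) act_superset[of ?W])
      (auto simp: lookup_add V.scale_left_distrib sum.distrib)
qed

lemma act_pscale: "act (pscale c p) v = vscale c (act p v)"
proof -
  have "Poly_Mapping.keys (pscale c p) \<subseteq> Poly_Mapping.keys p"
    by (auto simp: in_keys_iff lookup_pscale)
  then show ?thesis
    by (subst act_superset[of "Poly_Mapping.keys p"])
      (auto simp: act_def lookup_pscale V.scale_sum_right)
qed

lemma act_diff: "act (p - q) v = act p v - act q v"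
  using act_add[of "p - q" q v] by (simp add: algebra_simps)

lemma act_zero: "act 0 v = 0"
  by (simp add: act_def)

lemma act_word: "act (word u) v = foldr \<rho> u v"
  by (simp add: act_def word_def)

lemma act_gen: "act (gen x) v = \<rho> x v"
  by (simp add: gen_eq_word act_word)

lemma foldr_closed: "set u \<subseteq> L \<Longrightarrow> v \<in> N \<Longrightarrow> foldr \<rho> u v \<in> N"
  by (induction u) (auto intro: rho_closed)

lemma foldr_add:
  "set u \<subseteq> L \<Longrightarrow> v \<in> N \<Longrightarrow> w \<in> N \<Longrightarrow> foldr \<rho> u (v + w) = foldr \<rho> u v + foldr \<rho> u w"
  by (induction u) (auto simp: rho_add foldr_closed)

lemma foldr_scale:
  "set u \<subseteq> L \<Longrightarrow> v \<in> N \<Longrightarrow> foldr \<rho> u (vscale c v) = vscale c (foldr \<rho> u v)"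
  by (induction u) (auto simp: rho_scale foldr_closed)

lemma act_closed:
  assumes "p \<in> free_carrier L" "v \<in> N" shows "act p v \<in> N"
  using assms(1) unfolding free_carrier_eq_span
proof (induction rule: fa.span_induct_alt)
  case base
  then show ?case using V.subspace_0[OF N_subspace] by (simp add: act_zero)
next
  case (step c x y)
  then obtain u where "x = word u" "set u \<subseteq> L" by auto
  with step show ?case using assms(2) foldr_closed
    by (auto simp: act_add act_pscale act_word
        intro!: V.subspace_add[OF N_subspace] V.subspace_scale[OF N_subspace])
qed

lemma act_mult:
  assumes "p \<in> free_carrier L" "q \<in> free_carrier L" "v \<in> N"
  shows "act (p * q) v = act p (act q v)"
  using assms(1) unfolding free_carrier_eq_span
proof (induction rule: fa.span_induct_alt)
  case base
  then show ?case by (simp add: act_zero)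
next
  case (step c x y)
  then obtain u where u: "x = word u" "set u \<subseteq> L" by auto
  have "act q v \<in> N \<and> act (word u * q) v = foldr \<rho> u (act q v)"
    using assms(2) unfolding free_carrier_eq_span
  proof (induction rule: fa.span_induct_alt)
    case base
    then show ?case using foldr_scale[OF u(2), of 0 0] V.subspace_0[OF N_subspace]
      by (simp add: act_zero)
  next
    case (step c z w)
    then obtain u' where u': "z = word u'" "set u' \<subseteq> L" by auto
    have "foldr \<rho> u' v \<in> N" using u' assms(3) foldr_closed by blast
    then show ?case
      using step u u' V.subspace_add[OF N_subspace] V.subspace_scale[OF N_subspace]
      by (simp add: distrib_left pscale_mult_right act_add act_pscale act_word foldr_add foldr_scale
          word_append[symmetric])
  qed
  then show ?case
    using step u by (simp add: distrib_right pscale_mult_left act_add act_pscale act_word)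
qed

lemma act_linear:
  assumes "p \<in> free_carrier L" "v \<in> N" "w \<in> N"
  shows "act p (v + w) = act p v + act p w" "act p (vscale c v) = vscale c (act p v)"
proof -
  have w: "set u \<subseteq> L" if "Word u \<in> Poly_Mapping.keys p" for u
    using assms(1) that by (force simp: free_algebra_def)
  show "act p (v + w) = act p v + act p w"
    unfolding act_def sum.distrib[symmetric]
  proof (intro sum.cong refl)
    fix u assume "u \<in> Poly_Mapping.keys p"
    then show "vscale (Poly_Mapping.lookup p u) (foldr \<rho> (letters u) (v + w)) =
      vscale (Poly_Mapping.lookup p u) (foldr \<rho> (letters u) v)
      + vscale (Poly_Mapping.lookup p u) (foldr \<rho> (letters u) w)"
      using w assms by (cases u) (auto simp: foldr_add V.scale_right_distrib)
  qed
  show "act p (vscale c v) = vscale c (act p v)"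
    unfolding act_def V.scale_sum_right
  proof (intro sum.cong refl)
    fix u assume "u \<in> Poly_Mapping.keys p"
    then show "vscale (Poly_Mapping.lookup p u) (foldr \<rho> (letters u) (vscale c v)) =
      vscale c (vscale (Poly_Mapping.lookup p u) (foldr \<rho> (letters u) v))"
      using w assms by (cases u) (auto simp: foldr_scale V.scale_left_commute mult.commute)
  qed
qed

text \<open>The elements that annihilate \<open>N\<close> form a two-sided ideal, and the module
  laws say that it contains the defining relations. So \<open>act\<close> factors through
  U(L).\<close>

lemma act_uea_ideal:
  assumes "p \<in> uea_ideal" "v \<in> N" shows "act p v = 0"
proof -
  let ?I = "{p \<in> free_carrier L. \<forall>v\<in>N. act p v = 0}"
  interpret F: ring "free_algebra L" by (rule ring_free_algebra)
  have zero: "act p 0 = 0" if "p \<in> free_carrier L" for p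
    using act_linear(2)[OF that, of 0 0 0] V.subspace_0[OF N_subspace] by simp
  have "ideal ?I (free_algebra L)"
  proof (rule idealI)
    show "subgroup ?I (add_monoid (free_algebra L))"
    proof (unfold_locales, goal_cases)
      case (2 x y)
      then show ?case using fa.subspace_add[OF subspace_free, of x L y] by (simp add: act_add)
    next
      case (4 x)
      then have "inv\<^bsub>add_monoid (free_algebra L)\<^esub> x = - x"
        using F.minus_equality[of "- x" x] fa.subspace_neg[OF subspace_free, of x L]
        by (simp add: a_inv_def)
      then show ?case
        using 4 fa.subspace_neg[OF subspace_free, of x L] act_diff[of 0 x] by (simp add: act_zero)
    qed (auto intro: fa.subspace_0 subspace_free simp: act_zero)
  qed (auto intro!: free_mult ring_free_algebra simp: act_mult act_closed zero)
  moreover have "uea_relations scale bracket L \<subseteq> ?I"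
  proof
    fix r assume r: "r \<in> uea_relations scale bracket L"
    then have "act r v = 0" if "v \<in> N" for v
      using that unfolding uea_relations_def
      by (auto simp: act_diff act_gen act_mult gen_in_free
        act_pscale rho_add_left rho_scale_left rho_bracket simp flip: pscale_def)
    then show "r \<in> ?I" using r uea_relations_carrier by blast
  qed
  ultimately have "uea_ideal \<subseteq> ?I" by (rule uea_ideal_minimal)
  then show ?thesis using assms by blast
qed

end

text \<open>Bubble sort: the first letter of \<open>u\<close> occurs in \<open>v\<close> and is
  carried to its place there by \<open>front\<close>; the remaining letters are left to the
  induction hypothesis, behind a longer prefix \<open>p\<close>.\<close>

lemma mset_eq_adjacent_swaps:
  assumes refl: "\<And>u. set u \<subseteq> X \<Longrightarrow> R u u"
    and trans: "\<And>u v w. R u v \<Longrightarrow> R v w \<Longrightarrow> R u w"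
    and swap: "\<And>p x y s. set (p @ [x, y] @ s) \<subseteq> X \<Longrightarrow> R (p @ [x, y] @ s) (p @ [y, x] @ s)"
    and "mset u = mset v" "set u \<subseteq> X"
  shows "R u v"
proof -
  have front: "R (p @ x # u @ v) (p @ u @ x # v)" if "set (p @ x # u @ v) \<subseteq> X" for p x u v
    using that
  proof (induction u arbitrary: p)
    case Nil
    then show ?case using refl by simp
  next
    case (Cons y u)
    have "R (p @ [x, y] @ (u @ v)) (p @ [y, x] @ (u @ v))"
      using Cons.prems by (intro swap) auto
    moreover have "R ((p @ [y]) @ x # u @ v) ((p @ [y]) @ u @ x # v)"
      using Cons.prems by (intro Cons.IH) auto
    ultimately show ?case using trans by simp
  qed
  have "R (p @ u) (p @ v)" if "mset u = mset v" "set (p @ u) \<subseteq> X" for p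
    using that
  proof (induction u arbitrary: p v)
    case Nil
    then show ?case using refl by simp
  next
    case (Cons x u)
    then have "x \<in> set v" by (metis list.set_intros(1) mset_eq_setD)
    then obtain a b where v: "v = a @ x # b" by (meson split_list)
    then have "mset u = mset (a @ b)" using Cons.prems by simp
    then have 1: "R ((p @ [x]) @ u) ((p @ [x]) @ (a @ b))"
      using Cons.prems by (intro Cons.IH) auto
    have "set (p @ x # a @ b) \<subseteq> X"
      using Cons.prems mset_eq_setD[OF Cons.prems(1)] by (auto simp: v)
    then have "R (p @ x # a @ b) (p @ a @ x # b)" by (rule front)
    then show ?case using trans 1 v by simp
  qed
  from this[of "[]"] show ?thesis using assms by simp
qed

text \<open>An arbitrary choice of one word per multiset does the work of a linear order on the
  basis: PBW needs one representative for each multiset of letters, not a particular one.\<close>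

definition list_of :: "'x multiset \<Rightarrow> 'x list"
  where "list_of \<mu> = (SOME u. mset u = \<mu>)"

lemma mset_list_of [simp]: "mset (list_of \<mu>) = \<mu>"
  unfolding list_of_def by (rule someI_ex[OF ex_mset])

lemma set_list_of [simp]: "set (list_of \<mu>) = set_mset \<mu>"
  by (metis mset_list_of set_mset_mset)

lemma length_list_of [simp]: "length (list_of \<mu>) = size \<mu>"
  by (metis mset_list_of size_mset)

lemma list_of_empty [simp]: "list_of {#} = []"
  by (metis mset_list_of mset_zero_iff)

text \<open>With the letters of \<open>Y\<close> in front, each sorted word of U(G) factors as a
  sorted word of U(H) followed by a sorted word in the remaining basis letters.\<close>

definition split_word :: "'x set \<Rightarrow> 'x multiset \<Rightarrow> 'x list"
  where "split_word Y \<mu> = list_of (filter_mset (\<lambda>x. x \<in> Y) \<mu>) @ list_of (filter_mset (\<lambda>x. x \<notin> Y) \<mu>)"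

lemma mset_split_word [simp]: "mset (split_word Y \<mu>) = \<mu>"
  by (simp add: split_word_def flip: multiset_partition)

text \<open>The coefficients vanish off \<open>B\<close> so that several such sums can be extended
  to a common finite index set.\<close>

lemma (in vector_space) span_subspace_Un_image:
  assumes "subspace K" "p \<in> span (K \<union> f ` A)"
  shows "\<exists>B c. finite B \<and> B \<subseteq> A \<and> (\<forall>b. b \<notin> B \<longrightarrow> c b = 0) \<and> p - (\<Sum>b\<in>B. scale (c b) (f b)) \<in> K"
  using assms(2)
proof (induction rule: span_induct_alt)
  case base
  show ?case using subspace_0[OF assms(1)] by (intro exI[of _ "{}"] exI[of _ "\<lambda>_. 0"]) auto
next
  case (step a x y)
  then obtain B c where B: "finite B" "B \<subseteq> A" "\<forall>b. b \<notin> B \<longrightarrow> c b = 0"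
    "y - (\<Sum>b\<in>B. scale (c b) (f b)) \<in> K" by blast
  from step(1) show ?case
  proof
    assume "x \<in> K"
    then have "scale a x + (y - (\<Sum>b\<in>B. scale (c b) (f b))) \<in> K"
      using B assms(1) by (intro subspace_add subspace_scale)
    then show ?thesis using B by (intro exI[of _ B] exI[of _ c]) (simp add: algebra_simps)
  next
    assume "x \<in> f ` A"
    then obtain b where b: "b \<in> A" "x = f b" by blast
    let ?c = "c(b := c b + a)"
    have "(\<Sum>i\<in>insert b B. scale (?c i) (f i)) =
      (\<Sum>i\<in>insert b B. scale (c i) (f i) + (if i = b then scale a (f b) else 0))"
      by (intro sum.cong) (auto simp: scale_left_distrib)
    also have "\<dots> = (\<Sum>i\<in>insert b B. scale (c i) (f i)) + scale a (f b)"
      using B by (simp add: sum.distrib)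
    also have "(\<Sum>i\<in>insert b B. scale (c i) (f i)) = (\<Sum>i\<in>B. scale (c i) (f i))"
      using B by (intro sum.mono_neutral_right) auto
    finally show ?thesis using B b
      by (intro exI[of _ "insert b B"] exI[of _ ?c]) (simp add: algebra_simps)
  qed
qed

context lie_algebra
begin

lemma span_ideal_mult:
  assumes "p \<in> fa.span (uea_ideal \<union> A)" "q \<in> fa.span (uea_ideal \<union> B)"
    "A \<subseteq> free_carrier L" "B \<subseteq> free_carrier L"
  shows "p * q \<in> fa.span (uea_ideal \<union> {a * b | a b. a \<in> A \<and> b \<in> B})" (is "_ \<in> fa.span ?S")
proof -
  have sub: "fa.span (uea_ideal \<union> B) \<subseteq> free_carrier L"
    using assms uea_ideal_carrier by (intro fa.span_minimal subspace_free) auto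
  show ?thesis using assms(1)
  proof (induction rule: fa.span_induct_alt)
    case base
    then show ?case by (simp add: fa.span_zero)
  next
    case (step c x y)
    have "x * q \<in> fa.span ?S"
    proof (cases "x \<in> uea_ideal")
      case True
      then have "x * q \<in> uea_ideal" using uea_ideal_mult sub assms(2) by blast
      then show ?thesis by (auto intro: fa.span_base)
    next
      case False
      then have x: "x \<in> A" using step by blast
      show ?thesis using assms(2)
      proof (induction rule: fa.span_induct_alt)
        case base
        then show ?case by (simp add: fa.span_zero)
      next
        case (step d z w)
        have "x * z \<in> ?S" using step(1)
        proof
          assume "z \<in> uea_ideal"
          then show ?thesis using uea_ideal_mult x assms(3) by blast
        qed (use x in blast)
        then show ?case using step(2)
          by (simp add: distrib_left pscale_mult_right fa.span_add fa.span_scale fa.span_base)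
      qed
    qed
    then show ?case using step
      by (simp add: distrib_right pscale_mult_left fa.span_add fa.span_scale)
  qed
qed

lemma uea_ideal_relations:
  assumes "x \<in> L" "y \<in> L"
  shows "gen (x + y) - gen x - gen y \<in> uea_ideal"
    "gen (scale c x) - pscale c (gen x) \<in> uea_ideal"
    "gen x * gen y - gen y * gen x - gen (bracket x y) \<in> uea_ideal"
proof -
  show "gen (x + y) - gen x - gen y \<in> uea_ideal"
    by (rule subsetD[OF uea_relations_ideal], unfold uea_relations_def, rule UnI1, rule UnI1)
      (use assms in blast)
  show "gen (scale c x) - pscale c (gen x) \<in> uea_ideal"
    by (rule subsetD[OF uea_relations_ideal], unfold uea_relations_def pscale_def, rule UnI1, rule UnI2)
      (use assms in blast)
  show "gen x * gen y - gen y * gen x - gen (bracket x y) \<in> uea_ideal"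
    by (rule subsetD[OF uea_relations_ideal], unfold uea_relations_def, rule UnI2)
      (use assms in blast)
qed

lemma gen_span:
  assumes "x \<in> span X" "X \<subseteq> L"
  shows "gen x \<in> fa.span (uea_ideal \<union> gen ` X)"
proof -
  let ?S = "fa.span (uea_ideal \<union> gen ` X)"
  have K: "k \<in> ?S" if "k \<in> uea_ideal" for k using that by (auto intro: fa.span_base)
  have "x \<in> L \<and> gen x \<in> ?S"
    using assms(1)
  proof (induction rule: span_induct_alt)
    case base
    have "gen (scale 0 0) - pscale 0 (gen 0) \<in> uea_ideal"
      using subspace_0[OF L_subspace] by (intro uea_ideal_relations(2))
    then show ?case using K subspace_0[OF L_subspace] by simp
  next
    case (step c y z)
    then have y: "y \<in> L" "scale c y \<in> L" using assms(2) L_subspace subspace_scale by blast+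
    have yS: "pscale c (gen y) \<in> ?S"
      using step by (intro fa.span_scale fa.span_base) auto
    have "gen (scale c y + z) = (gen (scale c y + z) - gen (scale c y) - gen z)
        + (gen (scale c y) - pscale c (gen y)) + pscale c (gen y) + gen z" by simp
    moreover have "\<dots> \<in> ?S"
      using step y yS by (intro fa.span_add) (auto intro!: K uea_ideal_relations)
    ultimately show ?case using step y subspace_add[OF L_subspace] by auto
  qed
  then show ?thesis by blast
qed

text \<open>Multilinear expansion letter by letter. The length is recorded because the sorting
  argument inducts on it.\<close>

lemma word_span:
  assumes "set u \<subseteq> span X" "X \<subseteq> L"
  shows "word u \<in> fa.span (uea_ideal \<union> word ` {v. set v \<subseteq> X \<and> length v = length u})"
  using assms(1)
proof (induction u)
  case Nil
  then show ?case by (auto intro!: fa.span_base)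
next
  case (Cons x u)
  let ?A = "gen ` X :: ('g free_monoid \<Rightarrow>\<^sub>0 'k) set"
    and ?B = "word ` {v. set v \<subseteq> X \<and> length v = length u} :: ('g free_monoid \<Rightarrow>\<^sub>0 'k) set"
  have "gen x * word u \<in> fa.span (uea_ideal \<union> {a * b |a b. a \<in> ?A \<and> b \<in> ?B})"
    using Cons assms(2)
    by (intro span_ideal_mult gen_span) (auto simp: word_in_free gen_in_free)
  moreover have "{a * b |a b. a \<in> ?A \<and> b \<in> ?B}
      \<subseteq> word ` {v. set v \<subseteq> X \<and> length v = length (x # u)}"
  proof safe
    fix y v assume "y \<in> X" "set v \<subseteq> X" "length v = length u"
    then show "gen y * word v \<in> (word :: _ \<Rightarrow> 'g free_monoid \<Rightarrow>\<^sub>0 'k) ` {v. set v \<subseteq> X \<and> length v = length (x # u)}"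
      by (intro image_eqI[of _ _ "y # v"]) (auto simp: word_Cons)
  qed
  then have "fa.span (uea_ideal \<union> {a * b |a b. a \<in> ?A \<and> b \<in> ?B})
      \<subseteq> fa.span (uea_ideal \<union> word ` {v. set v \<subseteq> X \<and> length v = length (x # u)})"
    by (intro fa.span_mono Un_mono order_refl)
  ultimately show ?case unfolding word_Cons by blast
qed

text \<open>Swapping adjacent letters changes a word by an element of the ideal and by a word one
  letter shorter, in which a bracket replaces the pair. Brackets leave \<open>X\<close>, so the
  induction on length runs over words in \<open>L\<close>, and \<open>word_span\<close> leads back
  to letters in \<open>X\<close>.\<close>

lemma word_in_span_sorted:
  fixes r :: "'g multiset \<Rightarrow> 'g list"
  assumes "X \<subseteq> L" "L \<subseteq> span X" "\<And>\<mu>. mset (r \<mu>) = \<mu>" "set u \<subseteq> L"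
  shows "word u \<in> fa.span (uea_ideal \<union> word ` r ` {\<mu>. set_mset \<mu> \<subseteq> X \<and> size \<mu> \<le> length u})"
  using assms(4)
proof (induction "length u" arbitrary: u rule: less_induct)
  case less
  define n where "n = length u"
  define V where "V n = fa.span (uea_ideal \<union> word ` r ` {\<mu>. set_mset \<mu> \<subseteq> X \<and> size \<mu> \<le> n})" for n
  have mono: "V m \<subseteq> V m'" if "m \<le> m'" for m m'
    unfolding V_def using that by (intro fa.span_mono) auto
  have low: "word v \<in> V n" if "length v < n" "set v \<subseteq> L" for v
  proof -
    have "word v \<in> V (length v)"
      using less that by (simp add: V_def n_def)
    then show ?thesis using mono that by (meson less_imp_le subsetD)
  qed
  have "word v \<in> V n" if v: "set v \<subseteq> X" "length v = n" for v
  proof -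
    have "length v = n \<longrightarrow> word v - word (r (mset v)) \<in> V n"
    proof (rule mset_eq_adjacent_swaps[where X = X and
          R = "\<lambda>u v. length u = length v \<and> (length u = n \<longrightarrow> word u - word v \<in> V n)", THEN conjunct2])
      fix u v w :: "'g list"
      assume "length u = length v \<and> (length u = n \<longrightarrow> word u - word v \<in> V n)"
        "length v = length w \<and> (length v = n \<longrightarrow> word v - word w \<in> V n)"
      then show "length u = length w \<and> (length u = n \<longrightarrow> word u - word w \<in> V n)"
        using fa.span_add[of "word u - word v" _ "word v - word w"] by (auto simp: V_def)
    next
      fix p x y s
      assume X: "set (p @ [x, y] @ s) \<subseteq> X"
      let ?k = "gen x * gen y - gen y * gen x - gen (bracket x y)"
      have L: "x \<in> L" "y \<in> L" "set p \<subseteq> L" "set s \<subseteq> L" using X assms(1) by auto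
      have "?k \<in> uea_ideal"
        using L by (intro uea_ideal_relations(3))
      then have "word p * ?k * word s \<in> uea_ideal"
        using L by (intro uea_ideal_mult) (auto simp: word_in_free)
      then have 1: "word p * ?k * word s \<in> V n" by (auto simp: V_def intro: fa.span_base)
      have 2: "word (p @ [bracket x y] @ s) \<in> V n"
        if "length (p @ [x, y] @ s) = n"
        using that L bracket_closed by (intro low) auto
      have 3: "word (p @ [x, y] @ s) - word (p @ [y, x] @ s)
          = word p * ?k * word s + word (p @ [bracket x y] @ s)"
        by (simp add: word_append word_Cons word_Nil algebra_simps)
      show "length (p @ [x, y] @ s) = length (p @ [y, x] @ s) \<and>
          (length (p @ [x, y] @ s) = n \<longrightarrow> word (p @ [x, y] @ s) - word (p @ [y, x] @ s) \<in> V n)"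
      proof (intro conjI impI)
        assume "length (p @ [x, y] @ s) = n"
        then show "word (p @ [x, y] @ s) - word (p @ [y, x] @ s) \<in> V n"
          unfolding 3 using 1 2 unfolding V_def by (intro fa.span_add)
      qed simp
    qed (use v assms(3) in \<open>auto simp: V_def fa.span_zero\<close>)
    moreover have "word (r (mset v)) \<in> V n"
      unfolding V_def using v by (intro fa.span_base) auto
    ultimately show ?thesis using v fa.span_add[of "word v - word (r (mset v))" _ "word (r (mset v))"]
      by (simp add: V_def)
  qed
  then have "uea_ideal \<union> word ` {v. set v \<subseteq> X \<and> length v = length u} \<subseteq> V n"
    by (auto simp: V_def n_def intro: fa.span_base)
  then have "fa.span (uea_ideal \<union> word ` {v. set v \<subseteq> X \<and> length v = length u}) \<subseteq> V n"
    unfolding V_def by (intro fa.span_minimal) auto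
  then show ?case
    using word_span[of u X] less.prems assms unfolding V_def n_def by blast
qed

lemma free_carrier_in_span_sorted:
  assumes "X \<subseteq> L" "L \<subseteq> span X" "\<And>\<mu>. mset (r \<mu>) = \<mu>"
  shows "free_carrier L \<subseteq> fa.span (uea_ideal \<union> word ` r ` {\<mu>. set_mset \<mu> \<subseteq> X})"
  unfolding free_carrier_eq_span
proof (intro fa.span_minimal image_subsetI)
  fix u assume "u \<in> lists L"
  then have "word u \<in> fa.span (uea_ideal \<union> word ` r ` {\<mu>. set_mset \<mu> \<subseteq> X \<and> size \<mu> \<le> length u})"
    using assms by (intro word_in_span_sorted) auto
  moreover have "fa.span (uea_ideal \<union> word ` r ` {\<mu>. set_mset \<mu> \<subseteq> X \<and> size \<mu> \<le> length u})
    \<subseteq> fa.span (uea_ideal \<union> word ` r ` {\<mu>. set_mset \<mu> \<subseteq> X})" by (intro fa.span_mono) auto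
  ultimately show "word u \<in> fa.span (uea_ideal \<union> word ` r ` {\<mu>. set_mset \<mu> \<subseteq> X})" by blast
qed (rule fa.subspace_span)

end

section \<open>Linear independence of sorted words, for Lie algebras of derivations\<close>

locale char_0_algebra = assoc_algebra scale
  for scale :: "'k::field_char_0 \<Rightarrow> 'a::ring_1 \<Rightarrow> 'a"

text \<open>The number of bijections from the positions of a word onto \<open>S\<close> that respect the labels \<open>l\<close>.\<close>

fun matchings :: "('i \<Rightarrow> 'x) \<Rightarrow> 'x list \<Rightarrow> 'i set \<Rightarrow> nat" where
  "matchings l [] S = (if S = {} then 1 else 0)"
| "matchings l (x # u) S = (\<Sum>i\<in>{i\<in>S. l i = x}. matchings l u (S - {i}))"

lemma matchings_nonzero_iff:
  "finite S \<Longrightarrow> matchings l u S \<noteq> 0 \<longleftrightarrow> image_mset l (mset_set S) = mset u"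
proof (induction u arbitrary: S)
  case Nil
  then show ?case by (simp add: mset_set_empty_iff)
next
  case (Cons x u)
  have *: "image_mset l (mset_set S) = add_mset (l i) (image_mset l (mset_set (S - {i})))" if "i \<in> S" for i
    using that Cons.prems by (simp add: mset_set.remove)
  have "matchings l (x # u) S \<noteq> 0 \<longleftrightarrow> (\<exists>i\<in>S. l i = x \<and> image_mset l (mset_set (S - {i})) = mset u)"
    using Cons by auto
  also have "\<dots> \<longleftrightarrow> image_mset l (mset_set S) = mset (x # u)"
  proof
    assume "image_mset l (mset_set S) = mset (x # u)"
    moreover from this have "x \<in># image_mset l (mset_set S)" by simp
    then obtain i where "i \<in> S" "l i = x" using Cons.prems by auto
    ultimately show "\<exists>i\<in>S. l i = x \<and> image_mset l (mset_set (S - {i})) = mset u"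
      using * by force
  qed (use * in auto)
  finally show ?case .
qed

lemma matchings_short: "finite S \<Longrightarrow> length u < card S \<Longrightarrow> matchings l u S = 0"
  using matchings_nonzero_iff[of S l u] by (metis less_irrefl size_image_mset size_mset size_mset_set)

context char_0_algebra
begin

text \<open>These are the linear forms on the tensor power, indexed by \<open>I\<close>, of the
  space of maps from A to A; the arguments outside \<open>I\<close> are mere parameters.\<close>

definition multilinear :: "nat set \<Rightarrow> ((nat \<Rightarrow> 'a \<Rightarrow> 'a) \<Rightarrow> 'k) set"
  where "multilinear I = {f. \<forall>T. \<forall>i\<in>I. \<forall>a b c.
    f (T(i := a + b)) = f (T(i := a)) + f (T(i := b)) \<and>
    f (T(i := fun_scale scale c a)) = c * f (T(i := a))}"

text \<open>The action dual to composition from the left in one slot at a time. The sign makes it a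
  left action: without it, \<open>slotwise_commutator\<close> would come out with the opposite
  bracket.\<close>

definition slotwise :: "nat set \<Rightarrow> ('a \<Rightarrow> 'a) \<Rightarrow> ((nat \<Rightarrow> 'a \<Rightarrow> 'a) \<Rightarrow> 'k) \<Rightarrow> (nat \<Rightarrow> 'a \<Rightarrow> 'a) \<Rightarrow> 'k"
  where "slotwise I x f = (\<lambda>T. - (\<Sum>i\<in>I. f (T(i := x \<circ> T i))))"

lemma multilinearD:
  assumes "f \<in> multilinear I" "i \<in> I"
  shows "f (T(i := a + b)) = f (T(i := a)) + f (T(i := b))"
    "f (T(i := fun_scale scale c a)) = c * f (T(i := a))"
    "f (T(i := a - b)) = f (T(i := a)) - f (T(i := b))"
proof -
  have *: "f (T(i := a + b)) = f (T(i := a)) + f (T(i := b))" for a b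
    using assms unfolding multilinear_def by blast
  show "f (T(i := a + b)) = f (T(i := a)) + f (T(i := b))"
    "f (T(i := fun_scale scale c a)) = c * f (T(i := a))"
    using assms unfolding multilinear_def by blast+
  show "f (T(i := a - b)) = f (T(i := a)) - f (T(i := b))"
    using *[of "a - b" b] by (simp add: algebra_simps)
qed

lemma slotwise_multilinear:
  assumes x: "x \<in> Der scale" and f: "f \<in> multilinear I" and "finite I"
  shows "slotwise I x f \<in> multilinear I"
proof -
  note D = DerD[OF x] and M = multilinearD[OF f]
  have comp: "x \<circ> (a + b) = (x \<circ> a) + (x \<circ> b)" "x \<circ> fun_scale scale c a = fun_scale scale c (x \<circ> a)" for a b :: "'a \<Rightarrow> 'a" and c
    by (auto simp: fun_eq_iff D fun_scale_def)
  have *: "(\<Sum>i\<in>I. f ((T(j := t))(i := x \<circ> (T(j := t)) i)))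
      = f (T(j := x \<circ> t)) + (\<Sum>i\<in>I - {j}. f (T(i := x \<circ> T i, j := t)))" if "j \<in> I" for j t T
    using that assms(3) by (subst sum.remove[of I j])
      (auto intro!: sum.cong simp: fun_upd_twist)
  have slot: "slotwise I x f (T(j := t))
      = - (f (T(j := x \<circ> t)) + (\<Sum>i\<in>I - {j}. f (T(i := x \<circ> T i, j := t))))" if "j \<in> I" for j t T
    unfolding slotwise_def *[OF that] ..
  show ?thesis
    unfolding multilinear_def
    by (auto simp: slot M comp sum.distrib sum_distrib_left algebra_simps)
qed

lemma slotwise_commutator:
  assumes f: "f \<in> multilinear I" and "finite I"
  shows "slotwise I (commutator x y) f = slotwise I x (slotwise I y f) - slotwise I y (slotwise I x f)"
proof
  fix T
  \<comment> \<open>\<open>P\<close> collects the terms in which \<open>x\<close> and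
    \<open>y\<close> hit different slots; they are symmetric in \<open>x\<close> and
    \<open>y\<close> and cancel. \<open>Q\<close> collects those in which both hit the same slot,
    \<open>x\<close> before \<open>y\<close> in the argument of \<open>Q x y\<close>.\<close>
  define P where "P x y = (\<Sum>i\<in>I. \<Sum>j\<in>I - {i}. f (T(i := x \<circ> T i, j := y \<circ> T j)))" for x y
  define Q where "Q x y = (\<Sum>i\<in>I. f (T(i := y \<circ> x \<circ> T i)))" for x y :: "'a \<Rightarrow> 'a"
  have *: "slotwise I x (slotwise I y f) T = Q x y + P x y" for x y
  proof -
    have "slotwise I x (slotwise I y f) T
        = (\<Sum>i\<in>I. \<Sum>j\<in>I. f (T(i := x \<circ> T i, j := y \<circ> (T(i := x \<circ> T i)) j)))"
      by (simp add: slotwise_def sum_negf)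
    also have "\<dots> = (\<Sum>i\<in>I. f (T(i := y \<circ> x \<circ> T i))
        + (\<Sum>j\<in>I - {i}. f (T(i := x \<circ> T i, j := y \<circ> T j))))"
      using \<open>finite I\<close> by (intro sum.cong refl, subst sum.remove) (auto simp: o_assoc intro!: sum.cong)
    finally show ?thesis by (simp add: P_def Q_def sum.distrib)
  qed
  have "P x y = (\<Sum>i\<in>I. \<Sum>j\<in>I. if i = j then 0 else f (T(i := x \<circ> T i, j := y \<circ> T j)))" for x y
    unfolding P_def using \<open>finite I\<close>
    by (intro sum.cong refl sum.mono_neutral_cong_left) auto
  note P = this
  have "P x y = P y x"
    unfolding P by (subst sum.swap) (auto intro!: sum.cong simp: fun_upd_twist)
  moreover have "commutator x y \<circ> t = (x \<circ> y \<circ> t) - (y \<circ> x \<circ> t)" for t :: "'a \<Rightarrow> 'a"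
    by (auto simp: commutator_def fun_eq_iff)
  then have "slotwise I (commutator x y) f T = Q x y - Q y x"
    by (simp add: slotwise_def Q_def multilinearD[OF f] sum_subtractf)
  ultimately show "slotwise I (commutator x y) f T
      = (slotwise I x (slotwise I y f) - slotwise I y (slotwise I x f)) T"
    by (simp add: *)
qed

lemma lie_representation_slotwise:
  assumes "lie_algebra (fun_scale scale) commutator G" "G \<subseteq> Der scale" "finite I"
  shows "lie_representation (fun_scale scale) commutator G (\<lambda>c f T. c * f T) (multilinear I) (slotwise I)"
proof -
  interpret lie_algebra "fun_scale scale" commutator G by fact
  interpret V: vector_space "\<lambda>c f (T :: nat \<Rightarrow> 'a \<Rightarrow> 'a). c * f T :: 'k"
    by unfold_locales (auto simp: fun_eq_iff algebra_simps)
  show ?thesis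
  proof unfold_locales
    show "V.subspace (multilinear I)"
      by (rule V.subspaceI) (auto simp: multilinear_def algebra_simps)
    show "slotwise I x v \<in> multilinear I" if "x \<in> G" "v \<in> multilinear I" for x v
      using that assms slotwise_multilinear by blast
    show "slotwise I (commutator x y) v = slotwise I x (slotwise I y v) - slotwise I y (slotwise I x v)"
      if "v \<in> multilinear I" for x y v using slotwise_commutator that assms by blast
    fix x y v c assume "v \<in> multilinear I"
    note M = multilinearD[OF this]
    have comp: "(x + y) \<circ> a = (x \<circ> a) + (y \<circ> a)" "fun_scale scale c x \<circ> a = fun_scale scale c (x \<circ> a)"
      for a :: "'a \<Rightarrow> 'a" by (auto simp: fun_eq_iff fun_scale_def)
    show "slotwise I (x + y) v = slotwise I x v + slotwise I y v"
      "slotwise I (fun_scale scale c x) v = (\<lambda>T. c * slotwise I x v T)"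
      by (auto simp: slotwise_def comp M sum.distrib fun_eq_iff sum_distrib_left)
  qed (auto simp: slotwise_def fun_eq_iff sum.distrib sum_distrib_left)
qed

text \<open>Since \<open>\<phi> i\<close> vanishes at \<open>id\<close>, every slot of
  \<open>S\<close> must be hit, and a word no longer than \<open>card S\<close> can afford only one
  hit per slot; a hit by \<open>x\<close> survives only in a slot labelled \<open>x\<close>. The
  general \<open>T\<close> is what the induction meets once some slots are filled.\<close>

lemma foldr_slotwise:
  fixes \<phi> :: "nat \<Rightarrow> ('a \<Rightarrow> 'a) \<Rightarrow> 'k"
  assumes "finite I" "\<And>i. i \<in> I \<Longrightarrow> \<phi> i id = 0"
    and "\<And>i x. i \<in> I \<Longrightarrow> x \<in> X \<Longrightarrow> \<phi> i x = (if l i = x then 1 else 0)"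
    and "set u \<subseteq> X" "S \<subseteq> I" "length u \<le> card S" "\<And>i. i \<in> S \<Longrightarrow> T i = id"
  shows "foldr (slotwise I) u (\<lambda>T. \<Prod>i\<in>I. \<phi> i (T i)) T
    = (- 1) ^ length u * of_nat (matchings l u S) * (\<Prod>i\<in>I - S. \<phi> i (T i))"
  using assms(4-)
proof (induction u arbitrary: S T)
  case Nil
  show ?case
  proof (cases "S = {}")
    case False
    then obtain i where i: "i \<in> S" by blast
    have "\<phi> i (T i) = 0" using assms(2)[of i] Nil.prems(2) i by (simp only: Nil.prems(4)[OF i] subset_iff)
    then have "(\<Prod>i\<in>I. \<phi> i (T i)) = 0"
      using i Nil.prems(2) assms(1) by (intro prod_zero) auto
    then show ?thesis using False by simp
  qed simp
next
  case (Cons x u)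
  let ?f = "foldr (slotwise I) u (\<lambda>T. \<Prod>i\<in>I. \<phi> i (T i))"
  have fin: "finite S" using Cons assms(1) finite_subset by blast
  \<comment> \<open>A letter spent outside \<open>S\<close> leaves too few letters to hit all of
    \<open>S\<close>.\<close>
  have out: "?f (T(i := x \<circ> T i)) = 0" if "i \<in> I - S" for i
  proof -
    have "?f (T(i := x \<circ> T i)) = (- 1) ^ length u * of_nat (matchings l u S)
        * (\<Prod>j\<in>I - S. \<phi> j ((T(i := x \<circ> T i)) j))"
      using Cons.prems that by (intro Cons.IH) auto
    then show ?thesis using matchings_short[of S u l] fin Cons.prems by simp
  qed
  have inn: "?f (T(i := x \<circ> T i)) = (- 1) ^ length u
      * of_nat (if l i = x then matchings l u (S - {i}) else 0) * (\<Prod>j\<in>I - S. \<phi> j (T j))"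
    if i: "i \<in> S" for i
  proof -
    have xT: "x \<circ> T i = x" by (simp only: Cons.prems(4)[OF i] comp_id)
    have 1: "?f (T(i := x)) = (- 1) ^ length u * of_nat (matchings l u (S - {i}))
        * (\<Prod>j\<in>I - (S - {i}). \<phi> j ((T(i := x)) j))"
      using Cons.prems i fin by (intro Cons.IH) auto
    have 2: "I - (S - {i}) = insert i (I - S)" using i Cons.prems by blast
    have 3: "(\<Prod>j\<in>insert i (I - S). \<phi> j ((T(i := x)) j)) = \<phi> i x * (\<Prod>j\<in>I - S. \<phi> j (T j))"
      using i assms(1) by (subst prod.insert) (auto intro!: prod.cong)
    show ?thesis unfolding xT 1 2 3 using i Cons.prems(1,2) assms(3)[of i x] by auto
  qed
  have "foldr (slotwise I) (x # u) (\<lambda>T. \<Prod>i\<in>I. \<phi> i (T i)) T = - (\<Sum>i\<in>I. ?f (T(i := x \<circ> T i)))"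
    by (simp add: slotwise_def)
  also have "(\<Sum>i\<in>I. ?f (T(i := x \<circ> T i))) = (\<Sum>i\<in>S. ?f (T(i := x \<circ> T i)))"
    using Cons.prems assms(1) out by (intro sum.mono_neutral_right) auto
  also have "\<dots> = (- 1) ^ length u * of_nat (\<Sum>i\<in>S. if l i = x then matchings l u (S - {i}) else 0)
      * (\<Prod>j\<in>I - S. \<phi> j (T j))"
    using inn by (simp add: sum_distrib_left sum_distrib_right)
  also have "(\<Sum>i\<in>S. if l i = x then matchings l u (S - {i}) else 0) = matchings l (x # u) S"
    using fin by (simp add: sum.If_cases Int_def)
  finally show ?case by simp
qed

text \<open>Among the multisets with nonzero coefficient take \<open>\<mu>\<close> of maximal size,
  and test the relation on a product of forms dual to the letters of \<open>r \<mu>\<close>, at the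
  tuple (id, ..., id). Words that are shorter or have other letters give 0; \<open>\<mu>\<close>
  gives its coefficient times, up to sign, a number of matchings, which is nonzero in characteristic
  zero.\<close>

lemma sorted_words_independent:
  assumes G: "lie_algebra (fun_scale scale) commutator G" "G \<subseteq> Der scale"
    and X: "X \<subseteq> G" "\<not> maps.dependent X" and r: "\<And>\<mu>. mset (r \<mu>) = \<mu>"
    and M: "finite M" "\<And>\<mu>. \<mu> \<in> M \<Longrightarrow> set_mset \<mu> \<subseteq> X"
    and rel: "(\<Sum>\<mu>\<in>M. pscale (c \<mu>) (word (r \<mu>))) \<in> lie_algebra.uea_ideal (fun_scale scale) commutator G"
    and nontrivial: "(0 :: 'a) \<noteq> 1"
  shows "\<forall>\<mu>\<in>M. c \<mu> = 0"
proof (rule ccontr)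
  interpret lie_algebra "fun_scale scale" commutator G by (rule G(1))
  define C where "C = {\<mu> \<in> M. c \<mu> \<noteq> 0}"
  assume "\<not> ?thesis"
  then have C: "C \<noteq> {}" "finite C" using M(1) by (auto simp: C_def)
  then have "Max (size ` C) \<in> size ` C" by (intro Max_in) auto
  then obtain \<mu> where "\<mu> \<in> C" "size \<mu> = Max (size ` C)" by force
  then have \<mu>: "\<mu> \<in> C" "\<And>\<nu>. \<nu> \<in> C \<Longrightarrow> size \<nu> \<le> size \<mu>"
    using C by auto
  \<comment> \<open>A derivation equal to \<open>id\<close> would satisfy 1 = 1 + 1 by the Leibniz
    rule for 1 times 1. Independence of \<open>id\<close> from \<open>X\<close> permits forms that
    are dual to \<open>X\<close> and vanish at \<open>id\<close>.\<close>
  have idX: "id \<notin> maps.span X"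
  proof
    assume "id \<in> maps.span X"
    then have "id \<in> Der scale" using maps.span_minimal[OF X(1) L_subspace] G(2) by blast
    then have "id (1 * 1) = id 1 * 1 + 1 * id (1 :: 'a)" by (rule DerD(3))
    then have "(1 :: 'a) + 0 = 1 + 1" by simp
    then show False using nontrivial unfolding add_left_cancel by blast
  qed
  then have "\<not> maps.dependent (insert id X)" using X(2) by (intro maps.independent_insertI)
  interpret E: vector_space_pair "fun_scale scale" "(*) :: 'k \<Rightarrow> 'k \<Rightarrow> 'k"
    by unfold_locales (auto simp: algebra_simps)
  define I where "I = {..<size \<mu>}"
  define l where "l = (!) (r \<mu>)"
  have "\<exists>\<phi>. Vector_Spaces.linear (fun_scale scale) (*) \<phi> \<and>
      (\<forall>x\<in>insert id X. \<phi> x = (if l i = x \<and> x \<noteq> id then 1 else 0))" for i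
    by (rule E.linear_independent_extend[OF \<open>\<not> maps.dependent (insert id X)\<close>])
  then obtain \<phi> where \<phi>: "\<And>i. Vector_Spaces.linear (fun_scale scale) (*) (\<phi> i)"
    "\<And>i x. x \<in> insert id X \<Longrightarrow> \<phi> i x = (if l i = x \<and> x \<noteq> id then 1 else 0)"
    by metis
  have "id \<notin> X" using idX maps.span_base by blast
  have fin: "finite I" by (simp add: I_def)
  interpret R: lie_representation "fun_scale scale" commutator G "\<lambda>c f T. c * f T" "multilinear I" "slotwise I"
    by (rule lie_representation_slotwise[OF G fin])
  define f where "f = (\<lambda>T. \<Prod>i\<in>I. \<phi> i (T i))"
  have f: "f \<in> multilinear I"
  proof -
    have "f (T(j := t)) = \<phi> j t * (\<Prod>i\<in>I - {j}. \<phi> i (T i))" if "j \<in> I" for j t T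
      unfolding f_def using that fin by (subst prod.remove[of I j]) (auto intro!: prod.cong)
    then show ?thesis
      by (simp add: multilinear_def distrib_right E.linear_add[OF \<phi>(1)] E.linear_scale[OF \<phi>(1)])
  qed
  have val: "foldr (slotwise I) (r \<nu>) f (\<lambda>_. id) = (- 1) ^ size \<nu> * of_nat (matchings l (r \<nu>) I)"
    if "\<nu> \<in> C" for \<nu>
  proof -
    have "length (r \<nu>) = size \<nu>" "set (r \<nu>) = set_mset \<nu>"
      using r by (metis size_mset, metis set_mset_mset)
    then show ?thesis
      using foldr_slotwise[of I \<phi> X l "r \<nu>" I "\<lambda>_. id"] that M(2) \<mu>(2) \<phi>(2) fin \<open>id \<notin> X\<close>
      by (fastforce simp: f_def C_def I_def)
  qed
  have "image_mset l (mset_set I) = \<mu>"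
  proof -
    have "length (r \<mu>) = size \<mu>" using r by (metis size_mset)
    then have "image_mset l (mset_set I) = mset (map l [0..<length (r \<mu>)])"
      by (simp add: I_def atLeast0LessThan)
    also have "map l [0..<length (r \<mu>)] = r \<mu>" by (simp add: l_def map_nth)
    finally show ?thesis using r by simp
  qed
  then have match: "matchings l (r \<nu>) I \<noteq> 0 \<longleftrightarrow> \<nu> = \<mu>" for \<nu>
    using matchings_nonzero_iff[OF fin, of l "r \<nu>"] r by auto
  have "R.act (\<Sum>\<mu>\<in>M. pscale (c \<mu>) (word (r \<mu>))) f = 0"
    by (rule R.act_uea_ideal[OF rel f])
  moreover have "R.act (\<Sum>\<mu>\<in>M'. pscale (c \<mu>) (word (r \<mu>))) f
      = (\<lambda>T. \<Sum>\<mu>\<in>M'. c \<mu> * foldr (slotwise I) (r \<mu>) f T)" if "finite M'" for M'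
    using that by (induction M' rule: finite_induct)
      (auto simp: R.act_zero R.act_add R.act_pscale R.act_word fun_eq_iff)
  ultimately have "0 = (\<Sum>\<nu>\<in>M. c \<nu> * foldr (slotwise I) (r \<nu>) f (\<lambda>_. id))"
    using M(1) by (simp add: fun_eq_iff)
  also have "\<dots> = (\<Sum>\<nu>\<in>{\<mu>}. c \<nu> * foldr (slotwise I) (r \<nu>) f (\<lambda>_. id))"
  proof (intro sum.mono_neutral_right ballI)
    fix \<nu> assume \<nu>: "\<nu> \<in> M - {\<mu>}"
    show "c \<nu> * foldr (slotwise I) (r \<nu>) f (\<lambda>_. id) = 0"
    proof (cases "\<nu> \<in> C")
      case True
      then show ?thesis using val[OF True] match[of \<nu>] \<nu> by simp
    qed (use \<nu> in \<open>auto simp: C_def\<close>)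
  qed (use M \<mu> in \<open>auto simp: C_def\<close>)
  also have "\<dots> = c \<mu> * ((- 1) ^ size \<mu> * of_nat (matchings l (r \<mu>) I))"
    using val \<mu> by simp
  finally show False using match[of \<mu>] \<mu> by (simp add: C_def)
qed

end

section \<open>Right ideals of enveloping algebras\<close>

lemma right_noetherian_maximal:
  assumes R: "right_noetherian R" and F: "F \<noteq> {}" "\<And>I. I \<in> F \<Longrightarrow> right_ideal I R"
  shows "\<exists>M\<in>F. \<forall>I\<in>F. M \<subseteq> I \<longrightarrow> I = M"
proof (rule ccontr)
  assume "\<not> ?thesis"
  then have step: "\<exists>I'. I' \<in> F \<and> I \<subset> I'" if "I \<in> F" for I using that by blast
  have "\<exists>I. \<forall>n::nat. I n \<in> F \<and> I n \<subset> I (Suc n)"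
    by (rule dependent_nat_choice) (use F(1) step in blast)+
  then obtain I where I: "\<And>n::nat. I n \<in> F" "\<And>n. I n \<subset> I (Suc n)" by blast
  then have "(\<forall>n. right_ideal (I n) R) \<and> (\<forall>n. I n \<subseteq> I (Suc n))"
    using F(2) by (simp add: psubset_imp_subset)
  then obtain N where "\<forall>n\<ge>N. I n = I N"
    using R[unfolded right_noetherian_def, rule_format, of I] by blast
  then have "I (Suc N) = I N" by (meson le_SucI order_refl)
  then show False using I(2)[of N] by simp
qed

locale derivation_pair = char_0_algebra scale
  for scale :: "'k::field_char_0 \<Rightarrow> 'a::ring_1 \<Rightarrow> 'a" +
  fixes G H X Y :: "('a \<Rightarrow> 'a) set"
  assumes G_lie: "lie_algebra (fun_scale scale) commutator G" and G_Der: "G \<subseteq> Der scale"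
    and H_lie: "lie_algebra (fun_scale scale) commutator H" and H_sub: "H \<subseteq> G"
    and nontrivial: "(0 :: 'a) \<noteq> 1"
    and Y_sub: "Y \<subseteq> X" and X_indep: "\<not> maps.dependent X"
    and Y_basis: "Y \<subseteq> H" "H \<subseteq> maps.span Y" and X_basis: "X \<subseteq> G" "G \<subseteq> maps.span X"
begin

sublocale G: lie_algebra "fun_scale scale" commutator G by (rule G_lie)
sublocale H: lie_algebra "fun_scale scale" commutator H by (rule H_lie)

abbreviation KG where "KG \<equiv> lie_algebra.uea_ideal (fun_scale scale) commutator G"
abbreviation KH where "KH \<equiv> lie_algebra.uea_ideal (fun_scale scale) commutator H"

lemma KH_sub: "KH \<subseteq> KG"
  by (rule uea_ideal_mono[OF H_lie G_lie H_sub])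

lemma free_sub: "free_carrier H \<subseteq> free_carrier G"
  by (rule free_carrier_mono[OF H_sub])

text \<open>The universal enveloping algebra of \<open>G\<close> is free over that of \<open>H\<close>, on the sorted words in
  the part of the basis outside \<open>H\<close>.\<close>

lemma relatively_free:
  assumes M: "finite M" "\<And>\<alpha>. \<alpha> \<in> M \<Longrightarrow> set_mset \<alpha> \<subseteq> X - Y"
    and a: "\<And>\<alpha>. \<alpha> \<in> M \<Longrightarrow> a \<alpha> \<in> free_carrier H"
    and rel: "(\<Sum>\<alpha>\<in>M. a \<alpha> * word (list_of \<alpha>)) \<in> KG" and "\<alpha> \<in> M"
  shows "a \<alpha> \<in> KH"
proof -
  define Q where "Q \<alpha> B c \<longleftrightarrow> finite B \<and> B \<subseteq> {\<beta>. set_mset \<beta> \<subseteq> Y} \<and> (\<forall>b. b \<notin> B \<longrightarrow> c b = 0) \<and>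
      a \<alpha> - (\<Sum>\<beta>\<in>B. pscale (c \<beta>) (word (list_of \<beta>))) \<in> KH" for \<alpha> B c
  have "\<exists>B c. Q \<alpha> B c" if "\<alpha> \<in> M" for \<alpha>
  proof -
    have "a \<alpha> \<in> fa.span (KH \<union> word ` list_of ` {\<mu>. set_mset \<mu> \<subseteq> Y})"
      using H.free_carrier_in_span_sorted[OF Y_basis mset_list_of] a[OF that] by blast
    then have "a \<alpha> \<in> fa.span (KH \<union> (\<lambda>\<mu>. word (list_of \<mu>)) ` {\<mu>. set_mset \<mu> \<subseteq> Y})"
      by (simp add: image_image)
    from fa.span_subspace_Un_image[OF H.subspace_uea_ideal this] show ?thesis
      unfolding Q_def .
  qed
  then obtain B c where "\<And>\<alpha>. \<alpha> \<in> M \<Longrightarrow> Q \<alpha> (B \<alpha>) (c \<alpha>)"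
    by metis
  note B = this[unfolded Q_def]
  define C where "C = (\<Union>\<alpha>\<in>M. B \<alpha>)"
  have C: "finite C" "\<And>\<beta>. \<beta> \<in> C \<Longrightarrow> set_mset \<beta> \<subseteq> Y" using B M(1) by (auto simp: C_def)
  have aC: "a \<alpha> - (\<Sum>\<beta>\<in>C. pscale (c \<alpha> \<beta>) (word (list_of \<beta>))) \<in> KH" if "\<alpha> \<in> M" for \<alpha>
  proof -
    have "(\<Sum>\<beta>\<in>C. pscale (c \<alpha> \<beta>) (word (list_of \<beta>))) = (\<Sum>\<beta>\<in>B \<alpha>. pscale (c \<alpha> \<beta>) (word (list_of \<beta>)))"
      using B[OF that] C(1) that by (intro sum.mono_neutral_right) (auto simp: C_def)
    then show ?thesis using B[OF that] by simp
  qed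
  have split: "split_word Y (\<beta> + \<alpha>) = list_of \<beta> @ list_of \<alpha>"
    "filter_mset (\<lambda>x. x \<in> Y) (\<beta> + \<alpha>) = \<beta>" "filter_mset (\<lambda>x. x \<notin> Y) (\<beta> + \<alpha>) = \<alpha>"
    if "\<alpha> \<in> M" "\<beta> \<in> C" for \<alpha> \<beta>
  proof -
    have "filter_mset (\<lambda>x. x \<in> Y) \<beta> = \<beta>" "filter_mset (\<lambda>x. x \<notin> Y) \<beta> = {#}"
      "filter_mset (\<lambda>x. x \<in> Y) \<alpha> = {#}" "filter_mset (\<lambda>x. x \<notin> Y) \<alpha> = \<alpha>"
      using M(2)[OF that(1)] C(2)[OF that(2)]
      by (auto simp: filter_mset_eq_conv subset_iff)
    note F = this
    show "filter_mset (\<lambda>x. x \<in> Y) (\<beta> + \<alpha>) = \<beta>" "filter_mset (\<lambda>x. x \<notin> Y) (\<beta> + \<alpha>) = \<alpha>"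
      "split_word Y (\<beta> + \<alpha>) = list_of \<beta> @ list_of \<alpha>"
      unfolding split_word_def filter_union_mset F by simp_all
  qed
  \<comment> \<open>A multiset over \<open>X\<close> splits uniquely into its letters in
    \<open>Y\<close> and the others, so each pair can be read back from the sum
    \<open>\<beta> + \<alpha>\<close>, and \<open>d\<close> is the coefficient family of one
    relation between sorted words of U(G).\<close>
  define P where "P = (\<lambda>(\<alpha>, \<beta>). \<beta> + \<alpha>) ` (M \<times> C)"
  define d where "d \<mu> = c (filter_mset (\<lambda>x. x \<notin> Y) \<mu>) (filter_mset (\<lambda>x. x \<in> Y) \<mu>)" for \<mu>
  have d: "d (\<beta> + \<alpha>) = c \<alpha> \<beta>" if "\<alpha> \<in> M" "\<beta> \<in> C" for \<alpha> \<beta>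
    unfolding d_def split(2,3)[OF that] ..
  have inj: "inj_on (\<lambda>(\<alpha>, \<beta>). \<beta> + \<alpha>) (M \<times> C)"
    by (rule inj_on_inverseI[where g = "\<lambda>\<mu>. (filter_mset (\<lambda>x. x \<notin> Y) \<mu>, filter_mset (\<lambda>x. x \<in> Y) \<mu>)"])
      (clarsimp simp only: split prod.case mem_Times_iff fst_conv snd_conv simp_thms)
  have "(\<Sum>\<mu>\<in>P. pscale (d \<mu>) (word (split_word Y \<mu>)))
      = (\<Sum>(\<alpha>, \<beta>)\<in>M \<times> C. pscale (c \<alpha> \<beta>) (word (list_of \<beta>)) * word (list_of \<alpha>))"
    unfolding P_def sum.reindex[OF inj]
    by (intro sum.cong) (auto simp: split(1) d word_append pscale_mult_left)
  also have "\<dots> = (\<Sum>\<alpha>\<in>M. a \<alpha> * word (list_of \<alpha>)) - (\<Sum>\<alpha>\<in>M.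
      (a \<alpha> - (\<Sum>\<beta>\<in>C. pscale (c \<alpha> \<beta>) (word (list_of \<beta>)))) * word (list_of \<alpha>))"
    by (simp add: sum.cartesian_product[symmetric] left_diff_distrib sum_subtractf sum_distrib_right)
  also have "\<dots> \<in> KG"
  proof (rule fa.subspace_diff[OF G.subspace_uea_ideal rel], rule fa.subspace_sum[OF G.subspace_uea_ideal])
    fix \<alpha> assume \<alpha>: "\<alpha> \<in> M"
    have "set_mset \<alpha> \<subseteq> G" using M(2)[OF \<alpha>] X_basis by blast
    then show "(a \<alpha> - (\<Sum>\<beta>\<in>C. pscale (c \<alpha> \<beta>) (word (list_of \<beta>)))) * word (list_of \<alpha>) \<in> KG"
      using aC[OF \<alpha>] KH_sub by (intro G.uea_ideal_mult) (auto simp: word_in_free)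
  qed
  finally have "\<forall>\<mu>\<in>P. d \<mu> = 0"
    using C M Y_sub by (intro sorted_words_independent[OF G_lie G_Der X_basis(1) X_indep mset_split_word])
      (auto simp: P_def nontrivial, blast+)
  then have "c \<alpha> \<beta> = 0" if "\<beta> \<in> C" for \<beta>
    using d[OF \<open>\<alpha> \<in> M\<close> that] that \<open>\<alpha> \<in> M\<close> unfolding P_def by force
  then show ?thesis using aC[OF \<open>\<alpha> \<in> M\<close>] by simp
qed

text \<open>For \<open>A\<close> closed under right multiplication by the free algebra of
  \<open>H\<close>, this is the preimage of the right ideal of U(G) generated by \<open>A\<close>.
  Sorted words without letters in \<open>Y\<close> suffice as right factors, because factors from
  \<open>H\<close> are absorbed by \<open>A\<close>.\<close>

definition extend_ideal :: "(('a \<Rightarrow> 'a) free_monoid \<Rightarrow>\<^sub>0 'k) set \<Rightarrow> (('a \<Rightarrow> 'a) free_monoid \<Rightarrow>\<^sub>0 'k) set"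
  where "extend_ideal A = fa.span (KG \<union> {a * word (list_of \<alpha>) | a \<alpha>. a \<in> A \<and> set_mset \<alpha> \<subseteq> X - Y})"

lemma extend_ideal_mono: "A \<subseteq> B \<Longrightarrow> extend_ideal A \<subseteq> extend_ideal B"
  unfolding extend_ideal_def by (intro fa.span_mono) blast

lemma extend_ideal_superset: "KG \<subseteq> extend_ideal A" "A \<subseteq> extend_ideal A"
proof -
  show "KG \<subseteq> extend_ideal A" unfolding extend_ideal_def by (auto intro: fa.span_base)
  show "A \<subseteq> extend_ideal A"
  proof
    fix a assume a: "a \<in> A"
    have "a * word [] \<in> extend_ideal A"
      unfolding extend_ideal_def
      by (intro fa.span_base UnI2 CollectI exI[of _ a] exI[of _ "{#}"]) (simp add: a)
    then show "a \<in> extend_ideal A" by (simp add: word_Nil)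
  qed
qed

lemma extend_ideal_subspace: "fa.subspace (extend_ideal A)"
  by (simp add: extend_ideal_def)

lemma free_eq_extend_ideal: "free_carrier G \<subseteq> extend_ideal (free_carrier H)"
proof -
  have "free_carrier G \<subseteq> fa.span (KG \<union> word ` split_word Y ` {\<mu>. set_mset \<mu> \<subseteq> X})"
    by (rule G.free_carrier_in_span_sorted[OF X_basis mset_split_word])
  also have "\<dots> \<subseteq> extend_ideal (free_carrier H)"
  proof (intro fa.span_minimal extend_ideal_subspace Un_least extend_ideal_superset)
    show "word ` split_word Y ` {\<mu>. set_mset \<mu> \<subseteq> X} \<subseteq> extend_ideal (free_carrier H)"
    proof clarify
      fix \<mu> assume \<mu>: "set_mset \<mu> \<subseteq> X"
      let ?\<beta> = "filter_mset (\<lambda>x. x \<in> Y) \<mu>" and ?\<alpha> = "filter_mset (\<lambda>x. x \<notin> Y) \<mu>"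
      have "word (list_of ?\<beta>) \<in> free_carrier H" using Y_basis by (auto simp: word_in_free)
      moreover have "set_mset ?\<alpha> \<subseteq> X - Y" using \<mu> by auto
      ultimately show "word (split_word Y \<mu>) \<in> extend_ideal (free_carrier H)"
        unfolding split_word_def word_append extend_ideal_def by (intro fa.span_base) blast
    qed
  qed
  finally show ?thesis .
qed

lemma extend_ideal_carrier:
  assumes "A \<subseteq> free_carrier H" shows "extend_ideal A \<subseteq> free_carrier G"
  unfolding extend_ideal_def
proof (intro fa.span_minimal subspace_free Un_least G.uea_ideal_carrier)
  show "{a * word (list_of \<alpha>) | a \<alpha>. a \<in> A \<and> set_mset \<alpha> \<subseteq> X - Y} \<subseteq> free_carrier G"
  proof clarify
    fix a \<alpha> assume "a \<in> A" "set_mset \<alpha> \<subseteq> X - Y"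
    then show "a * word (list_of \<alpha>) \<in> free_carrier G"
      using assms free_sub X_basis(1) by (intro free_mult) (auto simp: word_in_free)
  qed
qed

lemma extend_ideal_mult:
  assumes A: "A \<subseteq> free_carrier H" "\<And>a b. a \<in> A \<Longrightarrow> b \<in> free_carrier H \<Longrightarrow> a * b \<in> A"
    and "p \<in> extend_ideal A" "u \<in> free_carrier G"
  shows "p * u \<in> extend_ideal A"
proof -
  note sub = extend_ideal_subspace
  have left: "a * q \<in> extend_ideal A" if a: "a \<in> A" and q: "q \<in> free_carrier G" for a q
  proof -
    have "q \<in> extend_ideal (free_carrier H)" using q free_eq_extend_ideal by blast
    then show ?thesis unfolding extend_ideal_def[of "free_carrier H"]
    proof (induction rule: fa.span_induct_alt)
      case base
      then show ?case by (simp add: fa.subspace_0 sub)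
    next
      case (step c x y)
      have "a * x \<in> extend_ideal A" using step(1)
      proof
        assume "x \<in> KG"
        then have "a * x \<in> KG" using a A(1) free_sub by (intro G.uea_ideal_mult) auto
        then show ?thesis using extend_ideal_superset by blast
      next
        assume "x \<in> {a * word (list_of \<alpha>) |a \<alpha>. a \<in> free_carrier H \<and> set_mset \<alpha> \<subseteq> X - Y}"
        then obtain b \<alpha> where "x = b * word (list_of \<alpha>)" "b \<in> free_carrier H" "set_mset \<alpha> \<subseteq> X - Y"
          by blast
        moreover from this have "a * b \<in> A" using A(2) a by blast
        ultimately show ?thesis unfolding extend_ideal_def
          by (intro fa.span_base UnI2 CollectI exI[of _ "a * b"] exI[of _ \<alpha>]) (simp add: mult.assoc)
      qed
      then show ?case using step(2)
        by (simp add: distrib_left pscale_mult_right fa.subspace_add fa.subspace_scale sub)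
    qed
  qed
  show ?thesis using assms(3) unfolding extend_ideal_def[of A]
  proof (induction rule: fa.span_induct_alt)
    case base
    then show ?case using fa.subspace_0[OF sub[of A]] by (simp add: extend_ideal_def)
  next
    case (step c x y)
    have "x * u \<in> extend_ideal A" using step(1)
    proof
      assume "x \<in> KG"
      then have "x * u \<in> KG" using assms(4) by (intro G.uea_ideal_mult)
      then show ?thesis using extend_ideal_superset by blast
    next
      assume "x \<in> {a * word (list_of \<alpha>) |a \<alpha>. a \<in> A \<and> set_mset \<alpha> \<subseteq> X - Y}"
      then obtain b \<alpha> where b: "x = b * word (list_of \<alpha>)" "b \<in> A" "set_mset \<alpha> \<subseteq> X - Y"
        by blast
      have "word (list_of \<alpha>) * u \<in> free_carrier G"
        using b X_basis assms(4) by (intro free_mult) (auto simp: word_in_free)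
      then show ?thesis using left[OF b(2)] b(1) by (simp add: mult.assoc)
    qed
    then show ?case using step(2) fa.subspace_add[OF sub[of A]] fa.subspace_scale[OF sub[of A]]
      by (simp add: distrib_right pscale_mult_left extend_ideal_def)
  qed
qed

text \<open>Membership in the extension writes \<open>p\<close> with coefficients in
  \<open>A\<close>, while \<open>p\<close> is also its own coefficient at the empty word. By
  freeness the two coefficients at the empty word agree modulo \<open>KH\<close>, which lies in
  \<open>A\<close>.\<close>

lemma extend_ideal_contract:
  assumes A: "fa.subspace A" "A \<subseteq> free_carrier H" "KH \<subseteq> A"
    and p: "p \<in> extend_ideal A" "p \<in> free_carrier H"
  shows "p \<in> A"
proof -
  have "\<exists>M a. finite M \<and> (\<forall>\<alpha>\<in>M. set_mset \<alpha> \<subseteq> X - Y) \<and> (\<forall>\<alpha>. a \<alpha> \<in> A) \<and> (\<forall>\<alpha>. \<alpha> \<notin> M \<longrightarrow> a \<alpha> = 0) \<and>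
      (\<Sum>\<alpha>\<in>M. a \<alpha> * word (list_of \<alpha>)) - p \<in> KG"
    using p(1) unfolding extend_ideal_def
  proof (induction rule: fa.span_induct_alt)
    case base
    show ?case using fa.subspace_0[OF G.subspace_uea_ideal] fa.subspace_0[OF A(1)]
      by (intro exI[of _ "{}"] exI[of _ "\<lambda>_. 0"]) auto
  next
    case (step c x y)
    then obtain M a where M: "finite M" "\<forall>\<alpha>\<in>M. set_mset \<alpha> \<subseteq> X - Y" "\<forall>\<alpha>. a \<alpha> \<in> A"
      "\<forall>\<alpha>. \<alpha> \<notin> M \<longrightarrow> a \<alpha> = 0" "(\<Sum>\<alpha>\<in>M. a \<alpha> * word (list_of \<alpha>)) - y \<in> KG" by blast
    from step(1) show ?case
    proof
      assume "x \<in> KG"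
      then have "((\<Sum>\<alpha>\<in>M. a \<alpha> * word (list_of \<alpha>)) - y) - pscale c x \<in> KG"
        by (intro fa.subspace_diff[OF G.subspace_uea_ideal M(5)] fa.subspace_scale[OF G.subspace_uea_ideal])
      then show ?thesis using M by (intro exI[of _ M] exI[of _ a]) (simp add: algebra_simps)
    next
      assume "x \<in> {a * word (list_of \<alpha>) |a \<alpha>. a \<in> A \<and> set_mset \<alpha> \<subseteq> X - Y}"
      then obtain b \<gamma> where b: "x = b * word (list_of \<gamma>)" "b \<in> A" "set_mset \<gamma> \<subseteq> X - Y"
        by blast
      let ?a = "a(\<gamma> := a \<gamma> + pscale c b)"
      have "(\<Sum>\<alpha>\<in>insert \<gamma> M. ?a \<alpha> * word (list_of \<alpha>))
          = (\<Sum>\<alpha>\<in>insert \<gamma> M. a \<alpha> * word (list_of \<alpha>) + (if \<alpha> = \<gamma> then pscale c x else 0))"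
        by (intro sum.cong) (auto simp: b distrib_right pscale_mult_left)
      also have "\<dots> = (\<Sum>\<alpha>\<in>insert \<gamma> M. a \<alpha> * word (list_of \<alpha>)) + pscale c x"
        using M by (simp add: sum.distrib)
      also have "(\<Sum>\<alpha>\<in>insert \<gamma> M. a \<alpha> * word (list_of \<alpha>)) = (\<Sum>\<alpha>\<in>M. a \<alpha> * word (list_of \<alpha>))"
        using M by (intro sum.mono_neutral_right) auto
      finally have "(\<Sum>\<alpha>\<in>insert \<gamma> M. ?a \<alpha> * word (list_of \<alpha>)) - (pscale c x + y) \<in> KG"
        using M(5) by (simp add: algebra_simps)
      moreover have "a \<gamma> + pscale c b \<in> A"
        using M(3) b(2) A(1) by (intro fa.subspace_add fa.subspace_scale) auto
      ultimately show ?thesis using M b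
        by (intro exI[of _ "insert \<gamma> M"] exI[of _ ?a]) auto
    qed
  qed
  then obtain M a where M: "finite M" "\<forall>\<alpha>\<in>M. set_mset \<alpha> \<subseteq> X - Y" "\<forall>\<alpha>. a \<alpha> \<in> A"
    "\<forall>\<alpha>. \<alpha> \<notin> M \<longrightarrow> a \<alpha> = 0" "(\<Sum>\<alpha>\<in>M. a \<alpha> * word (list_of \<alpha>)) - p \<in> KG" by blast
  \<comment> \<open>\<open>p\<close> joins the sum as part of the coefficient at the empty word
    \<open>{#}\<close>, so that the difference becomes a relation to which
    \<open>relatively_free\<close> applies.\<close>
  let ?M = "insert {#} M" and ?a = "a({#} := a {#} - p)"
  have "(\<Sum>\<alpha>\<in>?M. ?a \<alpha> * word (list_of \<alpha>))
      = (\<Sum>\<alpha>\<in>?M. a \<alpha> * word (list_of \<alpha>) - (if \<alpha> = {#} then p else 0))"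
    by (intro sum.cong) (auto simp: left_diff_distrib word_Nil)
  also have "\<dots> = (\<Sum>\<alpha>\<in>?M. a \<alpha> * word (list_of \<alpha>)) - p"
    using M by (simp add: sum_subtractf)
  also have "(\<Sum>\<alpha>\<in>?M. a \<alpha> * word (list_of \<alpha>)) = (\<Sum>\<alpha>\<in>M. a \<alpha> * word (list_of \<alpha>))"
    using M by (intro sum.mono_neutral_right) auto
  finally have "(\<Sum>\<alpha>\<in>?M. ?a \<alpha> * word (list_of \<alpha>)) \<in> KG" using M(5) by simp
  then have "?a {#} \<in> KH"
    using M A(2) p(2) by (intro relatively_free[of ?M ?a "{#}"])
      (auto intro!: fa.subspace_diff subspace_free)
  then have 1: "a {#} - p \<in> A" using A(3) by auto
  have 2: "a {#} \<in> A" using M(3) by blast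
  from fa.subspace_diff[OF A(1) 2 1] show ?thesis by simp
qed

definition uea_right_ideal :: "(('a \<Rightarrow> 'a) free_monoid \<Rightarrow>\<^sub>0 'k) set \<Rightarrow> (('a \<Rightarrow> 'a) free_monoid \<Rightarrow>\<^sub>0 'k) set set"
  where "uea_right_ideal A = (\<lambda>p. KG +>\<^bsub>free_algebra G\<^esub> p) ` extend_ideal A"

lemma right_ideal_uea_right_ideal:
  assumes A: "A \<subseteq> free_carrier H" "\<And>a b. a \<in> A \<Longrightarrow> b \<in> free_carrier H \<Longrightarrow> a * b \<in> A"
  shows "right_ideal (uea_right_ideal A) (uea (fun_scale scale) commutator G)"
proof -
  let ?F = "free_algebra G :: (('a \<Rightarrow> 'a) free_monoid \<Rightarrow>\<^sub>0 'k) ring"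
  let ?U = "uea (fun_scale scale) commutator G"
  interpret K: ideal KG ?F by (rule G.ideal_uea_ideal)
  have U: "?U = ?F Quot KG" by (simp add: uea_def G.uea_ideal_def)
  interpret U: ring ?U unfolding U by (rule K.quotient_is_ring)
  have carr: "extend_ideal A \<subseteq> carrier ?F" by (rule extend_ideal_carrier[OF A(1)])
  have ops: "carrier ?U = a_rcosets\<^bsub>?F\<^esub> KG" "\<zero>\<^bsub>?U\<^esub> = KG"
    "p \<oplus>\<^bsub>?U\<^esub> q = p <+>\<^bsub>?F\<^esub> q" "p \<otimes>\<^bsub>?U\<^esub> q = [mod KG:] p \<Otimes>\<^bsub>?F\<^esub> q" for p q
    by (simp_all add: U FactRing_def)
  have add: "(KG +>\<^bsub>?F\<^esub> p) \<oplus>\<^bsub>?U\<^esub> (KG +>\<^bsub>?F\<^esub> q) = KG +>\<^bsub>?F\<^esub> (p + q)"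
    if "p \<in> carrier ?F" "q \<in> carrier ?F" for p q
    using K.a_rcos_sum[OF that] by (simp add: ops)
  have mult: "(KG +>\<^bsub>?F\<^esub> p) \<otimes>\<^bsub>?U\<^esub> (KG +>\<^bsub>?F\<^esub> q) = KG +>\<^bsub>?F\<^esub> (p * q)"
    if "p \<in> carrier ?F" "q \<in> carrier ?F" for p q
    using K.rcoset_mult_add[OF that] by (simp add: ops)
  have zero: "KG +>\<^bsub>?F\<^esub> 0 = \<zero>\<^bsub>?U\<^esub>" using K.a_coset_add_zero[OF G.uea_ideal_carrier] by (simp add: ops)
  have elem: "KG +>\<^bsub>?F\<^esub> p \<in> carrier ?U" if "p \<in> carrier ?F" for p
    using that by (auto simp: ops A_RCOSETS_def')
  have "subgroup (uea_right_ideal A) (add_monoid ?U)"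
  proof (unfold_locales, goal_cases)
    case 1
    then show ?case using elem carr by (auto simp: uea_right_ideal_def)
  next
    case (2 x y)
    then obtain p q where "x = KG +>\<^bsub>?F\<^esub> p" "y = KG +>\<^bsub>?F\<^esub> q" "p \<in> extend_ideal A" "q \<in> extend_ideal A"
      by (auto simp: uea_right_ideal_def)
    then show ?case using add carr fa.subspace_add[OF extend_ideal_subspace]
      unfolding uea_right_ideal_def by (auto simp: subset_iff)
  next
    case 3
    have "KG +>\<^bsub>?F\<^esub> 0 \<in> uea_right_ideal A"
      unfolding uea_right_ideal_def by (intro imageI fa.subspace_0 extend_ideal_subspace)
    then show ?case using zero by simp
  next
    case (4 x)
    then obtain p where p: "x = KG +>\<^bsub>?F\<^esub> p" "p \<in> extend_ideal A"
      by (auto simp: uea_right_ideal_def)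
    then have p': "- p \<in> extend_ideal A" using fa.subspace_neg[OF extend_ideal_subspace] by blast
    then have "(KG +>\<^bsub>?F\<^esub> - p) \<oplus>\<^bsub>?U\<^esub> x = \<zero>\<^bsub>?U\<^esub>"
      using add[of "- p" p] zero p carr by auto
    then have "\<ominus>\<^bsub>?U\<^esub> x = KG +>\<^bsub>?F\<^esub> - p"
      using p p' carr elem by (intro U.minus_equality) auto
    then show ?case using p' by (auto simp: uea_right_ideal_def a_inv_def)
  qed
  then have "additive_subgroup (uea_right_ideal A) ?U" by (rule additive_subgroupI)
  moreover have "a \<otimes>\<^bsub>?U\<^esub> r \<in> uea_right_ideal A" if r: "r \<in> carrier ?U" and a: "a \<in> uea_right_ideal A" for r a
  proof -
    obtain u where "r = KG +>\<^bsub>?F\<^esub> u" "u \<in> carrier ?F"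
      using r unfolding ops A_RCOSETS_def' by blast
    moreover obtain p where "a = KG +>\<^bsub>?F\<^esub> p" "p \<in> extend_ideal A"
      using a by (auto simp: uea_right_ideal_def)
    ultimately show ?thesis using mult[of p u] carr extend_ideal_mult[OF A, of p u]
      by (auto simp: uea_right_ideal_def)
  qed
  ultimately show ?thesis by (simp add: right_ideal_def)
qed

lemma uea_right_ideal_contract:
  assumes A: "fa.subspace A" "A \<subseteq> free_carrier H" "KH \<subseteq> A"
    and w: "w \<in> free_carrier H" "KG +>\<^bsub>free_algebra G\<^esub> w \<in> uea_right_ideal A"
  shows "w \<in> A"
proof -
  let ?F = "free_algebra G :: (('a \<Rightarrow> 'a) free_monoid \<Rightarrow>\<^sub>0 'k) ring"
  interpret K: ideal KG ?F by (rule G.ideal_uea_ideal)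
  obtain p where p: "p \<in> extend_ideal A" "KG +>\<^bsub>?F\<^esub> w = KG +>\<^bsub>?F\<^esub> p"
    using w(2) by (auto simp: uea_right_ideal_def)
  have "w \<in> carrier ?F" using w free_sub by blast
  then have "w \<in> KG +>\<^bsub>?F\<^esub> p" using K.a_rcos_self p(2) by metis
  then obtain k where "k \<in> KG" "w = k + p" by (auto simp: a_r_coset_def')
  then have "w \<in> extend_ideal A"
    using p(1) extend_ideal_superset(1) fa.subspace_add[OF extend_ideal_subspace] by blast
  then show ?thesis using A w extend_ideal_contract by blast
qed

end

section \<open>Infinite chains of right ideals from modules and cocycles\<close>

context char_0_algebra
begin

text \<open>A chain of finite-dimensional subspaces of an \<open>H\<close>-module cuts out a chain of right ideals of
  \<open>U(H)\<close>, which stays strict in \<open>U(G)\<close> because \<open>U(G)\<close> is free over \<open>U(H)\<close>.\<close>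

theorem not_right_noetherian_if_module:
  assumes G: "lie_algebra (fun_scale scale) commutator G" "G \<subseteq> Der scale"
    and HG: "H \<subseteq> G" and nontrivial: "(0 :: 'a) \<noteq> 1"
    and rep: "lie_representation (fun_scale scale) commutator H vscale UNIV \<rho>"
    and W: "W \<subseteq> free_carrier H"
    and fd: "\<And>w. w \<in> W \<Longrightarrow> vector_space.fd_mod vscale {} (range (lie_representation.act vscale \<rho> w))"
    and inf: "\<not> vector_space.fd_mod vscale {} (\<Union>w\<in>W. range (lie_representation.act vscale \<rho> w))"
  shows "\<not> right_noetherian (uea (fun_scale scale) commutator G)"
proof
  assume noeth: "right_noetherian (uea (fun_scale scale) commutator G)"
  interpret R: lie_representation "fun_scale scale" commutator H vscale UNIV \<rho> by (rule rep)
  have H_lie: "lie_algebra (fun_scale scale) commutator H" by (rule R.lie_algebra_axioms)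
  obtain Y where Y: "Y \<subseteq> H" "\<not> maps.dependent Y" "H \<subseteq> maps.span Y"
    by (rule maps.maximal_independent_subset)
  have "Y \<subseteq> G" using Y HG by blast
  then obtain X where X: "Y \<subseteq> X" "X \<subseteq> G" "\<not> maps.dependent X" "G \<subseteq> maps.span X"
    by (rule maps.maximal_independent_subset_extend[OF _ Y(2)])
  interpret D: derivation_pair scale G H X Y
    by (rule derivation_pair.intro[OF char_0_algebra_axioms derivation_pair_axioms.intro])
      (fact G HG nontrivial H_lie X Y)+
  define A where "A V = {a \<in> free_carrier H. range (R.act a) \<subseteq> V}" for V
  have A: "fa.subspace (A V)" "A V \<subseteq> free_carrier H" "D.KH \<subseteq> A V"
    "\<And>a b. a \<in> A V \<Longrightarrow> b \<in> free_carrier H \<Longrightarrow> a * b \<in> A V" if V: "R.V.subspace V" for V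
  proof -
    show "fa.subspace (A V)"
      using fa.subspace_0[OF subspace_free[of H]] fa.subspace_add[OF subspace_free[of H]]
        fa.subspace_scale[OF subspace_free[of H]]
        R.V.subspace_0[OF V] R.V.subspace_add[OF V] R.V.subspace_scale[OF V]
      by (intro fa.subspaceI) (auto simp: A_def R.act_zero R.act_add R.act_pscale image_subset_iff)
    show "A V \<subseteq> free_carrier H" by (auto simp: A_def)
    show "D.KH \<subseteq> A V"
      using R.uea_ideal_carrier R.V.subspace_0[OF V] by (auto simp: A_def R.act_uea_ideal)
    show "a * b \<in> A V" if "a \<in> A V" "b \<in> free_carrier H" for a b
      using that by (auto simp: A_def free_mult R.act_mult)
  qed
  let ?F = "{D.uea_right_ideal (A (R.V.span B)) | B. R.V.fd_mod {} B}"
  have ne: "?F \<noteq> {}" using R.V.fd_mod_self[of "{}"] by blast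
  have ri: "right_ideal I (uea (fun_scale scale) commutator G)" if "I \<in> ?F" for I
  proof -
    obtain B where "I = D.uea_right_ideal (A (R.V.span B))" using \<open>I \<in> ?F\<close> by blast
    then show ?thesis using A[OF R.V.subspace_span] by (simp add: D.right_ideal_uea_right_ideal)
  qed
  from right_noetherian_maximal[OF noeth ne ri]
  obtain M where M: "M \<in> ?F" "\<forall>I\<in>?F. M \<subseteq> I \<longrightarrow> I = M" by (rule bexE)
  from M(1) obtain B where B: "R.V.fd_mod {} B" "M = D.uea_right_ideal (A (R.V.span B))" by blast
  have "\<exists>w\<in>W. \<not> range (R.act w) \<subseteq> R.V.span B"
  proof (rule ccontr)
    assume "\<not> ?thesis"
    then have "(\<Union>w\<in>W. range (R.act w)) \<subseteq> R.V.span B" by blast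
    then show False using inf R.V.fd_mod_mono[OF R.V.fd_mod_span[OF B(1)]] by blast
  qed
  then obtain w where w: "w \<in> W" "\<not> range (R.act w) \<subseteq> R.V.span B" by blast
  define B' where "B' = B \<union> range (R.act w)"
  have "R.V.fd_mod {} B'" unfolding B'_def by (intro R.V.fd_mod_Un B fd w)
  moreover have "A (R.V.span B) \<subseteq> A (R.V.span B')"
    using R.V.span_mono[of B B'] by (auto simp: A_def B'_def)
  then have "M \<subseteq> D.uea_right_ideal (A (R.V.span B'))"
    unfolding B(2) D.uea_right_ideal_def by (intro image_mono D.extend_ideal_mono)
  ultimately have eq: "D.uea_right_ideal (A (R.V.span B')) = M"
    by (intro M(2)[rule_format] CollectI exI[of _ B'] conjI refl)
  have "w \<in> A (R.V.span B')"
    using w W by (auto simp: A_def B'_def intro: R.V.span_base)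
  then have "w \<in> D.extend_ideal (A (R.V.span B'))" using D.extend_ideal_superset(2) by blast
  then have "D.KG +>\<^bsub>free_algebra G\<^esub> w \<in> M"
    unfolding eq[symmetric] D.uea_right_ideal_def by (rule imageI)
  then have "D.KG +>\<^bsub>free_algebra G\<^esub> w \<in> D.uea_right_ideal (A (R.V.span B))"
    by (simp only: B(2))
  then have "w \<in> A (R.V.span B)"
    using w(1) W by (intro D.uea_right_ideal_contract[OF A(1-3)[OF R.V.subspace_span]]) blast+
  then show False using w(2) unfolding A_def by blast
qed

end

definition extension_scale :: "('k::field \<Rightarrow> 'v \<Rightarrow> 'v) \<Rightarrow> 'k \<Rightarrow> 'v \<times> 'k \<Rightarrow> 'v \<times> 'k"
  where "extension_scale vscale c = (\<lambda>(v, d). (vscale c v, c * d))"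

definition extension_action ::
  "('k::field \<Rightarrow> 'v \<Rightarrow> 'v::ab_group_add) \<Rightarrow> ('g \<Rightarrow> 'v \<Rightarrow> 'v) \<Rightarrow> ('g \<Rightarrow> 'v) \<Rightarrow> 'g \<Rightarrow> 'v \<times> 'k \<Rightarrow> 'v \<times> 'k"
  where "extension_action vscale \<rho> \<kappa> x = (\<lambda>(v, c). (\<rho> x v + vscale c (\<kappa> x), 0))"

text \<open>A \<open>1\<close>-cocycle \<open>\<kappa>\<close> with values in a module \<open>V\<close> is an extension of the trivial module by \<open>V\<close>.\<close>

locale lie_cocycle = lie_representation scale bracket L vscale UNIV \<rho>
  for scale :: "'k::field \<Rightarrow> 'g::ab_group_add \<Rightarrow> 'g" and bracket L
    and vscale :: "'k \<Rightarrow> 'v::ab_group_add \<Rightarrow> 'v" and \<rho> +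
  fixes \<kappa> :: "'g \<Rightarrow> 'v"
  assumes kappa_add: "\<lbrakk>x \<in> L; y \<in> L\<rbrakk> \<Longrightarrow> \<kappa> (x + y) = \<kappa> x + \<kappa> y"
    and kappa_scale: "x \<in> L \<Longrightarrow> \<kappa> (scale c x) = vscale c (\<kappa> x)"
    and kappa_bracket: "\<lbrakk>x \<in> L; y \<in> L\<rbrakk> \<Longrightarrow> \<kappa> (bracket x y) = \<rho> x (\<kappa> y) - \<rho> y (\<kappa> x)"
begin

lemma vector_space_extension: "vector_space (extension_scale vscale)"
  by unfold_locales
    (auto simp: extension_scale_def V.scale_right_distrib V.scale_left_distrib algebra_simps
      split: prod.splits)

lemma lie_representation_extension:
  "lie_representation scale bracket L (extension_scale vscale) UNIV (extension_action vscale \<rho> \<kappa>)"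
proof -
  interpret E: vector_space "extension_scale vscale" by (rule vector_space_extension)
  have rho_zero: "\<rho> x 0 = 0" if "x \<in> L" for x
    using rho_scale[OF that, of 0 0] by simp
  show ?thesis
    by unfold_locales
      (auto simp: extension_action_def extension_scale_def rho_add rho_scale rho_add_left rho_scale_left
        rho_bracket kappa_add kappa_scale kappa_bracket V.scale_right_distrib V.scale_left_distrib
        V.scale_right_diff_distrib rho_zero algebra_simps V.scale_left_commute split: prod.splits)
qed

end

context char_0_algebra
begin

text \<open>Each \<open>w i\<close> kills the submodule and sends the generator of the trivial
  quotient to \<open>u i\<close>. Its image in the extension thus has dimension at most one, while
  all images together project onto a set containing every \<open>u i\<close>.\<close>

theorem not_right_noetherian_if_cocycle:
  assumes G: "lie_algebra (fun_scale scale) commutator G" "G \<subseteq> Der scale"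
    and HG: "H \<subseteq> G" and nontrivial: "(0 :: 'a) \<noteq> 1"
    and coc: "lie_cocycle (fun_scale scale) commutator H vscale \<rho> \<kappa>"
    and w: "\<And>i. i \<in> I \<Longrightarrow> w i \<in> free_carrier H"
      "\<And>i v c. i \<in> I \<Longrightarrow>
        lie_representation.act (extension_scale vscale) (extension_action vscale \<rho> \<kappa>) (w i) (v, c)
        = (vscale c (u i), 0)"
    and inf: "\<not> vector_space.fd_mod vscale {} (u ` I)"
  shows "\<not> right_noetherian (uea (fun_scale scale) commutator G)"
proof -
  interpret C: lie_cocycle "fun_scale scale" commutator H vscale \<rho> \<kappa> by (rule coc)
  interpret E: lie_representation "fun_scale scale" commutator H "extension_scale vscale" UNIV
    "extension_action vscale \<rho> \<kappa>" by (rule C.lie_representation_extension)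
  interpret P: vector_space_pair "extension_scale vscale" vscale by unfold_locales
  have lin: "Vector_Spaces.linear (extension_scale vscale) vscale fst"
    by unfold_locales (auto simp: extension_scale_def split: prod.splits)
  show ?thesis
  proof (rule not_right_noetherian_if_module[OF G HG nontrivial C.lie_representation_extension])
    show "w ` I \<subseteq> free_carrier H" using w(1) by blast
    show "E.V.fd_mod {} (range (E.act p))" if p: "p \<in> w ` I" for p
    proof -
      obtain i where i: "i \<in> I" "p = w i" using p by blast
      have "E.act p vc \<in> E.V.span {(u i, 0)}" for vc
      proof (cases vc)
        case (Pair v c)
        have "E.act p vc = extension_scale vscale c (u i, 0)"
          using w(2) i Pair by (simp add: extension_scale_def)
        then show ?thesis by (simp add: E.V.span_base E.V.span_scale)
      qed
      then show ?thesis by (intro E.V.fd_modI[of "{(u i, 0)}"]) auto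
    qed
    show "\<not> E.V.fd_mod {} (\<Union>p\<in>w ` I. range (E.act p))"
    proof
      assume "E.V.fd_mod {} (\<Union>p\<in>w ` I. range (E.act p))"
      then have "C.V.fd_mod {} (fst ` (\<Union>p\<in>w ` I. range (E.act p)))"
        by (rule P.fd_mod_image[OF lin]) simp
      moreover have "u i \<in> fst ` (\<Union>p\<in>w ` I. range (E.act p))" if "i \<in> I" for i
      proof -
        have "E.act (w i) (0, 1) = (u i, 0)" using w(2)[OF that] by simp
        then have "(u i, 0) \<in> range (E.act (w i))" by (metis rangeI)
        then have "(u i, 0) \<in> (\<Union>p\<in>w ` I. range (E.act p))" using that by blast
        then show ?thesis by (rule image_eqI[rotated]) simp
      qed
      then have "u ` I \<subseteq> fst ` (\<Union>p\<in>w ` I. range (E.act p))" by blast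
      ultimately show False using inf C.V.fd_mod_mono by blast
    qed
  qed
qed

text \<open>The span of \<open>C\<close> is an abelian Lie algebra. With trivial action on itself
  the identity is a cocycle, and the generator of x acts on the extension by (v, c) \<mapsto> (c x,
  0), so the vectors \<open>u\<close> are the elements of \<open>C\<close> themselves.\<close>

lemma not_right_noetherian_if_abelian:
  assumes G: "lie_algebra (fun_scale scale) commutator G" "G \<subseteq> Der scale"
    and nontrivial: "(0 :: 'a) \<noteq> 1"
    and C: "C \<subseteq> G" "\<And>x y. x \<in> C \<Longrightarrow> y \<in> C \<Longrightarrow> commutator x y = 0" "\<not> maps.fd_mod {} C"
  shows "\<not> right_noetherian (uea (fun_scale scale) commutator G)"
proof -
  interpret G: lie_algebra "fun_scale scale" commutator G by (rule G(1))
  let ?H = "maps.span C"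
  have HG: "?H \<subseteq> G" using C(1) G.L_subspace by (rule maps.span_minimal)
  have zero: "commutator 0 y = 0" "commutator y 0 = 0" if "y \<in> G" for y
    using G(2) that by (auto simp: commutator_def fun_eq_iff DerD(5))
  have "commutator x y = 0" if y: "y \<in> C" and x: "x \<in> ?H" for x y
  proof -
    have "maps.subspace {x \<in> G. commutator x y = 0}"
      using y C(1) by (intro maps.subspaceI)
        (auto simp: G.bracket_add_left G.bracket_scale_left maps.subspace_0[OF G.L_subspace]
          maps.subspace_add[OF G.L_subspace] maps.subspace_scale[OF G.L_subspace] zero)
    then have "?H \<subseteq> {x \<in> G. commutator x y = 0}" using y C by (intro maps.span_minimal) auto
    then show ?thesis using x by blast
  qed
  note half = this
  have abel: "commutator x y = 0" if y: "y \<in> ?H" and x: "x \<in> ?H" for x y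
  proof -
    have "maps.subspace {y \<in> G. commutator x y = 0}"
      using x HG by (intro maps.subspaceI)
        (auto simp: G.bracket_add_right G.bracket_scale_right maps.subspace_0[OF G.L_subspace]
          maps.subspace_add[OF G.L_subspace] maps.subspace_scale[OF G.L_subspace] zero)
    then have "?H \<subseteq> {y \<in> G. commutator x y = 0}" using x C half by (intro maps.span_minimal) auto
    then show ?thesis using y by blast
  qed
  have H_lie: "lie_algebra (fun_scale scale) commutator ?H"
    using HG G(2) abel maps.span_zero by (intro lie_algebra_Der_subspace) auto
  interpret H: lie_algebra "fun_scale scale" commutator ?H by (rule H_lie)
  have coc: "lie_cocycle (fun_scale scale) commutator ?H (fun_scale scale) (\<lambda>_ _. 0) (\<lambda>x. x)"
    by unfold_locales (auto simp: abel)
  interpret K: lie_cocycle "fun_scale scale" commutator ?H "fun_scale scale" "\<lambda>_ _. 0" "\<lambda>x. x" by (rule coc)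
  interpret E: lie_representation "fun_scale scale" commutator ?H "extension_scale (fun_scale scale)" UNIV
    "extension_action (fun_scale scale) (\<lambda>_ _. 0) (\<lambda>x. x)" by (rule K.lie_representation_extension)
  show ?thesis
  proof (rule not_right_noetherian_if_cocycle[OF G HG nontrivial coc, where I = C and w = gen and u = "\<lambda>x. x"])
    show "gen x \<in> free_carrier ?H" if "x \<in> C" for x
      using that by (intro H.gen_in_free maps.span_base)
    show "\<not> maps.fd_mod {} ((\<lambda>x. x) ` C)" using C(3) by simp
  qed (simp add: E.act_gen extension_action_def)
qed

end

section \<open>Infinite-dimensional commutative subalgebras\<close>

context vector_space
begin

lemma span_finite_subset:
  assumes "x \<in> span B"
  shows "\<exists>F. finite F \<and> F \<subseteq> B \<and> x \<in> span F"
  using assms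
proof (induction rule: span_induct_alt)
  case base
  then show ?case by (intro exI[of _ "{}"]) (auto simp: span_zero)
next
  case (step c x y)
  then obtain F where F: "finite F" "F \<subseteq> B" "y \<in> span F" by blast
  then have "y \<in> span (insert x F)" using span_mono[of F "insert x F"] by blast
  moreover have "x \<in> span (insert x F)" by (auto intro: span_base)
  ultimately have "scale c x + y \<in> span (insert x F)" by (intro span_add span_scale)
  then show ?case using F step(1) by (intro exI[of _ "insert x F"]) auto
qed

lemma fd_mod_finite_subset:
  assumes "fd_mod J B"
  shows "\<exists>F. finite F \<and> F \<subseteq> B \<and> B \<subseteq> span (F \<union> J)"
proof -
  obtain T where T: "finite T" "T \<subseteq> span B" "span B \<subseteq> span (T \<union> J)"
    using fd_mod_basis[OF fd_mod_span[OF assms] subspace_span] by metis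
  have "\<forall>t\<in>T. \<exists>F. finite F \<and> F \<subseteq> B \<and> t \<in> span F"
    using T(2) span_finite_subset by blast
  then obtain F where F: "\<And>t. t \<in> T \<Longrightarrow> finite (F t) \<and> F t \<subseteq> B \<and> t \<in> span (F t)"
    by metis
  let ?F = "\<Union>t\<in>T. F t"
  have "T \<union> J \<subseteq> span (?F \<union> J)"
  proof
    fix x assume "x \<in> T \<union> J"
    then show "x \<in> span (?F \<union> J)"
    proof
      assume "x \<in> T"
      moreover from this have "span (F x) \<subseteq> span (?F \<union> J)" by (intro span_mono) blast
      ultimately show ?thesis using F by blast
    qed (auto intro: span_base)
  qed
  then have "span (T \<union> J) \<subseteq> span (?F \<union> J)" by (simp add: span_minimal)
  moreover have "B \<subseteq> span B" by (auto intro: span_base)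
  ultimately have "B \<subseteq> span (?F \<union> J)" using T(3) by blast
  moreover have "finite ?F" "?F \<subseteq> B" using T(1) F by auto
  ultimately show ?thesis by blast
qed

text \<open>In a relation expressing \<open>x n\<close> by earlier terms, the term of lowest index
  with nonzero coefficient can be solved for; if there is none, \<open>x n\<close> itself lies in
  \<open>span J\<close>. Applied to powers, it expresses one power by higher ones.\<close>

lemma fd_mod_range_dependent_tail:
  assumes "fd_mod J (range x)"
  shows "\<exists>m::nat. x m \<in> span (x ` {m<..} \<union> J)"
proof -
  have *: "\<exists>m. x m \<in> span (x ` {m<..} \<union> J)" if "x n \<in> span (x ` {a..<n} \<union> J)" "a \<le> n" for a n
    using that
  proof (induction "n - a" arbitrary: a)
    case 0
    then have "x n \<in> span J" by simp
    then show ?case using span_mono[of J "x ` {n<..} \<union> J"] by blast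
  next
    case (Suc k)
    then have a: "a < n" by simp
    then have "{a..<n} = insert a {Suc a..<n}" by auto
    then have "x n \<in> span (insert (x a) (x ` {Suc a..<n} \<union> J))" using Suc by simp
    then obtain c where c: "x n - scale c (x a) \<in> span (x ` {Suc a..<n} \<union> J)"
      unfolding span_breakdown_eq by blast
    show ?case
    proof (cases "c = 0")
      case True
      then show ?thesis using c Suc a by (intro Suc(1)[of "Suc a"]) auto
    next
      case False
      have sub: "span (x ` {Suc a..<n} \<union> J) \<subseteq> span (x ` {a<..} \<union> J)"
        by (intro span_mono) auto
      have "x n \<in> span (x ` {a<..} \<union> J)" using a by (intro span_base) auto
      then have "x n - (x n - scale c (x a)) \<in> span (x ` {a<..} \<union> J)"
        by (rule span_diff[OF _ subsetD[OF sub c]])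
      then have "scale (1 / c) (scale c (x a)) \<in> span (x ` {a<..} \<union> J)"
        by (intro span_scale[of _ _ "1 / c"]) simp
      moreover have "scale (1 / c) (scale c (x a)) = x a" using False by simp
      ultimately show ?thesis by metis
    qed
  qed
  obtain n where "x n \<in> span (x ` {..<n} \<union> J)" using fd_mod_range_dependent[OF assms] by blast
  then show ?thesis using *[of n 0] by (simp add: lessThan_atLeast0)
qed

end

section \<open>Centralizers modulo an ideal\<close>

context assoc_algebra
begin

lemma linear_mult_left: "Vector_Spaces.linear scale scale (\<lambda>b. a * b)"
  by unfold_locales (auto simp: algebra_simps scale_mult_right)

lemma linear_mult_right: "Vector_Spaces.linear scale scale (\<lambda>b. b * a)"
  by unfold_locales (auto simp: algebra_simps scale_mult_left)

end

locale algebra_ideal = assoc_algebra scale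
  for scale :: "'k::field \<Rightarrow> 'a::ring_1 \<Rightarrow> 'a" +
  fixes J :: "'a set"
  assumes J_subspace: "subspace J"
    and J_left: "x \<in> J \<Longrightarrow> a * x \<in> J" and J_right: "x \<in> J \<Longrightarrow> x * a \<in> J"
begin

sublocale endo: vector_space_pair scale scale ..

abbreviation cong_mod :: "'a \<Rightarrow> 'a \<Rightarrow> bool" (infix "\<doteq>" 50)
  where "a \<doteq> b \<equiv> a - b \<in> J"

lemma cong_refl: "a \<doteq> a"
  using subspace_0[OF J_subspace] by simp

lemma cong_sym: "a \<doteq> b \<Longrightarrow> b \<doteq> a"
  using subspace_neg[OF J_subspace, of "a - b"] by simp

lemma cong_trans [trans]: "a \<doteq> b \<Longrightarrow> b \<doteq> c \<Longrightarrow> a \<doteq> c"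
  using subspace_add[OF J_subspace, of "a - b" "b - c"] by simp

lemma cong_add: "a \<doteq> b \<Longrightarrow> c \<doteq> d \<Longrightarrow> a + c \<doteq> b + d"
  using subspace_add[OF J_subspace, of "a - b" "c - d"] by (simp add: algebra_simps)

lemma cong_diff: "a \<doteq> b \<Longrightarrow> c \<doteq> d \<Longrightarrow> a - c \<doteq> b - d"
  using subspace_diff[OF J_subspace, of "a - b" "c - d"] by (simp add: algebra_simps)

lemma cong_mult:
  assumes "a \<doteq> b" "c \<doteq> d" shows "a * c \<doteq> b * d"
proof -
  have "a * c - b * d = (a - b) * c + b * (c - d)" by (simp add: algebra_simps)
  then show ?thesis using subspace_add[OF J_subspace J_right[OF assms(1)] J_left[OF assms(2)]] by simp
qed

lemma cong_mult_left: "c \<doteq> d \<Longrightarrow> a * c \<doteq> a * d"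
  by (rule cong_mult[OF cong_refl])

lemma cong_mult_right: "a \<doteq> b \<Longrightarrow> a * c \<doteq> b * c"
  by (rule cong_mult[OF _ cong_refl])

lemma cong_mem: "a \<doteq> b \<Longrightarrow> a \<in> J \<longleftrightarrow> b \<in> J"
  using subspace_add[OF J_subspace, of "a - b" b] subspace_diff[OF J_subspace, of a "a - b"] by auto

lemma span_J [simp]: "span J = J"
  using J_subspace by simp

lemma linear_commutator: "Vector_Spaces.linear scale scale (\<lambda>b. a * b - b * a)"
  by unfold_locales (auto simp: algebra_simps scale_mult_left scale_mult_right scale_right_diff_distrib)

lemma fd_mod_mult_right: "fd_mod J B \<Longrightarrow> fd_mod J ((\<lambda>b. b * a) ` B)"
  by (rule endo.fd_mod_image[OF linear_mult_right]) (auto simp: J_right)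

definition commuting :: "'a set \<Rightarrow> bool"
  where "commuting C \<longleftrightarrow> (\<forall>x\<in>C. \<forall>y\<in>C. x * y \<doteq> y * x)"

definition cent :: "'a set \<Rightarrow> 'a set"
  where "cent C = {a. \<forall>c\<in>C. a * c \<doteq> c * a}"

text \<open>Subalgebras in the nonunital sense, so that the corners cut out by idempotents qualify;
  containing \<open>J\<close> makes them preimages of subalgebras of A / J.\<close>

definition subalg :: "'a set \<Rightarrow> bool"
  where "subalg B \<longleftrightarrow> subspace B \<and> J \<subseteq> B \<and> (\<forall>a\<in>B. \<forall>b\<in>B. a * b \<in> B)"

lemma subalgD:
  assumes "subalg B"
  shows "subspace B" "J \<subseteq> B" "a \<in> B \<Longrightarrow> b \<in> B \<Longrightarrow> a * b \<in> B"
    "a \<in> B \<Longrightarrow> b \<in> B \<Longrightarrow> a + b \<in> B" "a \<in> B \<Longrightarrow> b \<in> B \<Longrightarrow> a - b \<in> B"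
    "a \<in> B \<Longrightarrow> scale c a \<in> B" "0 \<in> B" "a \<in> B \<Longrightarrow> - a \<in> B"
  using assms by (simp_all add: subalg_def subspace_add subspace_diff subspace_scale subspace_0 subspace_neg)

lemma subalg_power: "subalg B \<Longrightarrow> b \<in> B \<Longrightarrow> 0 < n \<Longrightarrow> b ^ n \<in> B"
proof (induction n)
  case (Suc n)
  then show ?case by (cases n) (auto simp: subalgD(3))
qed simp

lemma commutes_J: "x \<in> J \<Longrightarrow> a * x \<doteq> x * a"
  using J_left J_right J_subspace subspace_diff by blast

lemma commutes_mult: "a * x \<doteq> x * a \<Longrightarrow> a * y \<doteq> y * a \<Longrightarrow> a * (x * y) \<doteq> x * y * a"
  using cong_trans[OF cong_mult_right[of "a * x" "x * a" y] cong_mult_left[of "a * y" "y * a" x, folded mult.assoc]]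
  by (simp add: mult.assoc)

lemma commutes_subspace: "subspace {x. a * x \<doteq> x * a}"
proof (rule subspaceI)
  show "0 \<in> {x. a * x \<doteq> x * a}" using cong_refl[of 0] by simp
  show "x + y \<in> {x. a * x \<doteq> x * a}" if "x \<in> {x. a * x \<doteq> x * a}" "y \<in> {x. a * x \<doteq> x * a}" for x y
    using cong_add[of "a * x" "x * a" "a * y" "y * a"] that by (simp add: distrib_left distrib_right)
  show "scale c x \<in> {x. a * x \<doteq> x * a}" if "x \<in> {x. a * x \<doteq> x * a}" for c x
    using subspace_scale[OF J_subspace, of "a * x - x * a" c] that
    by (simp add: scale_mult_left scale_mult_right scale_right_diff_distrib)
qed

lemma subalg_cent: "subalg (cent C)" "1 \<in> cent C"
proof -
  have "cent C = (\<Inter>c\<in>C. {x. c * x \<doteq> x * c})"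
    using cong_sym by (auto simp: cent_def)
  then have "subspace (cent C)"
    using subspace_Int[of C "\<lambda>c. {x. c * x \<doteq> x * c}"] commutes_subspace by simp
  then show "subalg (cent C)"
    unfolding subalg_def using commutes_J commutes_mult cong_sym by (auto simp: cent_def)
  show "1 \<in> cent C" using cong_refl by (simp add: cent_def)
qed

lemma cent_span: "C' \<subseteq> span (C \<union> J) \<Longrightarrow> cent C \<subseteq> cent C'"
proof
  fix a assume C: "C' \<subseteq> span (C \<union> J)" and a: "a \<in> cent C"
  have "span (C \<union> J) \<subseteq> {x. a * x \<doteq> x * a}"
    using a commutes_J by (intro span_minimal commutes_subspace) (auto simp: cent_def)
  then show "a \<in> cent C'" using C by (auto simp: cent_def)
qed

lemma cent_insert: "cent (insert x C) = {b \<in> cent C. b * x \<doteq> x * b}"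
  by (auto simp: cent_def)

text \<open>\<open>V m\<close> is spanned, beside \<open>J\<close>, by products with at least
  \<open>m\<close> factors \<open>x\<close> around an element of \<open>B\<close>. Bracketing with
  \<open>x\<close> maps \<open>V m\<close> into \<open>V (Suc m)\<close>, with kernel in the
  centralizer. With 2 n factors, n of them stand on one side, so \<open>V (2 * n)\<close> lies in
  \<open>J\<close>; rank-nullity then descends to \<open>V 0\<close>, which contains
  \<open>B\<close>.\<close>

lemma fd_mod_nilpotent_centralizer:
  assumes B: "subalg B" "x \<in> B" and n: "x ^ n \<in> J" and fd: "fd_mod J {b \<in> B. b * x \<doteq> x * b}"
  shows "fd_mod J B"
proof -
  have pow: "x ^ i \<in> J" if "n \<le> i" for i
    using J_left[OF n, of "x ^ (i - n)"] that by (simp flip: power_add)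
  define V where "V m = span (J \<union> {x ^ i * b * x ^ j | i j b. m \<le> i + j \<and> b \<in> B})" for m
  have xB: "x ^ i * b * x ^ j \<in> B" if "b \<in> B" for i j b
  proof -
    have *: "x ^ i * b \<in> B" for i
      using that B by (induction i) (auto simp: subalgD mult.assoc)
    have "c * x ^ j \<in> B" if "c \<in> B" for c j
      using that
    proof (induction j arbitrary: c)
      case (Suc j)
      then have "c * x * x ^ j \<in> B" using B by (intro Suc.IH) (simp add: subalgD)
      then show ?case by (simp add: mult.assoc)
    qed simp
    then show ?thesis using * by blast
  qed
  have VB: "V m \<subseteq> B" for m
    unfolding V_def using B xB by (intro span_minimal subalgD(1)[OF B(1)]) (auto simp: subalgD)
  have step: "x * v - v * x \<in> V (Suc m)" if v: "v \<in> V m" for m v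
  proof -
    interpret L: Vector_Spaces.linear scale scale "\<lambda>b. x * b - b * x" by (rule linear_commutator)
    have "(\<lambda>b. x * b - b * x) ` V m
        = span ((\<lambda>b. x * b - b * x) ` (J \<union> {x ^ i * b * x ^ j | i j b. m \<le> i + j \<and> b \<in> B}))"
      unfolding V_def by (rule L.span_image[symmetric])
    also have "\<dots> \<subseteq> V (Suc m)"
    proof (rule span_minimal)
      show "subspace (V (Suc m))" by (simp add: V_def)
      show "(\<lambda>b. x * b - b * x) ` (J \<union> {x ^ i * b * x ^ j | i j b. m \<le> i + j \<and> b \<in> B}) \<subseteq> V (Suc m)"
      proof (intro image_subsetI)
        fix y assume "y \<in> J \<union> {x ^ i * b * x ^ j | i j b. m \<le> i + j \<and> b \<in> B}"
        then show "x * y - y * x \<in> V (Suc m)"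
        proof
          assume "y \<in> J"
          then have "x * y - y * x \<in> J" by (rule commutes_J)
          then show ?thesis by (auto simp: V_def intro: span_base)
        next
          assume "y \<in> {x ^ i * b * x ^ j | i j b. m \<le> i + j \<and> b \<in> B}"
          then obtain i j b where y: "y = x ^ i * b * x ^ j" "m \<le> i + j" "b \<in> B" by blast
          have "x ^ Suc i * b * x ^ j \<in> V (Suc m)"
            unfolding V_def using y by (intro span_base UnI2 CollectI exI[of _ "Suc i"] exI[of _ j] exI[of _ b]) auto
          moreover have "x ^ i * b * x ^ Suc j \<in> V (Suc m)"
            unfolding V_def using y by (intro span_base UnI2 CollectI exI[of _ i] exI[of _ "Suc j"] exI[of _ b]) auto
          moreover have "x * y - y * x = x ^ Suc i * b * x ^ j - x ^ i * b * x ^ Suc j"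
            by (simp add: y mult.assoc power_commutes)
          ultimately show ?thesis unfolding V_def by (simp only: span_diff)
        qed
      qed
    qed
    finally show ?thesis using v by blast
  qed
  have "fd_mod J (V (2 * n - k))" for k
  proof (induction k)
    case 0
    have "J \<union> {x ^ i * b * x ^ j | i j b. 2 * n \<le> i + j \<and> b \<in> B} \<subseteq> J"
    proof (clarsimp)
      fix i j b assume "2 * n \<le> i + j"
      then have "n \<le> i \<or> n \<le> j" by linarith
      then show "x ^ i * b * x ^ j \<in> J" using pow J_left J_right by blast
    qed
    then have "V (2 * n) \<subseteq> J" unfolding V_def using J_subspace by (rule span_minimal)
    then show ?case using fd_mod_mono[OF fd_mod_self] by simp
  next
    case (Suc k)
    show ?case
    proof (cases "2 * n \<le> k")
      case False
      define m where "m = 2 * n - Suc k"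
      have m: "2 * n - k = Suc m" using False by (simp add: m_def)
      have "fd_mod J ((\<lambda>b. x * b - b * x) ` V m)"
        using step by (intro fd_mod_mono[OF Suc]) (auto simp: m)
      moreover have "fd_mod J {u \<in> V m. x * u - u * x \<in> span J}"
        using VB[of m] cong_sym by (intro fd_mod_mono[OF fd]) auto
      moreover have "subspace (V m)" by (simp add: V_def)
      ultimately have "fd_mod J (V m)"
        using endo.fd_mod_kernel[OF linear_commutator] by blast
      then show ?thesis by (simp add: m_def)
    qed (use Suc in simp)
  qed
  from this[of "2 * n"] have "fd_mod J (V 0)" by simp
  moreover have "B \<subseteq> V 0"
  proof
    fix b assume "b \<in> B"
    then have "x ^ 0 * b * x ^ 0 \<in> V 0"
      unfolding V_def by (intro span_base UnI2 CollectI exI[of _ 0] exI[of _ b]) auto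
    then show "b \<in> V 0" by simp
  qed
  ultimately show ?thesis by (rule fd_mod_mono)
qed

end

text \<open>The negation of Laffey's conclusion for A / J. The aim is \<open>fd_mod_UNIV\<close>:
  then A / J itself is finite-dimensional.\<close>

locale finite_commuting = algebra_ideal +
  assumes fd_commuting: "commuting C \<Longrightarrow> fd_mod J C"
begin

lemma fd_mod_square_zero:
  assumes "\<And>x y. x \<in> C \<Longrightarrow> y \<in> C \<Longrightarrow> x * y \<in> J"
  shows "fd_mod J C"
  using assms J_subspace by (intro fd_commuting) (auto simp: commuting_def subspace_diff)

text \<open>Peirce decomposition with f = 1 - e: the diagonal part commutes with \<open>e\<close>,
  and each off-diagonal corner multiplies into \<open>J\<close>, hence is commuting and
  finite-dimensional.\<close>

lemma fd_mod_idempotent_centralizer: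
  assumes B: "subalg B" "1 \<in> B" "e \<in> B" and e: "e * e \<doteq> e"
    and fd: "fd_mod J {b \<in> B. b * e \<doteq> e * b}"
  shows "fd_mod J B"
proof -
  define f where "f = 1 - e"
  have f: "f \<in> B" using B by (simp add: f_def subalgD)
  have ef: "e * f \<in> J" "f * e \<in> J"
    using cong_sym[OF e] by (simp_all add: f_def algebra_simps)
  have off: "fd_mod J {g * b * h | b. b \<in> B}" if "h * g \<in> J" for g h
  proof (rule fd_mod_square_zero, clarify)
    fix b c
    have "g * b * h * (g * c * h) = g * b * ((h * g) * (c * h))" by (simp add: mult.assoc)
    then show "g * b * h * (g * c * h) \<in> J" using J_left J_right that by metis
  qed
  have diag: "e * b * e + f * b * f \<in> {b \<in> B. b * e \<doteq> e * b}" if b: "b \<in> B" for b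
  proof -
    have "(e * b * e + f * b * f) * e - e * (e * b * e + f * b * f)
        = e * b * (e * e - e) - (e * e - e) * (b * e) + f * b * (f * e) - (e * f) * (b * f)"
      by (simp add: algebra_simps)
    also have "\<dots> \<in> J"
      by (rule subspace_diff[OF J_subspace subspace_add[OF J_subspace subspace_diff[OF J_subspace
        J_left[OF e] J_right[OF e]] J_left[OF ef(2)]] J_right[OF ef(1)]])
    finally show ?thesis using B f b by (simp add: subalgD)
  qed
  have "fd_mod J (span ({b \<in> B. b * e \<doteq> e * b} \<union> {e * b * f | b. b \<in> B} \<union> {f * b * e | b. b \<in> B}))"
    using off ef by (intro fd_mod_span fd_mod_Un fd) auto
  then show ?thesis
  proof (rule fd_mod_mono, intro subsetI)
    fix b assume b: "b \<in> B"
    have "b = (e * b * e + f * b * f) + e * b * f + f * b * e"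
      by (simp add: f_def algebra_simps)
    also have "\<dots> \<in> span ({b \<in> B. b * e \<doteq> e * b} \<union> {e * b * f | b. b \<in> B} \<union> {f * b * e | b. b \<in> B})"
      by (rule span_add[OF span_add[OF span_base[OF UnI1[OF UnI1[OF diag[OF b]]]]]]; rule span_base)
        (use b in blast)+
    finally show "b \<in> span ({b \<in> B. b * e \<doteq> e * b} \<union> {e * b * f | b. b \<in> B} \<union> {f * b * e | b. b \<in> B})" .
  qed
qed

text \<open>\<open>B\<close> is the centralizer of a commuting set \<open>C\<close> that is maximal
  among those with infinite-dimensional centralizer. A nilpotent or idempotent x in \<open>B\<close>
  has infinite-dimensional centralizer inside \<open>B\<close> by the two criteria above, so
  maximality puts x into \<open>C\<close>, and elements of \<open>C\<close> are central in
  \<open>B\<close>.\<close>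

lemma obtain_central_subalgebra:
  assumes "\<not> fd_mod J UNIV"
  obtains B where "subalg B" "1 \<in> B" "\<not> fd_mod J B"
    "\<And>x n b. x \<in> B \<Longrightarrow> x ^ n \<in> J \<Longrightarrow> b \<in> B \<Longrightarrow> b * x \<doteq> x * b"
    "\<And>e b. e \<in> B \<Longrightarrow> e * e \<doteq> e \<Longrightarrow> b \<in> B \<Longrightarrow> b * e \<doteq> e * b"
proof -
  let ?A = "{C. commuting C \<and> \<not> fd_mod J (cent C)}"
  have "\<exists>M\<in>?A. \<forall>C\<in>?A. M \<subseteq> C \<longrightarrow> C = M"
  proof (rule subset_Zorn_nonempty)
    have "{} \<in> ?A" using assms by (simp add: commuting_def cent_def)
    then show "?A \<noteq> {}" by blast
    fix \<C> assume ne: "\<C> \<noteq> {}" and chain: "subset.chain ?A \<C>"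
    have sub: "C \<in> ?A" if "C \<in> \<C>" for C
      using chain that by (simp add: subset.chain_def subset_iff)
    have tot: "C \<subseteq> D \<or> D \<subseteq> C" if "C \<in> \<C>" "D \<in> \<C>" for C D
      using chain that unfolding subset.chain_def by blast
    have comm: "commuting (\<Union>\<C>)"
      unfolding commuting_def
    proof (intro ballI)
      fix x y assume "x \<in> \<Union>\<C>" "y \<in> \<Union>\<C>"
      then obtain C D where CD: "C \<in> \<C>" "D \<in> \<C>" "x \<in> C" "y \<in> D" by blast
      then have "C \<subseteq> D \<or> D \<subseteq> C" "commuting C" "commuting D"
        using tot[of C D] sub[of C] sub[of D] by simp_all
      then show "x * y \<doteq> y * x" using CD unfolding commuting_def by blast
    qed
    \<comment> \<open>Zorn's lemma applies because the union of the chain is finite-dimensional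
      modulo \<open>J\<close>: a single member already has the same centralizer as the
      union.\<close>
    obtain F where F: "finite F" "F \<subseteq> \<Union>\<C>" "\<Union>\<C> \<subseteq> span (F \<union> J)"
      using fd_mod_finite_subset[OF fd_commuting[OF comm]] by blast
    obtain C where C: "C \<in> \<C>" "F \<subseteq> C"
      by (rule finite_subset_Union_chain[OF F(1,2) ne chain])
    have "cent C \<subseteq> cent F" using C by (auto simp: cent_def)
    also have "\<dots> \<subseteq> cent (\<Union>\<C>)" by (rule cent_span[OF F(3)])
    finally have "\<not> fd_mod J (cent (\<Union>\<C>))"
      using sub[OF C(1)] fd_mod_mono by auto
    then show "\<Union>\<C> \<in> ?A" using comm by simp
  qed
  then obtain C where C0: "C \<in> ?A" and max0: "\<forall>D\<in>?A. C \<subseteq> D \<longrightarrow> D = C" by (rule bexE)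
  have C: "commuting C" "\<not> fd_mod J (cent C)" using C0 by simp_all
  have max: "D = C" if "commuting D" "\<not> fd_mod J (cent D)" "C \<subseteq> D" for D
    using that by (intro max0[rule_format]) simp_all
  have key: "x \<in> C" if x: "x \<in> cent C" "\<not> fd_mod J {b \<in> cent C. b * x \<doteq> x * b}" for x
  proof -
    have "commuting (insert x C)"
      using x(1) C(1) cong_sym cong_refl by (auto simp: commuting_def cent_def)
    moreover have "\<not> fd_mod J (cent (insert x C))" using x(2) by (simp add: cent_insert)
    ultimately have "insert x C = C" by (intro max) auto
    then show ?thesis by blast
  qed
  show ?thesis
  proof (rule that[of "cent C"])
    show "b * x \<doteq> x * b" if "x \<in> cent C" "x ^ n \<in> J" "b \<in> cent C" for x n b
    proof -
      have "x \<in> C"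
        using fd_mod_nilpotent_centralizer[OF subalg_cent(1)] that C(2) by (intro key) auto
      then show ?thesis using that(3) by (simp add: cent_def)
    qed
    show "b * e \<doteq> e * b" if "e \<in> cent C" "e * e \<doteq> e" "b \<in> cent C" for e b
    proof -
      have "e \<in> C"
        using fd_mod_idempotent_centralizer[OF subalg_cent] that C(2) by (intro key) auto
      then show ?thesis using that(3) by (simp add: cent_def)
    qed
  qed (use subalg_cent C in auto)
qed

text \<open>Otherwise every idempotent with infinite-dimensional corner splits, and one of the
  halves again has an infinite-dimensional corner. The differences \<open>g\<close> along the
  resulting descending chain are nonzero orthogonal idempotents, hence an infinite independent
  commuting family.\<close>

lemma obtain_primitive_idempotent:
  assumes B: "subalg B" "1 \<in> B" "\<not> fd_mod J B"
    and central: "\<And>e b. e \<in> B \<Longrightarrow> e * e \<doteq> e \<Longrightarrow> b \<in> B \<Longrightarrow> b * e \<doteq> e * b"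
  shows "\<exists>e\<in>B. e * e \<doteq> e \<and> \<not> fd_mod J ((*) e ` B) \<and> (\<forall>f\<in>B. f * f \<doteq> f \<longrightarrow> e * f \<in> J \<or> e * f \<doteq> e)"
proof (rule ccontr)
  define good where "good e \<longleftrightarrow> e \<in> B \<and> e * e \<doteq> e \<and> \<not> fd_mod J ((*) e ` B)" for e
  assume neg: "\<not> ?thesis"
  have step: "\<exists>e'. good e' \<and> e * e' \<doteq> e' \<and> e - e' \<notin> J" if "good e" for e
  proof -
    have e: "e \<in> B" "e * e \<doteq> e" "\<not> fd_mod J ((*) e ` B)" using \<open>good e\<close> by (auto simp: good_def)
    then obtain f where f: "f \<in> B" "f * f \<doteq> f" "e * f \<notin> J" "\<not> e * f \<doteq> e" using neg by blast
    have efB: "e * f \<in> B" using e f B by (simp add: subalgD)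
    have ef: "e * f * (e * f) \<doteq> e * f"
    proof -
      have "e * f * (e * f) = e * (f * e) * f" by (simp add: mult.assoc)
      also have "\<dots> \<doteq> e * (e * f) * f"
        using central[of f e] central[of e f] e f by (intro cong_mult_left cong_mult_right)
      also have "e * (e * f) * f = (e * e) * (f * f)" by (simp add: mult.assoc)
      also have "\<dots> \<doteq> e * f" by (rule cong_mult[OF e(2) f(2)])
      finally show ?thesis .
    qed
    have e_ef: "e * (e * f) \<doteq> e * f"
      using cong_mult_right[OF e(2), of f] by (simp add: mult.assoc)
    have ef_e: "e * f * e \<doteq> e * f"
      using cong_trans[OF central[of "e * f" e, THEN cong_sym] e_ef] e efB ef by blast
    have "(*) e ` B \<subseteq> span ((*) (e * f) ` B \<union> (*) (e - e * f) ` B)"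
    proof (intro image_subsetI)
      fix b assume "b \<in> B"
      then have "(e * f) * b + (e - e * f) * b \<in> span ((*) (e * f) ` B \<union> (*) (e - e * f) ` B)"
        by (intro span_add span_base) auto
      then show "e * b \<in> span ((*) (e * f) ` B \<union> (*) (e - e * f) ` B)"
        by (simp add: algebra_simps)
    qed
    then have "\<not> fd_mod J ((*) (e * f) ` B) \<or> \<not> fd_mod J ((*) (e - e * f) ` B)"
      using e(3) fd_mod_mono[OF fd_mod_span[OF fd_mod_Un]] by blast
    then show ?thesis
    proof
      assume "\<not> fd_mod J ((*) (e * f) ` B)"
      then have "good (e * f)" using efB ef by (simp add: good_def)
      moreover have "e - e * f \<notin> J" using f(4) cong_sym by blast
      ultimately show ?thesis using e_ef by blast
    next
      assume "\<not> fd_mod J ((*) (e - e * f) ` B)"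
      moreover have "(e - e * f) * (e - e * f) \<doteq> e - e * f"
      proof -
        have "(e - e * f) * (e - e * f) = (e * e - e * (e * f)) - (e * f * e - e * f * (e * f))"
          by (simp add: algebra_simps)
        also have "\<dots> \<doteq> (e - e * f) - (e * f - e * f)"
          by (intro cong_diff e(2) e_ef ef_e ef)
        finally show ?thesis by simp
      qed
      ultimately have "good (e - e * f)" using e efB B by (simp add: good_def subalgD)
      moreover have "e * (e - e * f) \<doteq> e - e * f"
        using cong_diff[OF e(2) e_ef] by (simp add: right_diff_distrib)
      moreover have "e - (e - e * f) \<notin> J" using f(3) by simp
      ultimately show ?thesis by blast
    qed
  qed
  have "\<exists>e. \<forall>n::nat. good (e n) \<and> (e n * e (Suc n) \<doteq> e (Suc n) \<and> e n - e (Suc n) \<notin> J)"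
  proof (rule dependent_nat_choice)
    have "(*) 1 ` B = B" by simp
    then have "good 1" using B cong_refl[of 1] by (simp add: good_def)
    then show "\<exists>x. good x" by blast
  qed (use step in blast)
  then obtain e where e: "\<And>n::nat. good (e n)" "\<And>n. e n * e (Suc n) \<doteq> e (Suc n)" "\<And>n. e n - e (Suc n) \<notin> J"
    by blast
  have eB: "e n \<in> B" and idem: "e n * e n \<doteq> e n" for n using e(1)[of n] by (auto simp: good_def)
  have le: "e i * e j \<doteq> e j" if "i \<le> j" for i j
    using that
  proof (induction j rule: dec_induct)
    case base
    then show ?case by (rule idem)
  next
    case (step j)
    have "e i * e (Suc j) \<doteq> e i * (e j * e (Suc j))" by (intro cong_mult_left cong_sym[OF e(2)])
    also have "e i * (e j * e (Suc j)) = e i * e j * e (Suc j)" by (simp add: mult.assoc)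
    also have "\<dots> \<doteq> e j * e (Suc j)" by (rule cong_mult_right[OF step.IH])
    also have "e j * e (Suc j) \<doteq> e (Suc j)" by (rule e(2))
    finally show ?case .
  qed
  define g where "g n = e n - e (Suc n)" for n
  have gg: "g i * g n \<in> J" if "i < n" for i n
  proof -
    have "g i * g n = (e i * e n - e i * e (Suc n)) - (e (Suc i) * e n - e (Suc i) * e (Suc n))"
      by (simp add: g_def algebra_simps)
    also have "\<dots> \<doteq> (e n - e (Suc n)) - (e n - e (Suc n))"
      using that by (intro cong_diff le) auto
    finally show ?thesis by simp
  qed
  have g_idem: "g n * g n \<doteq> g n" for n
  proof -
    have *: "e (Suc n) * e n \<doteq> e (Suc n)"
      using cong_trans[OF central[OF eB idem eB] le[of n "Suc n"]] by simp
    have "g n * g n = (e n * e n - e n * e (Suc n)) - (e (Suc n) * e n - e (Suc n) * e (Suc n))"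
      by (simp add: g_def algebra_simps)
    also have "\<dots> \<doteq> (e n - e (Suc n)) - (e (Suc n) - e (Suc n))"
      by (intro cong_diff idem le *) simp
    finally show ?thesis by (simp add: g_def)
  qed
  have "commuting (range g)"
    unfolding commuting_def
  proof (intro ballI)
    fix x y assume "x \<in> range g" "y \<in> range g"
    then obtain i j where "x = g i" "y = g j" by blast
    moreover have "g i \<in> B" "g j \<in> B" using eB B by (auto simp: g_def subalgD)
    ultimately show "x * y \<doteq> y * x" using central[of "g j" "g i"] g_idem by blast
  qed
  then obtain n where n: "g n \<in> span (g ` {..<n} \<union> J)"
    using fd_mod_range_dependent[OF fd_commuting] by blast
  interpret L: Vector_Spaces.linear scale scale "\<lambda>b. b * g n" by (rule linear_mult_right)
  have "g n * g n \<in> span ((\<lambda>b. b * g n) ` (g ` {..<n} \<union> J))"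
    unfolding L.span_image using n by blast
  also have "\<dots> \<subseteq> J"
    using gg J_right by (intro span_minimal J_subspace) auto
  finally have "g n \<in> J" using cong_mem[OF g_idem] by blast
  then show False using e(3) by (simp add: g_def)
qed

end

section \<open>From the corner of a primitive idempotent to a division algebra\<close>

locale unital_mod = finite_commuting +
  fixes D :: "'b set" and e :: 'b
  assumes D: "subalg D" and e_D: "e \<in> D"
    and e_left: "b \<in> D \<Longrightarrow> e * b \<doteq> b" and e_right: "b \<in> D \<Longrightarrow> b * e \<doteq> b"
    and D_infinite: "\<not> fd_mod J D"
begin

lemma e_notin_J: "e \<notin> J"
proof
  assume "e \<in> J"
  then have "D \<subseteq> J" using e_left cong_mem J_right by blast
  then show False using D_infinite fd_mod_mono[OF fd_mod_self] by blast
qed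

text \<open>Fitting's argument. The powers of b commute, so b^m is congruent to b^(m+1) r for a
  polynomial r in b, and then b^n r^n is idempotent. If it lies in \<open>J\<close>, then b is
  nilpotent; if it is congruent to \<open>e\<close>, then b is invertible.\<close>

lemma nilpotent_or_unit:
  assumes primitive: "\<And>f. f \<in> D \<Longrightarrow> f * f \<doteq> f \<Longrightarrow> f \<in> J \<or> f \<doteq> e" and b: "b \<in> D"
  shows "(\<exists>n. b ^ n \<in> J) \<or> (\<exists>u\<in>D. u * b \<doteq> e \<and> b * u \<doteq> e)"
proof -
  have comm: "commuting (range ((^) b))"
    unfolding commuting_def using cong_refl by (auto simp: power_add[symmetric] add.commute)
  obtain m where m: "b ^ m \<in> span ((^) b ` {m<..} \<union> J)"
    using fd_mod_range_dependent_tail[OF fd_commuting[OF comm]] by blast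
  interpret L: Vector_Spaces.linear scale scale "\<lambda>y. b ^ Suc m * y" by (rule linear_mult_left)
  have "(^) b ` {m<..} = (\<lambda>y. b ^ Suc m * y) ` range ((^) b)"
  proof -
    have "{m<..} = range ((+) (Suc m))"
      by (auto simp: image_iff less_iff_Suc_add)
    then show ?thesis by (simp only: image_image power_add)
  qed
  then have "b ^ m \<in> span ((\<lambda>y. b ^ Suc m * y) ` range ((^) b) \<union> J)" using m by simp
  then obtain s j where sj: "b ^ m = s + j" "s \<in> span ((\<lambda>y. b ^ Suc m * y) ` range ((^) b))" "j \<in> J"
    unfolding span_Un by auto
  then obtain r where r: "r \<in> span (range ((^) b))" "s = b ^ Suc m * r"
    unfolding L.span_image by blast
  have "b ^ m \<doteq> b ^ Suc m * r" by (metis add_diff_cancel_left' r(2) sj(1,3))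
  have rb: "r * b = b * r"
    using r(1)
  proof (induction rule: span_induct_alt)
    case (step c x y)
    then show ?case by (auto simp: algebra_simps scale_mult_left scale_mult_right power_commutes)
  qed simp
  \<comment> \<open>One more than \<open>m\<close>: \<open>b ^ n\<close> then lies in
    \<open>D\<close> even if m = 0, where \<open>b ^ 0\<close> is the unit of the whole algebra, and
    \<open>v\<close> below arises from \<open>f\<close> by removing one factor
    \<open>b\<close>.\<close>
  define n where "n = Suc m"
  have n: "b ^ n \<doteq> b ^ Suc n * r"
    using cong_mult_left[OF \<open>b ^ m \<doteq> b ^ Suc m * r\<close>, of b] by (simp add: n_def mult.assoc)
  have iter: "b ^ n \<doteq> b ^ (n + k) * r ^ k" for k
  proof (induction k)
    case (Suc k)
    have "b ^ (n + k) * r ^ k = b ^ k * (b ^ n) * r ^ k" by (simp add: power_add[symmetric] add.commute)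
    also have "\<dots> \<doteq> b ^ k * (b ^ Suc n * r) * r ^ k"
      by (intro cong_mult_left cong_mult_right n)
    also have "b ^ k * (b ^ Suc n * r) * r ^ k = b ^ (k + Suc n) * r ^ Suc k"
      by (simp only: power_add power_Suc mult.assoc)
    also have "k + Suc n = n + Suc k" by simp
    finally show ?case using Suc cong_trans by blast
  qed (simp add: subspace_0[OF J_subspace])
  have comm_pow: "r ^ i * b ^ k = b ^ k * r ^ i" for i k
    using rb by (metis power_commuting_commutes)
  define f where "f = b ^ n * r ^ n"
  have bf: "b ^ n * f \<doteq> b ^ n"
    using cong_sym[OF iter[of n]] by (simp add: f_def power_add mult.assoc)
  have "f * f = b ^ n * (r ^ n * b ^ n) * r ^ n"
    unfolding f_def by (simp only: mult.assoc)
  also have "\<dots> = b ^ n * f * r ^ n" by (simp only: comm_pow f_def)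
  also have "\<dots> \<doteq> b ^ n * r ^ n" by (rule cong_mult_right[OF bf])
  finally have idem: "f * f \<doteq> f" by (simp add: f_def)
  have DB: "y * z \<in> D" if "y \<in> D" "z \<in> span (range ((^) b))" for y z
    using that(2)
  proof (induction rule: span_induct_alt)
    case base
    then show ?case using subalgD[OF D] by simp
  next
    case (step c z w)
    then obtain i where "z = b ^ i" by blast
    moreover have "y * b ^ i \<in> D" using that(1) subalg_power[OF D b, of i] D
      by (cases "i = 0") (auto simp: subalgD)
    ultimately show ?case using step D by (simp add: distrib_left scale_mult_right subalgD)
  qed
  have Dr: "y * r ^ i \<in> D" if "y \<in> D" for y i
    using that
  proof (induction i arbitrary: y)
    case (Suc i)
    have "y * r * r ^ i \<in> D" by (rule Suc.IH[OF DB[OF Suc.prems r(1)]])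
    then show ?case by (simp add: mult.assoc)
  qed simp
  have fD: "f \<in> D" unfolding f_def by (rule Dr[OF subalg_power[OF D b]]) (simp add: n_def)
  from primitive[OF fD idem] show ?thesis
  proof
    assume "f \<in> J"
    then have "b ^ n \<in> J" using cong_mem[OF bf] J_left by blast
    then show ?thesis by blast
  next
    assume fe: "f \<doteq> e"
    define v where "v = b ^ m * r ^ n"
    have bv: "b * v = f" "v * b = f"
    proof -
      show "b * v = f" by (simp add: v_def f_def n_def mult.assoc)
      have "v * b = b ^ m * (r ^ n * b ^ 1)" by (simp add: v_def mult.assoc)
      also have "\<dots> = b ^ m * b ^ 1 * r ^ n" by (simp only: comm_pow mult.assoc)
      also have "b ^ m * b ^ 1 = b ^ n" by (simp add: n_def power_commutes)
      finally show "v * b = f" by (simp add: f_def)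
    qed
    have "e * b ^ m \<in> D" using subalg_power[OF D b, of m] e_D D by (cases "m = 0") (auto simp: subalgD)
    then have "e * v \<in> D" unfolding v_def mult.assoc[symmetric] by (rule Dr)
    moreover have "e * v * b \<doteq> e"
      using cong_trans[OF e_left[OF fD] fe] by (simp add: mult.assoc bv)
    moreover have "b * (e * v) \<doteq> e"
    proof -
      have "b * (e * v) = (b * e) * v" by (simp add: mult.assoc)
      also have "\<dots> \<doteq> b * v" by (rule cong_mult_right[OF e_right[OF b]])
      finally show ?thesis using fe cong_trans by (simp add: bv)
    qed
    ultimately show ?thesis by blast
  qed
qed

end

context unital_mod
begin

text \<open>The nilpotents commute, so their set \<open>N\<close> is finite-dimensional. If a
  nilpotent x were outside \<open>J\<close>, right multiplication by x would map \<open>D\<close>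
  into \<open>N\<close> with a kernel of non-units, that is, again of nilpotents; \<open>D\<close>
  would be finite-dimensional.\<close>

lemma no_nilpotents:
  assumes unit: "\<And>b. b \<in> D \<Longrightarrow> (\<exists>n. b ^ n \<in> J) \<or> (\<exists>u\<in>D. u * b \<doteq> e \<and> b * u \<doteq> e)"
    and central: "\<And>x n b. x \<in> D \<Longrightarrow> x ^ n \<in> J \<Longrightarrow> b \<in> D \<Longrightarrow> b * x \<doteq> x * b"
    and x: "x \<in> D" "x ^ n \<in> J"
  shows "x \<in> J"
proof (rule ccontr)
  assume "x \<notin> J"
  define N where "N = {y \<in> D. \<exists>n. y ^ n \<in> J}"
  have "commuting N" unfolding commuting_def N_def using central by blast
  then have N: "fd_mod J N" by (rule fd_commuting)
  have pow: "(b * x) ^ k \<doteq> b ^ k * x ^ k" if "b \<in> D" for b k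
  proof (induction k)
    case (Suc k)
    have comm: "x * b ^ k \<doteq> b ^ k * x"
    proof (induction k)
      case (Suc k)
      have "x * b ^ Suc k = x * b * b ^ k" by (simp add: mult.assoc)
      also have "x * b * b ^ k \<doteq> b * x * b ^ k"
        using cong_sym[OF central[OF x that]] by (rule cong_mult_right)
      also have "b * x * b ^ k = b * (x * b ^ k)" by (simp add: mult.assoc)
      also have "b * (x * b ^ k) \<doteq> b * (b ^ k * x)" by (rule cong_mult_left[OF Suc])
      finally show ?case by (simp add: mult.assoc)
    qed (simp add: subspace_0[OF J_subspace])
    have "(b * x) ^ Suc k \<doteq> b * x * (b ^ k * x ^ k)"
      using cong_mult_left[OF Suc] by simp
    also have "b * x * (b ^ k * x ^ k) = b * (x * b ^ k) * x ^ k" by (simp add: mult.assoc)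
    also have "b * (x * b ^ k) * x ^ k \<doteq> b * (b ^ k * x) * x ^ k"
      by (intro cong_mult_right cong_mult_left comm)
    finally show ?case by (simp add: mult.assoc)
  qed (simp add: subspace_0[OF J_subspace])
  have "(\<lambda>b. b * x) ` D \<subseteq> N"
  proof (intro image_subsetI)
    fix b assume b: "b \<in> D"
    have "b ^ n * x ^ n \<in> J" by (rule J_left[OF x(2)])
    then have "(b * x) ^ n \<in> J" using cong_mem[OF pow[OF b]] by blast
    then show "b * x \<in> N" using b x D by (auto simp: N_def subalgD)
  qed
  then have "fd_mod J ((\<lambda>b. b * x) ` D)" by (rule fd_mod_mono[OF N])
  moreover have "{b \<in> D. b * x \<in> span J} \<subseteq> N"
  proof clarify
    fix b assume b: "b \<in> D" "b * x \<in> span J"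
    have False if u: "u \<in> D" "u * b \<doteq> e" for u
    proof -
      have "x \<doteq> e * x" by (rule cong_sym[OF e_left[OF x(1)]])
      also have "e * x \<doteq> u * b * x" by (rule cong_mult_right[OF cong_sym[OF u(2)]])
      finally have "x \<in> J" using cong_mem J_left[of "b * x" u] b(2) by (simp add: mult.assoc)
      then show False using \<open>x \<notin> J\<close> by blast
    qed
    then show "b \<in> N" using unit[OF b(1)] b(1) by (auto simp: N_def)
  qed
  then have "fd_mod J {b \<in> D. b * x \<in> span J}" by (rule fd_mod_mono[OF N])
  ultimately have "fd_mod J D"
    using endo.fd_mod_kernel[OF linear_mult_right subalgD(1)[OF D]] by blast
  then show False using D_infinite by blast
qed

end

locale division_mod = unital_mod +
  assumes inverse: "b \<in> D \<Longrightarrow> b \<notin> J \<Longrightarrow> \<exists>u\<in>D. u * b \<doteq> e \<and> b * u \<doteq> e"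
begin

lemma sum_in_J: "(\<And>i. i \<in> I \<Longrightarrow> g i \<in> J) \<Longrightarrow> sum g I \<in> J"
  using J_subspace by (rule subspace_sum)

text \<open>Gaussian elimination over a division algebra, with the unknowns as left factors. The
  pivot \<open>m j0 p\<close> eliminates the unknown \<open>p\<close> from the other equations, and
  \<open>tp\<close> is the value that equation \<open>j0\<close> then forces.\<close>

lemma homogeneous_system:
  assumes "finite E" "finite I" "card E < card I" "\<And>j i. j \<in> E \<Longrightarrow> i \<in> I \<Longrightarrow> m j i \<in> D"
  shows "\<exists>t. (\<forall>i\<in>I. t i \<in> D) \<and> (\<exists>i\<in>I. t i \<notin> J) \<and> (\<forall>j\<in>E. (\<Sum>i\<in>I. t i * m j i) \<in> J)"
  using assms
proof (induction E arbitrary: I m rule: finite_induct)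
  case empty
  then have "I \<noteq> {}" by auto
  then show ?case using e_D e_notin_J by (intro exI[of _ "\<lambda>_. e"]) auto
next
  case (insert j0 E)
  have fin: "finite I" and I: "card E + 1 < card I" using insert by auto
  show ?case
  proof (cases "\<forall>i\<in>I. m j0 i \<in> J")
    case True
    obtain t where t: "\<forall>i\<in>I. t i \<in> D" "\<exists>i\<in>I. t i \<notin> J" "\<forall>j\<in>E. (\<Sum>i\<in>I. t i * m j i) \<in> J"
      using insert.IH[of I m] insert.prems I fin by auto
    then show ?thesis using True by (intro exI[of _ t]) (auto intro!: sum_in_J J_left)
  next
    case False
    then obtain p where p: "p \<in> I" "m j0 p \<notin> J" by blast
    then obtain u where u: "u \<in> D" "u * m j0 p \<doteq> e" using inverse[of "m j0 p"] insert.prems by blast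
    define m' where "m' j i = m j i - m j0 i * u * m j p" for j i
    have "card (I - {p}) = card I - 1" using p fin by simp
    then have "card E < card (I - {p})" using I by linarith
    moreover have "m' j i \<in> D" if "j \<in> E" "i \<in> I - {p}" for j i
      using that insert.prems(3) p u D by (auto simp: m'_def subalgD)
    ultimately obtain t where t: "\<forall>i\<in>I - {p}. t i \<in> D" "\<exists>i\<in>I - {p}. t i \<notin> J"
      "\<forall>j\<in>E. (\<Sum>i\<in>I - {p}. t i * m' j i) \<in> J"
      using insert.IH[of "I - {p}" m'] fin by auto
    define tp where "tp = - (\<Sum>i\<in>I - {p}. t i * m j0 i * u)"
    let ?t = "t(p := tp)"
    have "tp \<in> D"
      unfolding tp_def using t(1) u insert.prems(3)
      by (intro subalgD(8)[OF D] subspace_sum[OF subalgD(1)[OF D]] subalgD(3)[OF D]) auto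
    have split: "(\<Sum>i\<in>I. ?t i * m j i) = (\<Sum>i\<in>I - {p}. t i * m j i) + tp * m j p" for j
      using fin p by (subst sum.remove[of I p]) (auto intro!: sum.cong)
    have "(\<Sum>i\<in>I. ?t i * m j i) \<in> J" if j: "j \<in> insert j0 E" for j
    proof (cases "j = j0")
      case False
      have "(\<Sum>i\<in>I. ?t i * m j i) = (\<Sum>i\<in>I - {p}. t i * m' j i)"
        unfolding split m'_def unfolding tp_def
        by (simp add: right_diff_distrib sum_subtractf sum_distrib_right mult.assoc)
      then show ?thesis using t(3) j False by auto
    next
      case True
      have "(\<Sum>i\<in>I. ?t i * m j0 i) = (\<Sum>i\<in>I - {p}. t i * m j0 i - t i * m j0 i * (u * m j0 p))"
        unfolding split unfolding tp_def by (simp add: sum_subtractf sum_distrib_right mult.assoc)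
      also have "\<dots> \<in> J"
      proof (rule sum_in_J)
        fix i assume i: "i \<in> I - {p}"
        then have "t i * m j0 i \<in> D" using t(1) insert.prems(3) D by (auto simp: subalgD)
        then have "t i * m j0 i \<doteq> t i * m j0 i * e" by (rule cong_sym[OF e_right])
        also have "t i * m j0 i * e \<doteq> t i * m j0 i * (u * m j0 p)" by (rule cong_mult_left[OF cong_sym[OF u(2)]])
        finally show "t i * m j0 i \<doteq> t i * m j0 i * (u * m j0 p)" .
      qed
      finally show ?thesis using True by simp
    qed
    moreover have "\<exists>i\<in>I. ?t i \<notin> J" using t(2) by auto
    moreover have "\<forall>i\<in>I. ?t i \<in> D" using t(1) \<open>tp \<in> D\<close> by auto
    ultimately show ?thesis by blast
  qed
qed

text \<open>Artin's argument: a maximal subfield that is finite-dimensional over the ground field bounds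
  the dimension of the whole division algebra.\<close>

theorem contradiction: False
proof -
  obtain L where L: "L \<subseteq> D" "commuting L" "\<And>M. M \<subseteq> D \<Longrightarrow> commuting M \<Longrightarrow> L \<subseteq> M \<Longrightarrow> M = L"
  proof -
    let ?A = "{L. L \<subseteq> D \<and> commuting L}"
    have "\<exists>M\<in>?A. \<forall>X\<in>?A. M \<subseteq> X \<longrightarrow> X = M"
    proof (rule subset_Zorn_nonempty)
      have "{} \<in> ?A" by (simp add: commuting_def)
      then show "?A \<noteq> {}" by blast
      fix \<C> assume chain: "subset.chain ?A \<C>"
      have sub: "C \<subseteq> D \<and> commuting C" if "C \<in> \<C>" for C
        using chain that by (simp add: subset.chain_def subset_iff)
      have tot: "C \<subseteq> M \<or> M \<subseteq> C" if "C \<in> \<C>" "M \<in> \<C>" for C M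
        using chain that unfolding subset.chain_def by blast
      have "commuting (\<Union>\<C>)"
        unfolding commuting_def
      proof (intro ballI)
        fix x y assume "x \<in> \<Union>\<C>" "y \<in> \<Union>\<C>"
        then obtain C M where CM: "C \<in> \<C>" "M \<in> \<C>" "x \<in> C" "y \<in> M" by blast
        then have "C \<subseteq> M \<or> M \<subseteq> C" "commuting C" "commuting M"
          using tot[of C M] sub[of C] sub[of M] by simp_all
        then show "x * y \<doteq> y * x" using CM unfolding commuting_def by blast
      qed
      then show "\<Union>\<C> \<in> ?A" using sub by auto
    qed
    then obtain L where "L \<in> ?A" and max: "\<forall>X\<in>?A. L \<subseteq> X \<longrightarrow> X = L" by (rule bexE)
    show ?thesis
    proof (rule that[of L])
      show "L \<subseteq> D" "commuting L" using \<open>L \<in> ?A\<close> by simp_all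
      show "M = L" if "M \<subseteq> D" "commuting M" "L \<subseteq> M" for M
        using that by (intro max[rule_format]) simp_all
    qed
  qed
  have LI: "x \<in> L" if x: "x \<in> D" "\<And>l. l \<in> L \<Longrightarrow> x * l \<doteq> l * x" for x
  proof -
    have "commuting (insert x L)"
      using x(2) L(2) cong_sym cong_refl by (auto simp: commuting_def)
    then have "insert x L = L" using x L(1) by (intro L(3)) auto
    then show ?thesis by blast
  qed
  have LD: "x * l \<doteq> l * x" if "x \<in> L" "l \<in> L" for x l using L(2) that by (auto simp: commuting_def)
  have eL: "e \<in> L"
    using LI[of e] e_D e_left e_right cong_trans cong_sym L(1) by blast
  have L_mult: "x * y \<in> L" if "x \<in> L" "y \<in> L" for x y
    using that L(1) D LD commutes_mult cong_sym by (intro LI) (auto simp: subalgD subset_iff)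
  have L_inverse: "\<exists>u\<in>L. u * l \<doteq> e" if l: "l \<in> L" "l \<notin> J" for l
  proof -
    obtain u where u: "u \<in> D" "u * l \<doteq> e" "l * u \<doteq> e" using inverse l L(1) by blast
    have "u * k \<doteq> k * u" if k: "k \<in> L" for k
    proof -
      have kD: "k \<in> D" using k L(1) by blast
      have "u * k \<doteq> u * (k * e)" by (rule cong_mult_left[OF cong_sym[OF e_right[OF kD]]])
      also have "u * (k * e) \<doteq> u * (k * (l * u))" by (intro cong_mult_left cong_sym[OF u(3)])
      also have "u * (k * (l * u)) = u * (k * l) * u" by (simp add: mult.assoc)
      also have "u * (k * l) * u \<doteq> u * (l * k) * u" by (intro cong_mult_left cong_mult_right LD k l)
      also have "u * (l * k) * u = (u * l) * (k * u)" by (simp add: mult.assoc)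
      also have "(u * l) * (k * u) \<doteq> e * (k * u)" by (rule cong_mult_right[OF u(2)])
      also have "e * (k * u) \<doteq> k * u" using kD u D by (intro e_left) (simp add: subalgD)
      finally show ?thesis .
    qed
    then show ?thesis using u LI by blast
  qed
  obtain F where F: "finite F" "F \<subseteq> L" "L \<subseteq> span (F \<union> J)"
    using fd_mod_finite_subset[OF fd_commuting[OF L(2)]] by blast
  \<comment> \<open>One more than the size of a spanning set of \<open>L\<close>, which gives the
    system below more unknowns than equations.\<close>
  define n where "n = Suc (card F)"
  define S where "S y i = span (J \<union> {l * y j | l j. l \<in> L \<and> j < i})" for y and i :: nat
  \<comment> \<open>The \<open>y i\<close> are chosen successively outside the left
    \<open>L\<close>-span of their predecessors, which is finite-dimensional because
    \<open>L\<close> is.\<close>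
  have "\<exists>y. \<forall>i<m. y i \<in> D \<and> y i \<notin> S y i" for m :: nat
  proof (induction m)
    case (Suc m)
    then obtain y where y: "\<forall>i<m. y i \<in> D \<and> y i \<notin> S y i" by blast
    have "{l * y j | l j. l \<in> L \<and> j < m} = (\<Union>j\<in>{..<m}. (\<lambda>l. l * y j) ` L)" by blast
    moreover have "fd_mod J (\<Union>j\<in>{..<m}. (\<lambda>l. l * y j) ` L)"
      by (intro fd_mod_UN fd_mod_mult_right fd_commuting L(2)) simp
    ultimately have "fd_mod J (S y m)"
      unfolding S_def by (intro fd_mod_span fd_mod_Un fd_mod_self) simp
    then obtain z where z: "z \<in> D" "z \<notin> S y m" using D_infinite fd_mod_mono by blast
    define y' where "y' = y(m := z)"
    have y': "y' m = z" "\<And>i. i < m \<Longrightarrow> y' i = y i" by (simp_all add: y'_def)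
    have eq: "S y' i = S y i" if "i \<le> m" for i
    proof -
      have "{l * y' j | l j. l \<in> L \<and> j < i} = {l * y j | l j. l \<in> L \<and> j < i}"
        using that y'(2) by (intro Collect_cong ex_cong1) auto
      then show ?thesis unfolding S_def by simp
    qed
    have "y' i \<in> D \<and> y' i \<notin> S y' i" if "i < Suc m" for i
      using y z y' eq[of i] that by (cases "i = m") auto
    then show ?case by blast
  qed simp
  then obtain y where y: "\<And>i. i < n \<Longrightarrow> y i \<in> D" "\<And>i. i < n \<Longrightarrow> y i \<notin> S y i" by blast
  \<comment> \<open>A solution makes the map l \<mapsto> \<Sum> t_i l y_i vanish on
    \<open>L\<close>; by linearity it need only be found on the finite set \<open>F\<close>.\<close>
  define sol where "sol t \<longleftrightarrow> (\<forall>i<n. t i \<in> D) \<and> (\<forall>l\<in>L. (\<Sum>i<n. t i * (l * y i)) \<in> J)" for t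
  define supp where "supp t = {i. i < n \<and> t i \<notin> J}" for t :: "nat \<Rightarrow> 'b"
  have "\<exists>t. sol t \<and> supp t \<noteq> {}"
  proof -
    have "\<exists>t. (\<forall>i\<in>{..<n}. t i \<in> D) \<and> (\<exists>i\<in>{..<n}. t i \<notin> J) \<and>
        (\<forall>l\<in>F. (\<Sum>i<n. t i * (l * y i)) \<in> J)"
      using F L(1) y(1) D by (intro homogeneous_system) (auto simp: n_def subalgD subset_iff)
    then obtain t where t: "\<forall>i<n. t i \<in> D" "\<exists>i<n. t i \<notin> J" "\<forall>l\<in>F. (\<Sum>i<n. t i * (l * y i)) \<in> J"
      by auto
    have "subspace {l. (\<Sum>i<n. t i * (l * y i)) \<in> J}"
    proof (rule subspaceI)
      fix l k c assume l: "l \<in> {l. (\<Sum>i<n. t i * (l * y i)) \<in> J}"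
      have "(\<Sum>i<n. t i * (scale c l * y i)) = scale c (\<Sum>i<n. t i * (l * y i))"
        by (simp add: scale_sum_right scale_mult_left scale_mult_right)
      then show "scale c l \<in> {l. (\<Sum>i<n. t i * (l * y i)) \<in> J}"
        using l subspace_scale[OF J_subspace] by simp
      assume "k \<in> {l. (\<Sum>i<n. t i * (l * y i)) \<in> J}"
      then show "l + k \<in> {l. (\<Sum>i<n. t i * (l * y i)) \<in> J}"
        using l subspace_add[OF J_subspace] by (simp add: distrib_left distrib_right sum.distrib)
    qed (simp add: subspace_0[OF J_subspace])
    moreover have "F \<union> J \<subseteq> {l. (\<Sum>i<n. t i * (l * y i)) \<in> J}"
      using t(3) by (blast intro: sum_in_J J_left J_right)
    ultimately have "L \<subseteq> {l. (\<Sum>i<n. t i * (l * y i)) \<in> J}"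
      using F(3) span_minimal by blast
    then have "sol t" using t(1) by (auto simp: sol_def)
    then show ?thesis using t(2) by (auto simp: supp_def)
  qed
  then obtain t0 where "sol t0 \<and> supp t0 \<noteq> {}" by blast
  \<comment> \<open>A solution of minimal support is normalized to \<open>e\<close> at
    \<open>p\<close>. Its commutator with any \<open>l\<close> in \<open>L\<close> is again a
    solution and vanishes at \<open>p\<close>, so minimality makes it zero; the coefficients
    therefore centralize \<open>L\<close> and lie in \<open>L\<close>.\<close>
  then obtain t where t: "sol t \<and> supp t \<noteq> {}"
    and min: "\<And>t'. sol t' \<and> supp t' \<noteq> {} \<Longrightarrow> card (supp t) \<le> card (supp t')"
    using ex_has_least_nat[of "\<lambda>t. sol t \<and> supp t \<noteq> {}" t0 "\<lambda>t. card (supp t)"] by blast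
  then obtain p where p: "p < n" "t p \<notin> J" by (auto simp: supp_def)
  have tD: "t i \<in> D" if "i < n" for i using t that by (simp add: sol_def)
  obtain u where u: "u \<in> D" "u * t p \<doteq> e" using inverse[OF tD] p by blast
  define s where "s i = u * t i" for i
  have sD: "s i \<in> D" if "i < n" for i using tD[OF that] u D by (simp add: s_def subalgD)
  have s_sum: "(\<Sum>i<n. s i * (l * y i)) \<in> J" if "l \<in> L" for l
  proof -
    have "(\<Sum>i<n. s i * (l * y i)) = u * (\<Sum>i<n. t i * (l * y i))"
      by (simp add: s_def sum_distrib_left mult.assoc)
    then show ?thesis using t that J_left by (simp add: sol_def)
  qed
  have sL: "s i \<in> L" if i: "i < n" for i
  proof (rule LI[OF sD[OF i]])
    fix l assume l: "l \<in> L"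
    then have lD: "l \<in> D" using L(1) by blast
    define r where "r i = s i * l - l * s i" for i
    have "(\<Sum>i<n. r i * (k * y i)) \<in> J" if k: "k \<in> L" for k
    proof -
      have "(\<Sum>i<n. r i * (k * y i)) = (\<Sum>i<n. s i * (l * k * y i)) - l * (\<Sum>i<n. s i * (k * y i))"
        by (simp add: r_def left_diff_distrib sum_subtractf sum_distrib_left mult.assoc)
      then show ?thesis
        using s_sum[OF L_mult[OF l k]] J_left[OF s_sum[OF k]] subspace_diff[OF J_subspace] by simp
    qed
    then have "sol r" using sD lD D by (simp add: sol_def r_def subalgD)
    have "r p \<in> J"
    proof -
      have "s p * l \<doteq> e * l" unfolding s_def by (rule cong_mult_right[OF u(2)])
      also have "e * l \<doteq> l * e" using e_left[OF lD] e_right[OF lD] cong_trans cong_sym by blast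
      also have "l * e \<doteq> l * s p" unfolding s_def by (rule cong_mult_left[OF cong_sym[OF u(2)]])
      finally show ?thesis by (simp add: r_def)
    qed
    have "supp r \<subset> supp t"
    proof
      show "supp r \<subseteq> supp t"
      proof
        fix i assume "i \<in> supp r"
        then have "i < n" "s i * l - l * s i \<notin> J" by (auto simp: supp_def r_def)
        moreover from this have "s i \<notin> J" using commutes_J cong_sym by blast
        ultimately show "i \<in> supp t" using J_left by (auto simp: supp_def s_def)
      qed
      show "supp r \<noteq> supp t" using p \<open>r p \<in> J\<close> by (auto simp: supp_def)
    qed
    then have "card (supp r) < card (supp t)" by (intro psubset_card_mono) (auto simp: supp_def)
    then have "supp r = {}" using min[of r] \<open>sol r\<close> by linarith
    then show "s i * l \<doteq> l * s i" using i by (auto simp: supp_def r_def)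
  qed
  have "s p \<notin> J" using cong_mem[OF u(2)] e_notin_J by (simp add: s_def)
  \<comment> \<open>Index of the last nonzero coefficient: the relation at l = e, solved for
    \<open>y q\<close>, puts it into the left \<open>L\<close>-span of its predecessors.\<close>
  define q where "q = Max {i. i < n \<and> s i \<notin> J}"
  have q: "q < n" "s q \<notin> J" "\<And>i. i < n \<Longrightarrow> q < i \<Longrightarrow> s i \<in> J"
  proof -
    have fin: "finite {i. i < n \<and> s i \<notin> J}" by simp
    have "{i. i < n \<and> s i \<notin> J} \<noteq> {}" using p \<open>s p \<notin> J\<close> by blast
    then have "q \<in> {i. i < n \<and> s i \<notin> J}" unfolding q_def by (intro Max_in fin)
    then show "q < n" "s q \<notin> J" by auto
    show "s i \<in> J" if "i < n" "q < i" for i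
    proof (rule ccontr)
      assume "s i \<notin> J"
      then have "i \<le> q" unfolding q_def using that by (intro Max_ge fin) simp
      then show False using that by simp
    qed
  qed
  obtain v where v: "v \<in> L" "v * s q \<doteq> e" using L_inverse[OF sL] q by blast
  have "v * (\<Sum>i<n. s i * (e * y i)) \<in> J" by (rule J_left[OF s_sum[OF eL]])
  also have "v * (\<Sum>i<n. s i * (e * y i)) = (\<Sum>i<n. v * s i * e * y i)"
    by (simp add: sum_distrib_left mult.assoc)
  finally have vJ: "(\<Sum>i<n. v * s i * e * y i) \<in> J" .
  have SJ: "J \<subseteq> S y q" by (auto simp: S_def intro: span_base)
  have Ssub: "subspace (S y q)" by (simp add: S_def)
  have rest: "(\<Sum>i\<in>{..<n} - {q}. v * s i * e * y i) \<in> S y q"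
  proof (rule subspace_sum[OF Ssub])
    fix i assume i: "i \<in> {..<n} - {q}"
    show "v * s i * e * y i \<in> S y q"
    proof (cases "i < q")
      case True
      then have "v * s i * e \<in> L" using L_mult v(1) sL eL i by simp
      then show ?thesis unfolding S_def using True
        by (intro span_base UnI2 CollectI exI[of _ "v * s i * e"] exI[of _ i] conjI refl)
    next
      case False
      then have "s i \<in> J" using i by (intro q(3)) auto
      then have "v * s i * e * y i \<in> J" by (intro J_right J_left)
      then show ?thesis using SJ by blast
    qed
  qed
  have "(\<Sum>i<n. v * s i * e * y i) = v * s q * e * y q + (\<Sum>i\<in>{..<n} - {q}. v * s i * e * y i)"
    by (rule sum.remove) (simp_all add: q(1))
  then have "v * s q * e * y q = (\<Sum>i<n. v * s i * e * y i) - (\<Sum>i\<in>{..<n} - {q}. v * s i * e * y i)"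
    by simp
  also have "\<dots> \<in> S y q" by (rule subspace_diff[OF Ssub subsetD[OF SJ vJ] rest])
  finally have top: "v * s q * e * y q \<in> S y q" .
  have "y q \<doteq> v * s q * e * y q"
  proof -
    have yD: "y q \<in> D" using y q by blast
    have "v * s q * e * y q \<doteq> e * e * y q" by (intro cong_mult_right v(2))
    also have "e * e * y q \<doteq> e * y q" by (intro cong_mult_right e_left e_D)
    also have "e * y q \<doteq> y q" by (rule e_left[OF yD])
    finally show ?thesis by (rule cong_sym)
  qed
  from subspace_add[OF Ssub subsetD[OF SJ this] top] have "y q \<in> S y q" by simp
  then show False using y(2) q by blast
qed

end

context finite_commuting
begin

text \<open>Laffey's theorem for A / J, by contradiction. In the corner \<open>D\<close> of a
  primitive idempotent of \<open>B\<close> every element is nilpotent or invertible, and nilpotents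
  lie in \<open>J\<close>; this leaves an infinite-dimensional division algebra, which
  \<open>division_mod\<close> excludes.\<close>

theorem fd_mod_UNIV: "fd_mod J UNIV"
proof (rule ccontr)
  assume "\<not> fd_mod J UNIV"
  then obtain B where B: "subalg B" "1 \<in> B" "\<not> fd_mod J B"
    and nilp: "\<And>x n b. x \<in> B \<Longrightarrow> x ^ n \<in> J \<Longrightarrow> b \<in> B \<Longrightarrow> b * x \<doteq> x * b"
    and idem: "\<And>e b. e \<in> B \<Longrightarrow> e * e \<doteq> e \<Longrightarrow> b \<in> B \<Longrightarrow> b * e \<doteq> e * b"
    by (rule obtain_central_subalgebra) blast
  obtain e where e: "e \<in> B" "e * e \<doteq> e" "\<not> fd_mod J ((*) e ` B)"
    and prim: "\<forall>f\<in>B. f * f \<doteq> f \<longrightarrow> e * f \<in> J \<or> e * f \<doteq> e"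
    using obtain_primitive_idempotent[OF B idem] by blast
  define D where "D = {b \<in> B. e * b \<doteq> b}"
  have DB: "D \<subseteq> B" by (auto simp: D_def)
  have eB: "(*) e ` B \<subseteq> D"
    using e B cong_mult_right[OF e(2)] by (auto simp: D_def subalgD mult.assoc)
  have e_left: "e * b \<doteq> b" if "b \<in> D" for b using that by (simp add: D_def)
  have subD: "subalg D"
    unfolding subalg_def
  proof (intro conjI ballI)
    show "J \<subseteq> D"
    proof
      fix x assume "x \<in> J"
      then have "x \<in> B" "e * x \<doteq> x"
        using B J_left subspace_diff[OF J_subspace] subalgD(2)[OF B(1)] by auto
      then show "x \<in> D" by (simp add: D_def)
    qed
    show "subspace D"
    proof (rule subspaceI)
      show "0 \<in> D" using B subspace_0[OF J_subspace] by (simp add: D_def subalgD)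
      show "x + y \<in> D" if "x \<in> D" "y \<in> D" for x y
        using that B cong_add[of "e * x" x "e * y" y] by (simp add: D_def subalgD distrib_left)
      show "scale c x \<in> D" if "x \<in> D" for c x
        using that B subspace_scale[OF J_subspace, of "e * x - x" c]
        by (simp add: D_def subalgD scale_mult_right scale_right_diff_distrib)
    qed
    show "x * y \<in> D" if "x \<in> D" "y \<in> D" for x y
      using that B cong_mult_right[of "e * x" x y] by (simp add: D_def subalgD mult.assoc)
  qed
  interpret U: unital_mod scale J D e
  proof
    show "subalg D" by (rule subD)
    show "e \<in> D" using e by (simp add: D_def)
    show "e * b \<doteq> b" if "b \<in> D" for b using that by (rule e_left)
    show "b * e \<doteq> b" if "b \<in> D" for b
      using idem[OF e(1,2), of b] e_left[OF that] that DB cong_trans by blast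
    show "\<not> fd_mod J D" using e(3) fd_mod_mono[OF _ eB] by blast
  qed
  have unit: "(\<exists>n. b ^ n \<in> J) \<or> (\<exists>u\<in>D. u * b \<doteq> e \<and> b * u \<doteq> e)" if "b \<in> D" for b
  proof (rule U.nilpotent_or_unit[OF _ that])
    fix f assume f: "f \<in> D" "f * f \<doteq> f"
    then have "e * f \<in> J \<or> e * f \<doteq> e" using prim DB by blast
    then show "f \<in> J \<or> f \<doteq> e"
      using cong_mem[OF e_left[OF f(1)]] cong_trans[OF cong_sym[OF e_left[OF f(1)]]] by blast
  qed
  have no_nilp: "x \<in> J" if "x \<in> D" "x ^ n \<in> J" for x n
    using U.no_nilpotents[OF unit _ that] nilp DB by blast
  interpret V: division_mod scale J D e
    by unfold_locales (use unit no_nilp in blast)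
  show False by (rule V.contradiction)
qed

end

section \<open>Algebras whose inner derivations span a finite-dimensional space\<close>

definition center :: "'a::ring_1 set"
  where "center = {z. \<forall>a. z * a = a * z}"

text \<open>The largest ideal contained in the center.\<close>

definition core :: "'a::ring_1 set"
  where "core = {z \<in> center. \<forall>a b. z * (a * b - b * a) = 0}"

lemma centerD: "z \<in> center \<Longrightarrow> z * a = a * z"
  by (simp add: center_def)

lemma core_center: "core \<subseteq> center"
  by (auto simp: core_def)

lemma coreD: "s \<in> core \<Longrightarrow> s * a = a * s" "s \<in> core \<Longrightarrow> a * b * s = b * a * s"
proof -
  assume s: "s \<in> core"
  then show c: "s * a = a * s" for a by (simp add: core_def centerD)
  have "s * (a * b - b * a) = 0" using s by (simp add: core_def)
  then show "a * b * s = b * a * s" by (simp add: c left_diff_distrib)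
qed

context assoc_algebra
begin

lemma center_subspace: "subspace center"
proof (rule subspaceI)
  show "0 \<in> center" by (simp add: center_def)
  fix x y :: 'a and c assume x: "x \<in> center"
  show "scale c x \<in> center"
    unfolding center_def by (simp add: scale_mult_left scale_mult_right centerD[OF x])
  assume y: "y \<in> center"
  show "x + y \<in> center"
    unfolding center_def by (simp add: distrib_left distrib_right centerD[OF x] centerD[OF y])
qed

lemma core_subspace: "subspace core"
proof (rule subspaceI)
  show "(0 :: 'a) \<in> core" using subspace_0[OF center_subspace] by (simp add: core_def)
  fix x y :: 'a and c assume x: "x \<in> core"
  then show "scale c x \<in> core"
    using subspace_scale[OF center_subspace] by (simp add: core_def scale_mult_left)
  assume "y \<in> core"
  with x show "x + y \<in> core"
    using subspace_add[OF center_subspace] by (simp add: core_def distrib_right)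
qed

lemma core_mult: "x \<in> core \<Longrightarrow> a * x \<in> core"
proof -
  assume x: "x \<in> core"
  note c = coreD[OF x]
  have "a * x * b = b * (a * x)" for b
    using c(1)[of b] c(2)[of a b] by (simp add: mult.assoc)
  moreover have "a * x * (b * c - c * b) = 0" for b c
    using x by (simp add: core_def mult.assoc)
  ultimately show ?thesis by (simp add: core_def center_def)
qed

lemma algebra_ideal_core: "algebra_ideal scale core"
proof
  show "subspace core" by (rule core_subspace)
  show "a * x \<in> core" "x * a \<in> core" if "x \<in> core" for x a
    using core_mult[OF that] coreD(1)[OF that] by simp_all
qed

lemma subalgebra_hull_induct:
  assumes "subalgebra hull S = UNIV" "S \<subseteq> B" "subspace B" "1 \<in> B" "\<And>a b. a \<in> B \<Longrightarrow> b \<in> B \<Longrightarrow> a * b \<in> B"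
  shows "B = UNIV"
  using hull_minimal[of S B subalgebra] assms by (auto simp: subalgebra_def)

text \<open>Requiring z g to be central for a generator g costs finitely many dimensions of the
  center. For central z, the a with z a central form a subalgebra, so finitely many such conditions
  force z A into the center; then z a b = b z a = z b a.\<close>

lemma fd_mod_core_center:
  assumes S: "finite S" "subalgebra hull S = UNIV"
    and fd: "\<And>a. fd_mod center ((\<lambda>z. z * a) ` center)"
  shows "fd_mod core center"
proof -
  interpret endo: vector_space_pair scale scale ..
  have lin: "Vector_Spaces.linear scale scale (\<lambda>z. z * a)" for a
    by unfold_locales (auto simp: algebra_simps scale_mult_left)
  have sub: "subspace {z \<in> center. \<forall>a\<in>T. z * a \<in> center}" for T
    using center_subspace
    by (intro subspaceI)
      (auto simp: distrib_right scale_mult_left subspace_0 subspace_add subspace_scale)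
  have step: "fd_mod {z \<in> center. \<forall>a\<in>T. z * a \<in> center} center" if "finite T" for T
    using that
  proof (induction T rule: finite_induct)
    case (insert a T)
    let ?U = "{z \<in> center. \<forall>a\<in>T. z * a \<in> center}"
    let ?V = "{z \<in> center. \<forall>a\<in>insert a T. z * a \<in> center}"
    have im: "fd_mod center ((\<lambda>z. z * a) ` ?U)" by (rule fd_mod_mono[OF fd]) auto
    have sp: "span center = center" using center_subspace by (simp add: span_eq_iff)
    have "{z \<in> ?U. z * a \<in> span center} = ?V" unfolding sp by auto
    then have "fd_mod ?V {z \<in> ?U. z * a \<in> span center}" by (simp only: fd_mod_self)
    with im have "fd_mod ?V ?U" by (rule endo.fd_mod_kernel[OF lin sub])
    then show ?case by (rule fd_mod_trans[OF insert.IH])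
  qed (simp add: fd_mod_self)
  have "fd_mod {z \<in> center. \<forall>a\<in>S. z * a \<in> center} center" by (rule step[OF S(1)])
  moreover have "{z \<in> center. \<forall>a\<in>S. z * a \<in> center} \<subseteq> core"
  proof
    fix z assume z: "z \<in> {z \<in> center. \<forall>a\<in>S. z * a \<in> center}"
    let ?B = "{a. z * a \<in> center}"
    note zc = centerD[of z]
    have "?B = UNIV"
    proof (rule subalgebra_hull_induct[OF S(2)])
      show "S \<subseteq> ?B" "1 \<in> ?B" using z by auto
      show "subspace ?B"
        using center_subspace by (intro subspaceI)
          (auto simp: distrib_left scale_mult_right subspace_0 subspace_add subspace_scale)
      fix a b assume "a \<in> ?B" "b \<in> ?B"
      then have ab: "z * a * c = c * (z * a)" "z * b * c = c * (z * b)" for c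
        using centerD[of "z * a" c] centerD[of "z * b" c] by simp_all
      have "z * (a * b) * c = c * (z * (a * b))" for c
      proof -
        have "z * (a * b) * c - c * (z * (a * b)) = (z * a) * (b * c) - (c * (z * a)) * b"
          by (simp add: mult.assoc)
        also have "\<dots> = (z * a) * (b * c - c * b)"
          using ab(1)[of c] by (simp add: right_diff_distrib mult.assoc[symmetric])
        also have "\<dots> = (b * c - c * b) * (z * a)" by (rule ab(1))
        also have "\<dots> = (b * c - c * b) * z * a" by (simp only: mult.assoc)
        also have "(b * c - c * b) * z = 0"
        proof -
          have "(b * c - c * b) * z = z * (b * c - c * b)" using z zc[of "b * c - c * b"] by simp
          also have "\<dots> = z * b * c - z * c * b" by (simp add: right_diff_distrib mult.assoc)
          also have "z * c * b = c * (z * b)" using z zc[of c] by (simp add: mult.assoc)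
          finally show ?thesis using ab(2)[of c] by simp
        qed
        finally show ?thesis by simp
      qed
      then show "a * b \<in> ?B" by (simp add: center_def)
    qed
    then have zB: "z * a \<in> center" for a by auto
    have "z * (a * b - b * a) = 0" for a b
    proof -
      have "z * a * b = b * (z * a)" by (rule centerD[OF zB])
      also have "\<dots> = z * b * a" using z zc[of b] by (simp add: mult.assoc[symmetric])
      finally show ?thesis by (simp add: right_diff_distrib mult.assoc)
    qed
    then show "z \<in> core" using z by (simp add: core_def)
  qed
  ultimately show ?thesis by (rule fd_mod_base_mono)
qed

lemma linear_ad: "Vector_Spaces.linear scale (fun_scale scale) ad"
  by unfold_locales
    (auto simp: ad_def fun_scale_def fun_eq_iff algebra_simps scale_mult_left scale_mult_right
      scale_right_diff_distrib)

lemma ad_eq_0_iff: "ad a = 0 \<longleftrightarrow> a \<in> center"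
  by (auto simp: ad_def center_def fun_eq_iff)

lemma fd_mod_center_iff: "fd_mod center (span C) \<longleftrightarrow> maps.fd_mod {} (ad ` C)"
proof
  interpret P: vector_space_pair scale "fun_scale scale" ..
  have sp: "ad ` span C = maps.span (ad ` C)" by (rule P.linear_span_image[OF linear_ad, symmetric])
  {
    assume "fd_mod center (span C)"
    then have "maps.fd_mod {} (ad ` span C)"
      by (rule P.fd_mod_image[OF linear_ad]) (use ad_eq_0_iff in auto)
    then show "maps.fd_mod {} (ad ` C)" unfolding sp by (rule maps.fd_mod_mono) (auto intro: maps.span_base)
  next
    assume "maps.fd_mod {} (ad ` C)"
    then have "maps.fd_mod {} (ad ` span C)" unfolding sp by (rule maps.fd_mod_span)
    moreover have "fd_mod center {u \<in> span C. ad u \<in> maps.span {}}"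
      by (rule fd_mod_mono[OF fd_mod_self]) (auto simp: ad_eq_0_iff)
    ultimately show "fd_mod center (span C)"
      by (rule P.fd_mod_kernel[OF linear_ad subspace_span])
  }
qed

text \<open>The center need not be an ideal, so the theorem on commuting families is applied modulo
  \<open>core\<close>. For fixed a, the elements z a with z central commute, which yields finite
  codimension of \<open>core\<close> in the center; sets commuting modulo \<open>core\<close> are
  then finite-dimensional modulo \<open>core\<close>, not only modulo the center.\<close>

lemma Inn_infinite_abelian:
  assumes fg: "finitely_generated" and inf: "\<not> maps.fd_mod {} (Inn :: ('a \<Rightarrow> 'a) set)"
  shows "\<exists>C. C \<subseteq> Inn \<and> (\<forall>x\<in>C. \<forall>y\<in>C. commutator x y = 0) \<and> \<not> maps.fd_mod {} C"
proof (rule ccontr)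
  assume neg: "\<not> ?thesis"
  have fd: "maps.fd_mod {} C"
    if "C \<subseteq> Inn" "\<And>x y. x \<in> C \<Longrightarrow> y \<in> C \<Longrightarrow> commutator x y = 0" for C
    using that neg by blast
  obtain S where S: "finite S" "subalgebra hull S = UNIV" using fg by (auto simp: finitely_generated_def)
  have comm: "fd_mod center C" if C: "\<And>x y. x \<in> C \<Longrightarrow> y \<in> C \<Longrightarrow> x * y - y * x \<in> center" for C
  proof -
    have "maps.fd_mod {} (ad ` C)"
    proof (rule fd)
      show "ad ` C \<subseteq> Inn" by (auto simp: Inn_def)
      fix f g assume "f \<in> ad ` C" "g \<in> ad ` C"
      then obtain x y where xy: "x \<in> C" "y \<in> C" "f = ad x" "g = ad y" by blast
      have "commutator f g = ad (x * y - y * x)"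
        unfolding xy commutator_ad[OF ad_Der] by (simp add: ad_def)
      moreover have "ad (x * y - y * x) = 0" unfolding ad_eq_0_iff by (rule C[OF xy(1,2)])
      ultimately show "commutator f g = 0" by simp
    qed
    then have "fd_mod center (span C)" by (simp add: fd_mod_center_iff)
    then show ?thesis by (rule fd_mod_mono) (auto intro: span_base)
  qed
  have core: "fd_mod core center"
  proof (rule fd_mod_core_center[OF S], rule comm)
    fix a x y assume "x \<in> (\<lambda>z. z * a) ` center" "y \<in> (\<lambda>z. z * a) ` center"
    then obtain z w where zw: "x = z * a" "y = w * a" "z \<in> center" "w \<in> center" by blast
    have "x * y = z * (a * w) * a" by (simp add: zw mult.assoc)
    also have "\<dots> = (z * w) * a * a" using zw centerD[of w a] by (simp add: mult.assoc)
    also have "\<dots> = (w * z) * a * a" using zw centerD[of w z] by simp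
    also have "\<dots> = w * (a * z) * a" using zw centerD[of z a] by (simp add: mult.assoc)
    also have "\<dots> = y * x" by (simp add: zw mult.assoc)
    finally show "x * y - y * x \<in> center" by (simp add: center_def)
  qed
  interpret algebra_ideal scale core by (rule algebra_ideal_core)
  interpret finite_commuting scale core
  proof
    fix C assume "commuting C"
    then have "fd_mod center C" using core_center by (intro comm) (auto simp: commuting_def)
    then show "fd_mod core C" by (rule fd_mod_trans[OF _ core])
  qed
  have "fd_mod center (span UNIV)"
    using fd_mod_base_mono[OF fd_mod_UNIV core_center] by simp
  then have "maps.fd_mod {} (ad ` UNIV)" by (simp only: fd_mod_center_iff)
  then show False using inf by (simp add: Inn_def)
qed

lemma Inn_finite_core:
  assumes fg: "finitely_generated" and fin: "maps.fd_mod {} (Inn :: ('a \<Rightarrow> 'a) set)"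
  shows "fd_mod core UNIV"
proof -
  obtain S where S: "finite S" "subalgebra hull S = UNIV" using fg by (auto simp: finitely_generated_def)
  have "fd_mod center (span UNIV)" using fin unfolding fd_mod_center_iff Inn_def .
  then have UNIV: "fd_mod center UNIV" by simp
  then have "fd_mod core center"
    by (intro fd_mod_core_center[OF S]) (rule fd_mod_mono, auto)
  then show ?thesis by (rule fd_mod_trans[OF UNIV])
qed

end

section \<open>Noetherianity of finitely generated commutative quotients\<close>

locale commutative_mod = algebra_ideal +
  assumes commutator_J: "a * b \<doteq> b * a"
begin

text \<open>The subring B[r] read modulo \<open>J\<close>: coefficients stand on the left, and
  reordering a product costs only elements of \<open>J\<close>.\<close>

definition adjoin :: "'b set \<Rightarrow> 'b \<Rightarrow> 'b set"
  where "adjoin B r = {\<Sum>i<n. c i * r ^ i | n c. \<forall>i. c i \<in> B}"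

lemma adjoinI: "(\<And>i. c i \<in> B) \<Longrightarrow> (\<Sum>i<n. c i * r ^ i) \<in> adjoin B r"
  unfolding adjoin_def by blast

lemma sum_pad:
  fixes c :: "nat \<Rightarrow> 'b"
  assumes "n \<le> m"
  shows "(\<Sum>i<n. c i * r ^ i) = (\<Sum>i<m. (if i < n then c i else 0) * r ^ i)"
proof -
  have "(\<Sum>i<n. c i * r ^ i) = (\<Sum>i<n. (if i < n then c i else 0) * r ^ i)"
    by (intro sum.cong) auto
  also have "\<dots> = (\<Sum>i<m. (if i < n then c i else 0) * r ^ i)"
    using assms by (intro sum.mono_neutral_left) auto
  finally show ?thesis .
qed

lemma commute_power: "r ^ i * b \<doteq> b * r ^ i"
  by (rule commutator_J)

lemma adjoin_subspace:
  assumes "subspace B" shows "subspace (adjoin B r)"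
proof (rule subspaceI)
  have "(\<Sum>i<0. (\<lambda>_. 0) i * r ^ i) \<in> adjoin B r" using subspace_0[OF assms] by (intro adjoinI)
  then show "0 \<in> adjoin B r" by simp
  fix x y k assume x: "x \<in> adjoin B r"
  then obtain n c where c: "x = (\<Sum>i<n. c i * r ^ i)" "\<forall>i. c i \<in> B" unfolding adjoin_def by blast
  have "(\<Sum>i<n. scale k (c i) * r ^ i) \<in> adjoin B r"
    using c subspace_scale[OF assms] by (intro adjoinI) auto
  then show "scale k x \<in> adjoin B r" by (simp add: c scale_sum_right scale_mult_left)
  assume y: "y \<in> adjoin B r"
  then obtain m d where d: "y = (\<Sum>i<m. d i * r ^ i)" "\<forall>i. d i \<in> B" unfolding adjoin_def by blast
  have "(\<Sum>i<max n m. ((if i < n then c i else 0) + (if i < m then d i else 0)) * r ^ i) \<in> adjoin B r"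
    using c(2) d(2) subspace_0[OF assms] subspace_add[OF assms] by (intro adjoinI) auto
  moreover have "(\<Sum>i<max n m. ((if i < n then c i else 0) + (if i < m then d i else 0)) * r ^ i) = x + y"
    unfolding c d sum_pad[of n "max n m", OF max.cobounded1] sum_pad[of m "max n m", OF max.cobounded2]
    by (simp add: distrib_right sum.distrib del: if_distrib)
  ultimately show "x + y \<in> adjoin B r" by simp
qed

lemma adjoin_monomial:
  assumes "subspace B" "b \<in> B" shows "b * r ^ i \<in> adjoin B r"
proof -
  have "(\<Sum>j<Suc i. (if j = i then b else 0) * r ^ j) \<in> adjoin B r"
    using assms subspace_0[of B] by (intro adjoinI) auto
  moreover have "(\<Sum>j<i. (if j = i then b else 0) * r ^ j) = 0"
    by (intro sum.neutral) auto
  ultimately show ?thesis by simp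
qed

lemma adjoin_superset: "subspace B \<Longrightarrow> B \<subseteq> adjoin B r"
  using adjoin_monomial[of B _ r 0] by auto

lemma adjoin_element: "subspace B \<Longrightarrow> 1 \<in> B \<Longrightarrow> r \<in> adjoin B r"
  using adjoin_monomial[of B 1 r 1] by simp

lemma adjoin_subalg:
  assumes B: "subalg B" shows "subalg (adjoin B r)"
  unfolding subalg_def
proof (intro conjI ballI)
  note sB = subalgD(1)[OF B]
  note sA = adjoin_subspace[OF sB]
  show "subspace (adjoin B r)" by (rule sA)
  show JA: "J \<subseteq> adjoin B r" using subalgD(2)[OF B] adjoin_superset[OF sB] by blast
  fix x y assume "x \<in> adjoin B r" "y \<in> adjoin B r"
  then obtain n c m d where c: "x = (\<Sum>i<n. c i * r ^ i)" "\<forall>i. c i \<in> B"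
    and d: "y = (\<Sum>i<m. d i * r ^ i)" "\<forall>i. d i \<in> B" unfolding adjoin_def by blast
  have "c i * r ^ i * (d j * r ^ j) \<in> adjoin B r" for i j
  proof -
    have "c i * r ^ i * (d j * r ^ j) = c i * d j * r ^ (i + j) + c i * (r ^ i * d j - d j * r ^ i) * r ^ j"
      by (simp add: algebra_simps power_add)
    moreover have "c i * (r ^ i * d j - d j * r ^ i) * r ^ j \<in> J"
      by (intro J_left J_right commute_power)
    moreover have "c i * d j * r ^ (i + j) \<in> adjoin B r"
      using c d B by (intro adjoin_monomial sB) (simp add: subalgD)
    ultimately show ?thesis using subspace_add[OF sA] JA by auto
  qed
  then show "x * y \<in> adjoin B r"
    unfolding c d sum_product by (intro subspace_sum[OF sA])
qed

lemma subalg_base: "subalg (span (insert 1 J))"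
proof -
  have *: "span (insert 1 J) = {x. \<exists>k. x - scale k 1 \<in> J}"
    unfolding span_insert using J_subspace by simp
  have "x * y \<in> span (insert 1 J)" if xy: "x \<in> span (insert 1 J)" "y \<in> span (insert 1 J)" for x y
  proof -
    obtain k l where k: "x - scale k 1 \<in> J" "y - scale l 1 \<in> J" using xy unfolding * by blast
    have "x * y - scale (k * l) 1 = (x - scale k 1) * y + scale k (y - scale l 1)"
      by (simp add: algebra_simps scale_mult_left scale_right_diff_distrib)
    also have "\<dots> \<in> J"
      by (intro subspace_add[OF J_subspace] J_right k subspace_scale[OF J_subspace])
    finally show ?thesis unfolding * by blast
  qed
  then show ?thesis unfolding subalg_def by (auto intro: span_base)
qed

text \<open>Starting from the scalars modulo \<open>J\<close> and adjoining one generator after the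
  other exhausts the algebra.\<close>

lemma adjoin_induct_generators:
  assumes S: "finite S" "subalgebra hull S = UNIV"
    and base: "P (span (insert 1 J))"
    and step: "\<And>B r. subalg B \<Longrightarrow> 1 \<in> B \<Longrightarrow> P B \<Longrightarrow> r \<in> S \<Longrightarrow> P (adjoin B r)"
  shows "P UNIV"
proof -
  have "\<exists>B. subalg B \<and> 1 \<in> B \<and> T \<subseteq> B \<and> P B" if "T \<subseteq> S" for T
    using finite_subset[OF that S(1)] that
  proof (induction T rule: finite_induct)
    case empty
    have "1 \<in> span (insert 1 J)" by (auto intro: span_base)
    then show ?case using base subalg_base by blast
  next
    case (insert r T)
    then obtain B where B: "subalg B" "1 \<in> B" "T \<subseteq> B" "P B" by blast
    note sB = subalgD(1)[OF B(1)]
    have "subalg (adjoin B r)" "P (adjoin B r)" using adjoin_subalg B step insert by auto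
    moreover have "insert r T \<subseteq> adjoin B r" "1 \<in> adjoin B r"
      using adjoin_superset[OF sB] adjoin_element[OF sB B(2)] B by auto
    ultimately show ?case by blast
  qed
  then obtain B where B: "subalg B" "1 \<in> B" "S \<subseteq> B" "P B" by blast
  have "B = UNIV" using B by (intro subalgebra_hull_induct[OF S(2)]) (auto simp: subalgD)
  then show ?thesis using B by simp
qed

definition ideal_over :: "'b set \<Rightarrow> 'b set \<Rightarrow> bool"
  where "ideal_over B I \<longleftrightarrow> subspace I \<and> J \<subseteq> I \<and> I \<subseteq> B \<and> (\<forall>b\<in>B. \<forall>x\<in>I. b * x \<in> I)"

definition noetherian_over :: "'b set \<Rightarrow> bool"
  where "noetherian_over B \<longleftrightarrow> (\<forall>I::nat \<Rightarrow> 'b set. (\<forall>n. ideal_over B (I n)) \<longrightarrow> mono I \<longrightarrow> (\<exists>N. \<forall>n\<ge>N. I n = I N))"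

lemma noetherian_over_base: "noetherian_over (span (insert 1 J))"
  unfolding noetherian_over_def
proof (intro allI impI)
  fix I :: "nat \<Rightarrow> 'b set" assume I: "\<forall>n. ideal_over (span (insert 1 J)) (I n)" and mono: "mono I"
  have dich: "I n = J \<or> I n = span (insert 1 J)" for n
  proof (cases "I n \<subseteq> J")
    case False
    then obtain x where x: "x \<in> I n" "x \<notin> J" by blast
    have In: "subspace (I n)" "J \<subseteq> I n" "I n \<subseteq> span (insert 1 J)" using I by (auto simp: ideal_over_def)
    then obtain k where k: "x - scale k 1 \<in> J" using x unfolding span_insert by auto
    then have "k \<noteq> 0" using x by auto
    have "x - (x - scale k 1) \<in> I n" using subspace_diff[OF In(1)] x k In(2) by blast
    then have "scale k 1 \<in> I n" by simp
    then have "scale (1 / k) (scale k 1) \<in> I n" by (rule subspace_scale[OF In(1)])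
    then have "1 \<in> I n" using \<open>k \<noteq> 0\<close> by simp
    then have "span (insert 1 J) \<subseteq> I n" using In by (intro span_minimal) auto
    then show ?thesis using In by blast
  qed (use I in \<open>auto simp: ideal_over_def\<close>)
  show "\<exists>N. \<forall>n\<ge>N. I n = I N"
  proof (cases "\<exists>N. I N \<noteq> J")
    case True
    then obtain N where N: "I N = span (insert 1 J)" using dich by blast
    have "I n = I N" if "n \<ge> N" for n
    proof -
      have "I N \<subseteq> I n" using monoD[OF mono that] .
      then show ?thesis using N dich[of n] I unfolding ideal_over_def by blast
    qed
    then show ?thesis by blast
  qed auto
qed

text \<open>Hilbert's basis theorem, by comparing ideals of leading coefficients.\<close>

definition leading :: "'b set \<Rightarrow> 'b \<Rightarrow> nat \<Rightarrow> 'b set \<Rightarrow> 'b set"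
  where "leading B r d I = {b \<in> B. \<exists>c. (\<forall>i. c i \<in> B) \<and> b * r ^ d + (\<Sum>i<d. c i * r ^ i) \<in> I}"

text \<open>The diagonal chain, degree m of \<open>I m\<close>, is stationary from some
  \<open>M\<close> on and settles all degrees from \<open>M\<close> upwards at once; the finitely
  many lower degrees are settled one by one. If the leading ideals agree in all degrees, the ideals
  agree by induction on the degree.\<close>

lemma noetherian_over_adjoin:
  assumes B: "subalg B" "1 \<in> B" and noeth: "noetherian_over B"
  shows "noetherian_over (adjoin B r)"
  unfolding noetherian_over_def
proof (intro allI impI)
  note sB = subalgD(1)[OF B(1)]
  fix I :: "nat \<Rightarrow> 'b set" assume I: "\<forall>n. ideal_over (adjoin B r) (I n)" and mono: "mono I"
  have In: "subspace (I n)" "J \<subseteq> I n" "I n \<subseteq> adjoin B r"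
    "\<And>b x. b \<in> adjoin B r \<Longrightarrow> x \<in> I n \<Longrightarrow> b * x \<in> I n" for n
    using I by (auto simp: ideal_over_def)
  have B_adj: "b \<in> adjoin B r" if "b \<in> B" for b using adjoin_superset[OF sB] that by blast
  have lead: "ideal_over B (leading B r d (I n))" for d n
    unfolding ideal_over_def
  proof (intro conjI ballI)
    show "leading B r d (I n) \<subseteq> B" by (auto simp: leading_def)
    show "J \<subseteq> leading B r d (I n)"
    proof
      fix x assume x: "x \<in> J"
      have "x * r ^ d + (\<Sum>i<d. 0 * r ^ i) \<in> I n" using J_right[OF x] In(2) by auto
      then show "x \<in> leading B r d (I n)"
        unfolding leading_def using subsetD[OF subalgD(2)[OF B(1)] x] B
        by (intro CollectI conjI exI[of _ "\<lambda>_. 0"]) (auto simp: subalgD)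
    qed
    show "subspace (leading B r d (I n))"
    proof (rule subspaceI)
      show "0 \<in> leading B r d (I n)" using \<open>J \<subseteq> leading B r d (I n)\<close> subspace_0[OF J_subspace] by blast
      fix x y k assume x: "x \<in> leading B r d (I n)"
      then obtain c where c: "x \<in> B" "\<forall>i. c i \<in> B" "x * r ^ d + (\<Sum>i<d. c i * r ^ i) \<in> I n"
        by (auto simp: leading_def)
      have "scale k (x * r ^ d + (\<Sum>i<d. c i * r ^ i)) \<in> I n" by (rule subspace_scale[OF In(1) c(3)])
      then have "scale k x * r ^ d + (\<Sum>i<d. scale k (c i) * r ^ i) \<in> I n"
        by (simp add: scale_right_distrib scale_mult_left scale_sum_right)
      then show "scale k x \<in> leading B r d (I n)"
        unfolding leading_def using c B
        by (intro CollectI conjI exI[of _ "\<lambda>i. scale k (c i)"]) (auto simp: subalgD)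
      assume "y \<in> leading B r d (I n)"
      then obtain e where e: "y \<in> B" "\<forall>i. e i \<in> B" "y * r ^ d + (\<Sum>i<d. e i * r ^ i) \<in> I n"
        by (auto simp: leading_def)
      have "(x + y) * r ^ d + (\<Sum>i<d. (c i + e i) * r ^ i) \<in> I n"
        using subspace_add[OF In(1) c(3) e(3)] by (simp add: distrib_right sum.distrib algebra_simps)
      then show "x + y \<in> leading B r d (I n)"
        unfolding leading_def using c e B
        by (intro CollectI conjI exI[of _ "\<lambda>i. c i + e i"]) (auto simp: subalgD)
    qed
    fix b x assume b: "b \<in> B" and "x \<in> leading B r d (I n)"
    then obtain c where c: "x \<in> B" "\<forall>i. c i \<in> B" "x * r ^ d + (\<Sum>i<d. c i * r ^ i) \<in> I n"
      by (auto simp: leading_def)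
    have "b * (x * r ^ d + (\<Sum>i<d. c i * r ^ i)) \<in> I n" by (rule In(4)[OF B_adj[OF b] c(3)])
    then have "b * x * r ^ d + (\<Sum>i<d. b * c i * r ^ i) \<in> I n"
      by (simp add: distrib_left sum_distrib_left mult.assoc)
    then show "b * x \<in> leading B r d (I n)"
      unfolding leading_def using b c B
      by (intro CollectI conjI exI[of _ "\<lambda>i. b * c i"]) (auto simp: subalgD)
  qed
  have mono_I: "leading B r d (I n) \<subseteq> leading B r d (I m)" if "n \<le> m" for d n m
    using monoD[OF mono that] unfolding leading_def by blast
  have mono_d: "leading B r d (I n) \<subseteq> leading B r (Suc d) (I n)" for d n
  proof
    fix x assume "x \<in> leading B r d (I n)"
    then obtain c where c: "x \<in> B" "\<forall>i. c i \<in> B" "x * r ^ d + (\<Sum>i<d. c i * r ^ i) \<in> I n"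
      by (auto simp: leading_def)
    let ?x = "x * r ^ d + (\<Sum>i<d. c i * r ^ i)"
    define e where "e i = (case i of 0 \<Rightarrow> 0 | Suc j \<Rightarrow> c j)" for i
    have "r * ?x \<in> I n" using In(4)[OF adjoin_element[OF sB B(2)] c(3)] .
    moreover have "?x * r - r * ?x \<in> I n" using In(2) commutator_J by blast
    ultimately have "?x * r \<in> I n" using subspace_add[OF In(1)[of n], of "?x * r - r * ?x" "r * ?x"] by simp
    moreover have "?x * r = x * r ^ Suc d + (\<Sum>i<Suc d. e i * r ^ i)"
      unfolding sum.lessThan_Suc_shift
      by (simp add: e_def distrib_right sum_distrib_right mult.assoc power_commutes)
    ultimately show "x \<in> leading B r (Suc d) (I n)"
      unfolding leading_def using c B
      by (intro CollectI conjI exI[of _ e]) (auto simp: subalgD e_def split: nat.split)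
  qed
  have mono_d: "leading B r d (I n) \<subseteq> leading B r d' (I n)" if "d \<le> d'" for d d' n
    by (rule lift_Suc_mono_le[of "\<lambda>d. leading B r d (I n)", OF mono_d that])
  note acc = noeth[unfolded noetherian_over_def, rule_format]
  have "mono (\<lambda>m. leading B r m (I m))"
  proof (rule monoI)
    fix m n :: nat assume "m \<le> n"
    then show "leading B r m (I m) \<subseteq> leading B r n (I n)" using mono_d mono_I by blast
  qed
  from acc[OF lead this] obtain M where M: "\<forall>m\<ge>M. leading B r m (I m) = leading B r M (I M)"
    by (rule exE)
  have "\<forall>d. \<exists>N. \<forall>n\<ge>N. leading B r d (I n) = leading B r d (I N)"
  proof
    fix d
    have "mono (\<lambda>n. leading B r d (I n))" using mono_I by (intro monoI)
    from acc[OF lead this] show "\<exists>N. \<forall>n\<ge>N. leading B r d (I n) = leading B r d (I N)" .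
  qed
  then obtain K where K: "\<And>d n. K d \<le> n \<Longrightarrow> leading B r d (I n) = leading B r d (I (K d))" by metis
  define N where "N = Max (insert M (K ` {..<M}))"
  have NM: "M \<le> N" "\<And>d. d < M \<Longrightarrow> K d \<le> N" by (auto simp: N_def)
  have stable: "leading B r d (I n) = leading B r d (I N)" if n: "N \<le> n" for d n
  proof (cases "d < M")
    case True
    then show ?thesis using K[of d n] K[of d N] NM n by (metis le_trans)
  next
    case False
    define m where "m = max d n"
    have m: "M \<le> m" "d \<le> m" "n \<le> m" using False by (auto simp: m_def)
    have "leading B r d (I n) \<subseteq> leading B r m (I m)" using mono_d[OF m(2)] mono_I[OF m(3)] by blast
    also have "leading B r m (I m) = leading B r M (I M)" using M m(1) by blast
    also have "leading B r M (I M) \<subseteq> leading B r d (I N)"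
      using mono_d[of M d M] mono_I[OF NM(1), of d] False by force
    finally show ?thesis using mono_I[OF n] by blast
  qed
  have "I n = I N" if n: "N \<le> n" for n
  proof
    show "I N \<subseteq> I n" using monoD[OF mono n] .
    have "(\<Sum>i<k. c i * r ^ i) \<in> I N" if "(\<Sum>i<k. c i * r ^ i) \<in> I n" "\<forall>i. c i \<in> B" for k c
      using that
    proof (induction k arbitrary: c)
      case (Suc k)
      have "c k \<in> leading B r k (I n)"
        unfolding leading_def using Suc.prems by (intro CollectI conjI exI[of _ c]) (auto simp: add.commute)
      then have "c k \<in> leading B r k (I N)" using stable[OF n] by blast
      then obtain e where e: "\<forall>i. e i \<in> B" "c k * r ^ k + (\<Sum>i<k. e i * r ^ i) \<in> I N"
        by (auto simp: leading_def)
      then have en: "c k * r ^ k + (\<Sum>i<k. e i * r ^ i) \<in> I n" using \<open>I N \<subseteq> I n\<close> by blast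
      have "(\<Sum>i<k. (c i - e i) * r ^ i) \<in> I n"
        using subspace_diff[OF In(1) Suc.prems(1) en] by (simp add: left_diff_distrib sum_subtractf)
      then have "(\<Sum>i<k. (c i - e i) * r ^ i) \<in> I N"
        using Suc.prems(2) e(1) B by (intro Suc.IH) (auto simp: subalgD)
      from subspace_add[OF In(1) this e(2)] show ?case
        by (simp add: left_diff_distrib sum_subtractf add.commute)
    qed (simp add: subspace_0[OF In(1)])
    then show "I n \<subseteq> I N" using In(3)[of n] unfolding adjoin_def by blast
  qed
  then show "\<exists>N. \<forall>n\<ge>N. I n = I N" by blast
qed

lemma ideal_family_maximal:
  assumes S: "finite S" "subalgebra hull S = UNIV"
    and F: "F \<noteq> {}" "\<And>I. I \<in> F \<Longrightarrow> ideal_over UNIV I"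
  shows "\<exists>M\<in>F. \<forall>I\<in>F. M \<subseteq> I \<longrightarrow> I = M"
proof (rule ccontr)
  have noeth: "noetherian_over UNIV"
    by (rule adjoin_induct_generators[OF S noetherian_over_base noetherian_over_adjoin])
  assume "\<not> ?thesis"
  then have step: "\<exists>I'. I' \<in> F \<and> I \<subset> I'" if "I \<in> F" for I using that by blast
  have "\<exists>I. \<forall>n::nat. I n \<in> F \<and> I n \<subset> I (Suc n)"
    by (rule dependent_nat_choice) (use F(1) step in blast)+
  then obtain I where I: "\<And>n::nat. I n \<in> F" "\<And>n. I n \<subset> I (Suc n)" by blast
  have "mono I"
  proof (rule monoI)
    fix m n :: nat assume "m \<le> n"
    have "I n \<subseteq> I (Suc n)" for n using I(2)[of n] by blast
    from lift_Suc_mono_le[of I, OF this \<open>m \<le> n\<close>] show "I m \<subseteq> I n" .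
  qed
  from noeth[unfolded noetherian_over_def, rule_format, OF F(2)[OF I(1)] this]
  obtain N where "\<forall>n\<ge>N. I n = I N" by (rule exE)
  then have "I (Suc N) = I N" by (meson le_SucI order_refl)
  then show False using I(2)[of N] by simp
qed

end

section \<open>An element of the core with prime annihilator\<close>

context assoc_algebra
begin

lemma fd_mod_zero: "B \<subseteq> {0} \<Longrightarrow> fd_mod J B"
  by (rule fd_mod_mono[OF fd_mod_finite]) auto

definition large :: "'a \<Rightarrow> bool"
  where "large s \<longleftrightarrow> s \<in> core \<and> \<not> fd_mod {} (range (\<lambda>a. a * s))"

text \<open>Every product of a generator with an element of the finite set \<open>W\<close> is a
  combination of \<open>S0\<close> up to an element of \<open>core\<close>. If the ideals generated
  by these finitely many core elements were finite-dimensional, then \<open>U\<close> would be a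
  finite-dimensional left ideal containing 1.\<close>

lemma exists_large:
  assumes S: "finite S" "subalgebra hull S = UNIV"
    and inf: "\<not> fd_mod {} (UNIV :: 'a set)" and core: "fd_mod core UNIV"
  shows "\<exists>s. large s"
proof (rule ccontr)
  assume neg: "\<not> ?thesis"
  obtain S0 where S0: "finite S0" "UNIV \<subseteq> span (S0 \<union> core)" using core by (auto simp: fd_mod_def)
  define W where "W = insert 1 S0"
  have "\<exists>j. j \<in> core \<and> x - j \<in> span S0" for x
  proof -
    have "x \<in> span (S0 \<union> core)" using S0 by blast
    then obtain p j where "x = p + j" "p \<in> span S0" "j \<in> span core" unfolding span_Un by auto
    moreover have "span core = core" using core_subspace by (simp add: span_eq_iff)
    ultimately show ?thesis by (intro exI[of _ j]) simp
  qed
  then obtain j where j: "\<And>x. j x \<in> core" "\<And>x. x - j x \<in> span S0" by metis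
  define X where "X = (\<lambda>(g, w). j (g * w)) ` (S \<times> W)"
  define U where "U = span (W \<union> (\<Union>x\<in>X. range (\<lambda>a. a * x)))"
  have Usub: "subspace U" by (simp add: U_def)
  have fin: "finite X" "finite W" using S(1) S0(1) by (auto simp: X_def W_def)
  have small: "fd_mod {} (range (\<lambda>a. a * x))" if "x \<in> X" for x
    using neg that j(1) by (auto simp: large_def X_def)
  have fdU: "fd_mod {} U" unfolding U_def
    by (rule fd_mod_span[OF fd_mod_Un[OF fd_mod_finite[OF fin(2)] fd_mod_UN[OF fin(1) small]]])
  define B where "B = {a. \<forall>u\<in>U. a * u \<in> U}"
  have "B = UNIV"
  proof (rule subalgebra_hull_induct[OF S(2)])
    show "subspace B"
      unfolding B_def using Usub
      by (intro subspaceI) (auto simp: distrib_right scale_mult_left subspace_0 subspace_add subspace_scale)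
    show "1 \<in> B" by (simp add: B_def)
    show "a * b \<in> B" if "a \<in> B" "b \<in> B" for a b using that by (simp add: B_def mult.assoc)
    show "S \<subseteq> B"
    proof
      fix g assume g: "g \<in> S"
      have sub: "subspace {u. g * u \<in> U}"
        using Usub by (intro subspaceI)
          (auto simp: distrib_left scale_mult_right subspace_0 subspace_add subspace_scale)
      have 1: "g * w \<in> U" if "w \<in> W" for w
      proof -
        have "j (g * w) \<in> X" using g that by (auto simp: X_def)
        then have "1 * j (g * w) \<in> (\<Union>x\<in>X. range (\<lambda>a. a * x))" by blast
        then have "j (g * w) \<in> U" by (auto simp: U_def intro: span_base)
        moreover have "span S0 \<subseteq> U" unfolding U_def W_def by (intro span_mono) auto
        then have "g * w - j (g * w) \<in> U" using j(2) by blast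
        ultimately show ?thesis using subspace_add[OF Usub, of "g * w - j (g * w)" "j (g * w)"] by simp
      qed
      have 2: "g * (a * x) \<in> U" if "x \<in> X" for a x
      proof -
        have "g * a * x \<in> (\<Union>x\<in>X. range (\<lambda>a. a * x))" using that by blast
        then show ?thesis by (auto simp: U_def mult.assoc intro: span_base)
      qed
      have "span (W \<union> (\<Union>x\<in>X. range (\<lambda>a. a * x))) \<subseteq> {u. g * u \<in> U}"
        using 1 2 by (intro span_minimal sub) auto
      then have "U \<subseteq> {u. g * u \<in> U}" by (simp only: U_def[symmetric])
      then show "g \<in> B" by (auto simp: B_def)
    qed
  qed
  have "1 \<in> U" by (auto simp: U_def W_def intro: span_base)
  have "UNIV \<subseteq> U"
  proof
    fix a :: 'a
    have "a \<in> B" using \<open>B = UNIV\<close> by simp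
    then have "a * 1 \<in> U" using \<open>1 \<in> U\<close> by (simp only: B_def mem_Collect_eq)
    then show "a \<in> U" by simp
  qed
  then show False using inf fd_mod_mono[OF fdU] by blast
qed

text \<open>\<open>core\<close> kills all commutators, so A is commutative modulo this ideal, and
  the basis theorem applies to the ideals above it.\<close>

definition core_annihilator :: "'a set"
  where "core_annihilator = {a. \<forall>s\<in>core. a * s = 0}"

lemma commutative_mod_core_annihilator: "commutative_mod scale core_annihilator"
proof
  show "subspace core_annihilator"
    by (rule subspaceI) (auto simp: core_annihilator_def distrib_right scale_mult_left)
  show "a * x \<in> core_annihilator" if "x \<in> core_annihilator" for a x
    using that by (simp add: core_annihilator_def mult.assoc)
  show "x * a \<in> core_annihilator" if "x \<in> core_annihilator" for a x
    using that by (simp add: core_annihilator_def mult.assoc core_mult)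
  show "a * b - b * a \<in> core_annihilator" for a b
    by (auto simp: core_annihilator_def left_diff_distrib intro: coreD(2))
qed

text \<open>An annihilator up to finite dimension. Since commutators kill a core element s,
  membership of a means that multiplication by a has finite-dimensional image on A s.\<close>

definition torsion :: "'a \<Rightarrow> 'a set"
  where "torsion s = {a. fd_mod {} (range (\<lambda>b. b * a * s))}"

text \<open>Take s with \<open>torsion s\<close> maximal. Its product \<open>V\<close> with s is
  finite-dimensional, and some r outside the torsion kills \<open>V\<close>. For t = r s the torsion
  ideal is unchanged and has become the exact annihilator; if b t is nonzero, it is
  \<open>large\<close>, and maximality at b t gives primeness.\<close>

lemma prime_annihilator:
  assumes S: "finite S" "subalgebra hull S = UNIV"
    and inf: "\<not> fd_mod {} (UNIV :: 'a set)" and core: "fd_mod core UNIV"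
  shows "\<exists>s. large s \<and> (\<forall>a b. a * b * s = 0 \<longrightarrow> a * s = 0 \<or> b * s = 0)"
proof -
  interpret T: commutative_mod scale core_annihilator by (rule commutative_mod_core_annihilator)
  have ideal: "T.ideal_over UNIV (torsion s)" if s: "s \<in> core" for s
    unfolding T.ideal_over_def
  proof (intro conjI ballI)
    show "subspace (torsion s)"
    proof (rule subspaceI)
      have "(\<lambda>b. b * 0 * s) ` UNIV \<subseteq> {0}" by auto
      then show "0 \<in> torsion s" by (simp add: torsion_def fd_mod_zero)
      fix x y c assume x: "x \<in> torsion s"
      have "range (\<lambda>b. b * scale c x * s) \<subseteq> span (range (\<lambda>b. b * x * s))"
        by (auto simp: scale_mult_left scale_mult_right intro: span_scale span_base)
      moreover have "fd_mod {} (span (range (\<lambda>b. b * x * s)))"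
        using x by (intro fd_mod_span) (simp add: torsion_def)
      ultimately show "scale c x \<in> torsion s" unfolding torsion_def using fd_mod_mono by blast
      assume y: "y \<in> torsion s"
      have "range (\<lambda>b. b * (x + y) * s) \<subseteq> span (range (\<lambda>b. b * x * s) \<union> range (\<lambda>b. b * y * s))"
      proof clarify
        fix b
        have "b * x * s + b * y * s \<in> span (range (\<lambda>b. b * x * s) \<union> range (\<lambda>b. b * y * s))"
          by (intro span_add span_base) auto
        then show "b * (x + y) * s \<in> span (range (\<lambda>b. b * x * s) \<union> range (\<lambda>b. b * y * s))"
          by (simp add: distrib_left distrib_right)
      qed
      moreover have "fd_mod {} (span (range (\<lambda>b. b * x * s) \<union> range (\<lambda>b. b * y * s)))"
        using x y by (intro fd_mod_span fd_mod_Un) (simp_all add: torsion_def)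
      ultimately show "x + y \<in> torsion s" unfolding torsion_def using fd_mod_mono by blast
    qed
    show "core_annihilator \<subseteq> torsion s"
    proof
      fix a assume "a \<in> core_annihilator"
      then have "a * s = 0" using s by (simp add: core_annihilator_def)
      then have "range (\<lambda>b. b * a * s) \<subseteq> {0}" by (auto simp: mult.assoc)
      then show "a \<in> torsion s" by (simp add: torsion_def fd_mod_zero)
    qed
    show "b * x \<in> torsion s" if "x \<in> torsion s" for b x
    proof -
      have "c * (b * x) * s = (c * b) * x * s" for c by (simp add: mult.assoc)
      then have "range (\<lambda>c. c * (b * x) * s) \<subseteq> range (\<lambda>c. c * x * s)" by blast
      moreover have "fd_mod {} (range (\<lambda>c. c * x * s))" using that by (simp add: torsion_def)
      ultimately show ?thesis unfolding torsion_def using fd_mod_mono by blast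
    qed
  qed auto
  have mono: "torsion s \<subseteq> torsion (r * s)" if s: "s \<in> core" for s r
  proof
    fix a assume "a \<in> torsion s"
    then have "fd_mod {} ((\<lambda>x. r * x) ` range (\<lambda>b. b * a * s))"
      unfolding torsion_def by (intro T.endo.fd_mod_image[OF linear_mult_left]) auto
    moreover have "(\<lambda>x. r * x) ` range (\<lambda>b. b * a * s) = range (\<lambda>b. b * a * (r * s))"
    proof -
      have "r * (b * a * s) = b * a * (r * s)" for b
        using coreD(2)[OF s, of r "b * a"] by (simp add: mult.assoc)
      then show ?thesis by (simp add: image_image)
    qed
    ultimately show "a \<in> torsion (r * s)" by (simp add: torsion_def)
  qed
  have "\<exists>M\<in>{torsion s | s. large s}. \<forall>I\<in>{torsion s | s. large s}. M \<subseteq> I \<longrightarrow> I = M"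
    using exists_large[OF assms] ideal
    by (intro T.ideal_family_maximal[OF S]) (auto simp: large_def)
  then obtain s where s: "large s" and max0: "\<forall>I\<in>{torsion s | s. large s}. torsion s \<subseteq> I \<longrightarrow> I = torsion s"
    by blast
  have max: "torsion t = torsion s" if "large t" "torsion s \<subseteq> torsion t" for t
    using that max0 by blast
  have s_core: "s \<in> core" using s by (simp add: large_def)
  \<comment> \<open>Finite-dimensional by noetherianity: an ideal \<open>I\<close> maximal among
    those inside \<open>torsion s\<close> with I s finite-dimensional absorbs every torsion element
    \<open>q\<close>.\<close>
  define V where "V = (\<lambda>a. a * s) ` torsion s"
  have "fd_mod {} V"
  proof -
    let ?F = "{I. T.ideal_over UNIV I \<and> I \<subseteq> torsion s \<and> fd_mod {} ((\<lambda>a. a * s) ` I)}"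
    have "core_annihilator \<in> ?F"
    proof -
      have "(\<lambda>a. a * s) ` core_annihilator \<subseteq> {0}" using s_core by (auto simp: core_annihilator_def)
      then have "fd_mod {} ((\<lambda>a. a * s) ` core_annihilator)" by (rule fd_mod_zero)
      then show ?thesis
        using ideal[OF s_core] T.J_subspace T.J_left by (auto simp: T.ideal_over_def)
    qed
    then have "\<exists>M\<in>?F. \<forall>I\<in>?F. M \<subseteq> I \<longrightarrow> I = M"
      by (intro T.ideal_family_maximal[OF S]) auto
    then obtain I where "I \<in> ?F" and Imax: "\<forall>K\<in>?F. I \<subseteq> K \<longrightarrow> K = I" by (rule bexE)
    then have I: "T.ideal_over UNIV I" "I \<subseteq> torsion s" "fd_mod {} ((\<lambda>a. a * s) ` I)" by simp_all
    have Isub: "subspace I" "core_annihilator \<subseteq> I" "\<And>b x. x \<in> I \<Longrightarrow> b * x \<in> I"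
      using I(1) by (auto simp: T.ideal_over_def)
    have Tsub: "subspace (torsion s)" "\<And>b x. x \<in> torsion s \<Longrightarrow> b * x \<in> torsion s"
      using ideal[OF s_core] by (auto simp: T.ideal_over_def)
    have "torsion s \<subseteq> I"
    proof
      fix q assume q: "q \<in> torsion s"
      define K where "K = {x + b * q | x b. x \<in> I}"
      have KI: "x + b * q \<in> K" if "x \<in> I" for x b using that unfolding K_def by blast
      have IK: "I \<subseteq> K" using KI[of _ 0] by auto
      have "subspace K"
      proof (rule subspaceI)
        show "0 \<in> K" using IK subspace_0[OF Isub(1)] by blast
        fix x y c assume "x \<in> K"
        then obtain x' b where x: "x = x' + b * q" "x' \<in> I" by (auto simp: K_def)
        show "scale c x \<in> K"
          using KI[OF subspace_scale[OF Isub(1) x(2)], of c "scale c b"]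
          by (simp add: x(1) scale_right_distrib scale_mult_left)
        assume "y \<in> K"
        then obtain y' b' where y: "y = y' + b' * q" "y' \<in> I" by (auto simp: K_def)
        show "x + y \<in> K"
          using KI[OF subspace_add[OF Isub(1) x(2) y(2)], of "b + b'"]
          by (simp add: x(1) y(1) distrib_right algebra_simps)
      qed
      moreover have "b * x \<in> K" if x: "x \<in> K" for b x
      proof -
        obtain x' c where x: "x = x' + c * q" "x' \<in> I" using x by (auto simp: K_def)
        show ?thesis using KI[OF Isub(3)[OF x(2), of b], of "b * c"] by (simp add: x(1) distrib_left mult.assoc)
      qed
      ultimately have "T.ideal_over UNIV K" using IK Isub(2) by (auto simp: T.ideal_over_def)
      moreover have "K \<subseteq> torsion s"
        using I(2) q Tsub subspace_add[OF Tsub(1)] by (auto simp: K_def)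
      moreover have "fd_mod {} ((\<lambda>a. a * s) ` K)"
      proof -
        have "fd_mod {} (span ((\<lambda>a. a * s) ` I \<union> range (\<lambda>b. b * q * s)))"
          using q by (intro fd_mod_span fd_mod_Un I(3)) (simp add: torsion_def)
        moreover have "(\<lambda>a. a * s) ` K \<subseteq> span ((\<lambda>a. a * s) ` I \<union> range (\<lambda>b. b * q * s))"
        proof (intro image_subsetI)
          fix x assume "x \<in> K"
          then obtain x' b where x: "x = x' + b * q" "x' \<in> I" by (auto simp: K_def)
          have "x' * s + b * q * s \<in> span ((\<lambda>a. a * s) ` I \<union> range (\<lambda>b. b * q * s))"
            using x(2) by (intro span_add[OF span_base span_base]) auto
          then show "x * s \<in> span ((\<lambda>a. a * s) ` I \<union> range (\<lambda>b. b * q * s))"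
            by (simp add: x(1) distrib_right)
        qed
        ultimately show ?thesis by (rule fd_mod_mono)
      qed
      ultimately have "K = I" using Imax IK by simp
      moreover have "0 + 1 * q \<in> K" by (rule KI[OF subspace_0[OF Isub(1)]])
      ultimately show "q \<in> I" by simp
    qed
    then show ?thesis using I(3) unfolding V_def by (meson fd_mod_mono image_mono)
  qed
  then obtain F where F: "finite F" "F \<subseteq> V" "V \<subseteq> span F" using fd_mod_finite_subset[of "{}" V] by auto
  \<comment> \<open>Annihilating a finite-dimensional left submodule is a condition of finite
    codimension. So this annihilator cannot lie in \<open>torsion s\<close>, or A s would be
    finite-dimensional.\<close>
  define N where "N F = {a. \<forall>v\<in>F. a * v = 0}" for F :: "'a set"
  have Nsub: "subspace (N F)" for F
    by (rule subspaceI) (auto simp: N_def distrib_right scale_mult_left)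
  have VA: "a * v \<in> V" if "v \<in> V" for a v
    using that ideal[OF s_core] by (auto simp: V_def T.ideal_over_def mult.assoc[symmetric])
  have "fd_mod (N F') UNIV" if "F' \<subseteq> F" for F'
    using finite_subset[OF that F(1)] that
  proof (induction F' rule: finite_induct)
    case empty
    then show ?case using fd_mod_self by (simp add: N_def)
  next
    case (insert v F')
    then have "v \<in> V" using F by blast
    have "fd_mod {} ((\<lambda>a. a * v) ` N F')"
      using VA[OF \<open>v \<in> V\<close>] by (intro fd_mod_mono[OF \<open>fd_mod {} V\<close>]) auto
    moreover have "{u \<in> N F'. u * v \<in> span {}} = N (insert v F')" by (auto simp: N_def)
    then have "fd_mod (N (insert v F')) {u \<in> N F'. u * v \<in> span {}}" by (simp only: fd_mod_self)
    ultimately have "fd_mod (N (insert v F')) (N F')"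
      by (rule T.endo.fd_mod_kernel[OF linear_mult_right Nsub])
    then show ?case using fd_mod_trans insert by blast
  qed
  then have codim: "fd_mod (N F) UNIV" by blast
  have NV: "a * v = 0" if "a \<in> N F" "v \<in> V" for a v
  proof -
    have "span F \<subseteq> {v. a * v = 0}"
      using \<open>a \<in> N F\<close> by (intro span_minimal subspaceI) (auto simp: N_def distrib_left scale_mult_right)
    then show ?thesis using F(3) \<open>v \<in> V\<close> by blast
  qed
  have "\<exists>r\<in>N F. r \<notin> torsion s"
  proof (rule ccontr)
    assume "\<not> ?thesis"
    then have "(\<lambda>a. a * s) ` N F \<subseteq> span V" by (auto simp: V_def intro: span_base)
    then have "fd_mod V (range (\<lambda>a. a * s))" by (rule T.endo.fd_mod_image[OF linear_mult_right codim])
    then show False using fd_mod_trans[OF _ \<open>fd_mod {} V\<close>] s by (auto simp: large_def)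
  qed
  then obtain r where r: "r \<in> N F" "r \<notin> torsion s" by blast
  define t where "t = r * s"
  have t: "large t" using r(2) core_mult[OF s_core] by (simp add: t_def large_def torsion_def mult.assoc)
  have t_core: "t \<in> core" using t by (simp add: large_def)
  have tor: "torsion t = torsion s" using max[OF t] mono[OF s_core] by (simp add: t_def)
  have ann: "a * t = 0 \<longleftrightarrow> a \<in> torsion t" for a
  proof
    assume "a * t = 0"
    then have "range (\<lambda>b. b * a * t) \<subseteq> {0}" by (auto simp: mult.assoc)
    then show "a \<in> torsion t" by (simp add: torsion_def fd_mod_zero)
  next
    assume "a \<in> torsion t"
    then have "a * s \<in> V" by (simp add: tor V_def)
    then have "r * (a * s) = 0" using NV r(1) by blast
    then show "a * t = 0" using coreD(2)[OF s_core, of r a] by (simp add: t_def mult.assoc)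
  qed
  have "a * t = 0 \<or> b * t = 0" if ab: "a * b * t = 0" for a b
  proof (rule disjCI)
    assume "b * t \<noteq> 0"
    then have "large (b * t)"
      using ann[of b] core_mult[OF t_core] by (simp add: large_def torsion_def mult.assoc)
    moreover have "torsion s \<subseteq> torsion (b * t)" using mono[OF t_core] by (simp add: tor)
    ultimately have "torsion (b * t) = torsion t" using max tor by simp
    moreover have "range (\<lambda>c. c * a * (b * t)) \<subseteq> {0}"
      using ab by (auto simp: mult.assoc)
    then have "a \<in> torsion (b * t)" by (simp add: torsion_def fd_mod_zero)
    ultimately show "a * t = 0" using ann by simp
  qed
  then show ?thesis using t by blast
qed

end

section \<open>Extending derivations\<close>

locale prime_element = char_0_algebra scale
  for scale :: "'k::field_char_0 \<Rightarrow> 'a::ring_1 \<Rightarrow> 'a" +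
  fixes s :: 'a
  assumes s_large: "large s" and s_prime: "a * b * s = 0 \<Longrightarrow> a * s = 0 \<or> b * s = 0"
begin

lemma s_core: "s \<in> core"
  using s_large by (simp add: large_def)

definition P :: "'a set"
  where "P = {a. a * s = 0}"

sublocale commutative_mod scale P
proof
  show "subspace P" by (rule subspaceI) (auto simp: P_def distrib_right scale_mult_left)
  show "a * x \<in> P" if "x \<in> P" for a x using that by (simp add: P_def mult.assoc)
  show "x * a \<in> P" if "x \<in> P" for a x
    using that coreD(2)[OF s_core, of x a] by (simp add: P_def mult.assoc)
  show "a * b - b * a \<in> P" for a b
    using coreD(2)[OF s_core] by (simp add: P_def left_diff_distrib)
qed

lemma prime: "a * b \<in> P \<Longrightarrow> a \<in> P \<or> b \<in> P"
  using s_prime by (simp add: P_def)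

lemma one_notin_P: "1 \<notin> P"
proof
  assume "1 \<in> P"
  then have "s = 0" by (simp add: P_def)
  then show False using s_large by (simp add: large_def fd_mod_zero)
qed

text \<open>A torsion-free module over the domain A / P, contained in \<open>core\<close>; the
  derivations to be built take their values in it.\<close>

definition M :: "'a set"
  where "M = range (\<lambda>a. a * s)"

lemma M_core: "v \<in> M \<Longrightarrow> v \<in> core"
  using core_mult[OF s_core] by (auto simp: M_def)

lemma M_mult: "v \<in> M \<Longrightarrow> a * v \<in> M"
  by (auto simp: M_def mult.assoc[symmetric])

lemma M_subspace: "subspace M"
proof -
  interpret L: Vector_Spaces.linear scale scale "\<lambda>a. a * s" by (rule linear_mult_right)
  show ?thesis unfolding M_def by (rule L.subspace_image) simp
qed

lemma M_left_commute: "v \<in> M \<Longrightarrow> a * (b * v) = b * (a * v)"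
  using coreD(2)[OF M_core, of v a b] by (simp add: mult.assoc)

lemma P_M: "p \<in> P \<Longrightarrow> v \<in> M \<Longrightarrow> p * v = 0"
proof -
  assume p: "p \<in> P" and "v \<in> M"
  then obtain a where "v = a * s" by (auto simp: M_def)
  then have "p * v = a * (p * s)" using coreD(2)[OF s_core, of p a] by (simp add: mult.assoc)
  then show ?thesis using p by (simp add: P_def)
qed

lemma M_cancel:
  assumes "v \<in> M" "a * v = 0" "a \<notin> P" shows "v = 0"
proof -
  obtain b where b: "v = b * s" using assms(1) by (auto simp: M_def)
  then have "a * b * s = 0" using assms(2) by (simp add: mult.assoc)
  then show ?thesis using s_prime assms(3) by (auto simp: b P_def)
qed

text \<open>A derivation of B / P into the module \<open>M\<close>. Both terms of the Leibniz rule
  have the value of d on the right, since values in \<open>core\<close> commute with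
  everything.\<close>

definition partial_derivation :: "'a set \<Rightarrow> ('a \<Rightarrow> 'a) \<Rightarrow> bool"
  where "partial_derivation B d \<longleftrightarrow> (\<forall>x\<in>B. d x \<in> M) \<and> (\<forall>p\<in>P. d p = 0) \<and>
    (\<forall>x\<in>B. \<forall>y\<in>B. d (x + y) = d x + d y \<and> d (x * y) = x * d y + y * d x) \<and>
    (\<forall>x\<in>B. \<forall>c. d (scale c x) = scale c (d x))"

definition poly_eval :: "'a \<Rightarrow> nat \<Rightarrow> (nat \<Rightarrow> 'a) \<Rightarrow> 'a"
  where "poly_eval r n c = (\<Sum>i<n. c i * r ^ i)"

text \<open>The formal derivative, evaluated at r. The truncated exponent at i = 0 is harmless
  because the factor in front is 0.\<close>

definition poly_deriv :: "'a \<Rightarrow> nat \<Rightarrow> (nat \<Rightarrow> 'a) \<Rightarrow> 'a"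
  where "poly_deriv r n c = (\<Sum>i<n. of_nat i * c i * r ^ (i - 1))"

definition transcendental :: "'a set \<Rightarrow> 'a \<Rightarrow> bool"
  where "transcendental B r \<longleftrightarrow>
    (\<forall>n c. (\<forall>i. c i \<in> B) \<longrightarrow> poly_eval r n c \<in> P \<longrightarrow> (\<forall>i<n. c i \<in> P))"

text \<open>Multiplication by the variable, on coefficient sequences.\<close>

definition shift :: "(nat \<Rightarrow> 'a) \<Rightarrow> nat \<Rightarrow> 'a"
  where "shift c i = (case i of 0 \<Rightarrow> 0 | Suc j \<Rightarrow> c j)"

lemma shift_simps [simp]: "shift c 0 = 0" "shift c (Suc i) = c i"
  by (simp_all add: shift_def)

lemma shift_iterate: "(shift ^^ q) c (q + i) = c i"
  by (induction q) auto

lemma poly_eval_shift: "poly_eval r (Suc n) (shift c) = poly_eval r n c * r"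
  unfolding poly_eval_def sum.lessThan_Suc_shift
  by (simp add: sum_distrib_right mult.assoc power_commutes)

lemma poly_deriv_shift: "poly_deriv r (Suc n) (shift c) = poly_eval r n c + poly_deriv r n c * r"
proof -
  have "(1 + of_nat i) * c i * r ^ i = c i * r ^ i + of_nat i * c i * r ^ (i - 1) * r" for i
    by (cases i) (simp_all add: distrib_right distrib_left mult.assoc power_commutes)
  then show ?thesis
    unfolding poly_deriv_def poly_eval_def sum.lessThan_Suc_shift
    by (simp add: sum_distrib_right sum.distrib)
qed

end

locale derivation_extension = prime_element scale s
  for scale :: "'k::field_char_0 \<Rightarrow> 'a::ring_1 \<Rightarrow> 'a" and s +
  fixes B :: "'a set" and d :: "'a \<Rightarrow> 'a" and r \<mu> \<nu> :: 'a
  assumes B: "subalg B" "1 \<in> B" and d: "partial_derivation B d" and nu: "\<nu> \<in> M"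
begin

text \<open>The derivation of the polynomial ring over \<open>B\<close> that is \<open>\<mu> d\<close> on \<open>B\<close> and sends the variable to
  \<open>\<nu>\<close>, evaluated at \<open>r\<close>.\<close>

definition D :: "nat \<Rightarrow> (nat \<Rightarrow> 'a) \<Rightarrow> 'a"
  where "D n c = \<mu> * (\<Sum>i<n. r ^ i * d (c i)) + poly_deriv r n c * \<nu>"

lemma dD: "x \<in> B \<Longrightarrow> d x \<in> M" "p \<in> P \<Longrightarrow> d p = 0"
    "x \<in> B \<Longrightarrow> y \<in> B \<Longrightarrow> d (x + y) = d x + d y"
    "x \<in> B \<Longrightarrow> y \<in> B \<Longrightarrow> d (x * y) = x * d y + y * d x"
    "x \<in> B \<Longrightarrow> d (scale c x) = scale c (d x)"
  using d by (auto simp: partial_derivation_def)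

lemma d_zero: "d 0 = 0"
  by (rule dD(2)) (rule subspace_0[OF J_subspace])

lemma d_diff: "x \<in> B \<Longrightarrow> y \<in> B \<Longrightarrow> d (x - y) = d x - d y"
  using dD(3)[of "x - y" y] B by (simp add: subalgD)

lemma D_in_M: "(\<And>i. c i \<in> B) \<Longrightarrow> D n c \<in> M"
  unfolding D_def by (intro subspace_add[OF M_subspace] M_mult subspace_sum[OF M_subspace] dD nu)

lemma D_add:
  assumes "\<And>i. c i \<in> B" "\<And>i. e i \<in> B"
  shows "D n (\<lambda>i. c i + e i) = D n c + D n e"
  by (simp add: D_def poly_deriv_def dD assms distrib_left distrib_right sum.distrib algebra_simps)

lemma D_diff:
  assumes "\<And>i. c i \<in> B" "\<And>i. e i \<in> B"
  shows "D n (\<lambda>i. c i - e i) = D n c - D n e"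
  by (simp add: D_def poly_deriv_def d_diff assms left_diff_distrib right_diff_distrib sum_subtractf
      algebra_simps)

lemma D_scale:
  assumes "\<And>i. c i \<in> B" shows "D n (\<lambda>i. scale k (c i)) = scale k (D n c)"
  by (simp add: D_def poly_deriv_def dD assms scale_mult_left scale_mult_right scale_right_distrib
      scale_sum_right[symmetric])

lemma D_Suc: "D (Suc n) c = D n c + (\<mu> * (r ^ n * d (c n)) + of_nat n * c n * r ^ (n - 1) * \<nu>)"
  by (simp add: D_def poly_deriv_def distrib_left distrib_right algebra_simps)

lemma D_pad:
  assumes "n \<le> m" shows "D n c = D m (\<lambda>i. if i < n then c i else 0)"
proof -
  have "D k (\<lambda>i. if i < n then c i else 0) = D (min n k) c" for k
  proof (induction k)
    case (Suc k)
    show ?case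
    proof (cases "k < n")
      case True
      then have "min n (Suc k) = Suc (min n k)" "min n k = k" by auto
      then show ?thesis using Suc True by (simp add: D_Suc)
    next
      case False
      then have "min n (Suc k) = min n k" by simp
      then show ?thesis using Suc False by (simp add: D_Suc d_zero)
    qed
  qed (simp add: D_def poly_deriv_def)
  then show ?thesis using assms by (simp add: min_absorb1)
qed

lemma D_in_P: "(\<And>i. i < n \<Longrightarrow> c i \<in> P) \<Longrightarrow> D n c = 0"
proof (induction n)
  case (Suc n)
  have "of_nat n * c n * r ^ (n - 1) \<in> P" using Suc.prems by (intro J_left J_right) simp
  then show ?case using Suc P_M nu by (simp add: D_Suc dD(2))
qed (simp add: D_def poly_deriv_def)

lemma D_mult:
  assumes b: "b \<in> B" and c: "\<And>i. c i \<in> B"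
  shows "D n (\<lambda>i. b * c i) = b * D n c + \<mu> * (poly_eval r n c * d b)"
proof (induction n)
  case (Suc n)
  have "\<mu> * (r ^ n * d (b * c n)) = b * (\<mu> * (r ^ n * d (c n))) + \<mu> * (c n * (r ^ n * d b))"
    using M_left_commute[OF dD(1)[OF b], of "r ^ n" "c n"] M_left_commute[OF dD(1)[OF c[of n]], of "r ^ n" b]
      M_left_commute[OF M_mult[OF dD(1)[OF c[of n]]], of "\<mu>" b "r ^ n"]
    by (simp add: dD b c distrib_left)
  moreover have "of_nat n * (b * c n) * r ^ (n - 1) * \<nu> = b * (of_nat n * c n * r ^ (n - 1) * \<nu>)"
    using M_left_commute[of "c n * (r ^ (n - 1) * \<nu>)" "of_nat n" b] nu M_mult by (simp add: mult.assoc)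
  ultimately show ?case
    using Suc by (simp add: D_Suc poly_eval_def distrib_left distrib_right mult.assoc)
qed (simp add: D_def poly_deriv_def poly_eval_def)

lemma D_shift:
  assumes c: "\<And>i. c i \<in> B"
  shows "D (Suc n) (shift c) = r * D n c + poly_eval r n c * \<nu>"
proof -
  have "(\<Sum>i<Suc n. r ^ i * d (shift c i)) = r * (\<Sum>i<n. r ^ i * d (c i))"
    unfolding sum.lessThan_Suc_shift by (simp add: d_zero sum_distrib_left mult.assoc)
  moreover have "(\<Sum>i<n. r ^ i * d (c i)) \<in> M"
    by (intro subspace_sum[OF M_subspace] M_mult dD c)
  ultimately have "\<mu> * (\<Sum>i<Suc n. r ^ i * d (shift c i)) = r * (\<mu> * (\<Sum>i<n. r ^ i * d (c i)))"
    using M_left_commute by simp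
  moreover have "poly_deriv r n c * r * \<nu> = r * (poly_deriv r n c * \<nu>)"
    using M_left_commute[OF nu] by (simp add: mult.assoc)
  ultimately show ?thesis
    unfolding D_def poly_deriv_shift by (simp add: distrib_left distrib_right)
qed

lemma D_monomial:
  assumes "b \<in> B"
  shows "D (Suc k) (\<lambda>i. if i = k then b else 0) = \<mu> * (r ^ k * d b) + of_nat k * b * r ^ (k - 1) * \<nu>"
proof -
  have "D k (\<lambda>i. if i = k then b else 0) = 0"
    using subspace_0[OF J_subspace] by (intro D_in_P) auto
  then show ?thesis by (simp add: D_Suc)
qed

text \<open>Since \<open>D\<close> kills every polynomial whose value at r lies in \<open>P\<close>,
  it depends only on the element that a polynomial represents modulo \<open>P\<close>, and so
  descends to \<open>adjoin B r\<close>. The Leibniz rule is checked on monomials and spreads by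
  additivity.\<close>

lemma extension:
  assumes WD: "\<And>n c. (\<And>i. c i \<in> B) \<Longrightarrow> poly_eval r n c \<in> P \<Longrightarrow> D n c = 0"
  shows "\<exists>d'. partial_derivation (adjoin B r) d' \<and> (\<forall>b\<in>B. d' b = \<mu> * d b) \<and> d' r = \<nu>"
proof -
  note sB = subalgD(1)[OF B(1)]
  have zB: "0 \<in> B" using B by (simp add: subalgD)
  have WD2: "D n c = D m e" if c: "\<And>i. c i \<in> B" and e: "\<And>i. e i \<in> B"
    and eq: "poly_eval r n c - poly_eval r m e \<in> P" for n m c e
  proof -
    let ?k = "max n m"
    let ?c = "\<lambda>i. if i < n then c i else 0" and ?e = "\<lambda>i. if i < m then e i else 0"
    have B': "?c i \<in> B" "?e i \<in> B" for i using c e zB by auto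
    have "poly_eval r n c - poly_eval r m e = (\<Sum>i<?k. ?c i * r ^ i) - (\<Sum>i<?k. ?e i * r ^ i)"
      unfolding poly_eval_def sum_pad[of n ?k c, OF max.cobounded1] sum_pad[of m ?k e, OF max.cobounded2] ..
    also have "\<dots> = poly_eval r ?k (\<lambda>i. ?c i - ?e i)"
      unfolding poly_eval_def by (simp only: left_diff_distrib sum_subtractf)
    finally have "poly_eval r ?k (\<lambda>i. ?c i - ?e i) \<in> P" using eq by simp
    then have "D ?k (\<lambda>i. ?c i - ?e i) = 0" using B' B by (intro WD) (auto simp: subalgD)
    then have "D ?k ?c - D ?k ?e = 0" using D_diff[of ?c ?e ?k] B' by simp
    then show ?thesis using D_pad[of n ?k c] D_pad[of m ?k e] by simp
  qed
  have rep: "\<exists>n c. (\<forall>i. c i \<in> B) \<and> u = poly_eval r n c" if "u \<in> adjoin B r" for u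
    using that unfolding adjoin_def poly_eval_def by blast
  define d' where "d' u = (SOME v. \<exists>n c. (\<forall>i. c i \<in> B) \<and> u = poly_eval r n c \<and> v = D n c)" for u
  have d': "d' u = D n c" if c: "\<And>i. c i \<in> B" and u: "u - poly_eval r n c \<in> P" and uB: "u \<in> adjoin B r" for u n c
  proof -
    have "\<exists>v n c. (\<forall>i. c i \<in> B) \<and> u = poly_eval r n c \<and> v = D n c" using rep[OF uB] by blast
    then have "\<exists>n c. (\<forall>i. c i \<in> B) \<and> u = poly_eval r n c \<and> d' u = D n c"
      unfolding d'_def by (rule someI_ex)
    then obtain m e where e: "\<forall>i. e i \<in> B" "u = poly_eval r m e" "d' u = D m e" by blast
    then have "D m e = D n c" using u c by (intro WD2) auto
    then show ?thesis using e by simp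
  qed
  note sA = adjoin_subspace[OF sB, of r]
  note alg = adjoin_subalg[OF B(1), of r]
  have d'_M: "d' u \<in> M" if uA: "u \<in> adjoin B r" for u
  proof -
    obtain n c where "\<forall>i. c i \<in> B" "u = poly_eval r n c" using rep[OF uA] by blast
    then show ?thesis using d'[of c u n] uA D_in_M[of c n] cong_refl by auto
  qed
  have d'_cong: "d' u = d' v" if uv: "u - v \<in> P" "u \<in> adjoin B r" "v \<in> adjoin B r" for u v
  proof -
    obtain n c where c: "\<forall>i. c i \<in> B" "v = poly_eval r n c" using rep[OF uv(3)] by blast
    then show ?thesis using d'[of c u n] d'[of c v n] uv cong_refl by auto
  qed
  have d'_add: "d' (u + v) = d' u + d' v" if uvA: "u \<in> adjoin B r" "v \<in> adjoin B r" for u v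
  proof -
    obtain n c where c: "\<forall>i. c i \<in> B" "u = poly_eval r n c" using rep[OF uvA(1)] by blast
    obtain m e where e: "\<forall>i. e i \<in> B" "v = poly_eval r m e" using rep[OF uvA(2)] by blast
    let ?k = "max n m"
    let ?c = "\<lambda>i. if i < n then c i else 0" and ?e = "\<lambda>i. if i < m then e i else 0"
    have B': "?c i \<in> B" "?e i \<in> B" for i using c e zB by auto
    have "u = poly_eval r ?k ?c" "v = poly_eval r ?k ?e"
      unfolding c(2) e(2) poly_eval_def
      by (rule sum_pad[OF max.cobounded1], rule sum_pad[OF max.cobounded2])
    note uv = this
    have "u + v = poly_eval r ?k (\<lambda>i. ?c i + ?e i)"
      unfolding uv poly_eval_def by (simp only: distrib_right sum.distrib)
    moreover have "?c i + ?e i \<in> B" for i using B' B by (simp only: subalgD)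
    ultimately have "d' (u + v) = D ?k (\<lambda>i. ?c i + ?e i)"
      using subspace_add[OF sA uvA] by (intro d') (simp_all add: subspace_0[OF J_subspace])
    also have "\<dots> = D ?k ?c + D ?k ?e" by (rule D_add[OF B'])
    also have "D ?k ?c = d' u" using B' uv uvA by (intro d'[symmetric]) (simp_all add: subspace_0[OF J_subspace])
    also have "D ?k ?e = d' v" using B' uv uvA by (intro d'[symmetric]) (simp_all add: subspace_0[OF J_subspace])
    finally show ?thesis .
  qed
  have d'_scale: "d' (scale k u) = scale k (d' u)" if uA: "u \<in> adjoin B r" for k u
  proof -
    obtain n c where c: "\<forall>i. c i \<in> B" "u = poly_eval r n c" using rep[OF uA] by blast
    have "d' (scale k u) = D n (\<lambda>i. scale k (c i))"
      using c B subspace_scale[OF sA uA]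
      by (intro d') (simp_all add: subalgD poly_eval_def scale_sum_right scale_mult_left subspace_0[OF J_subspace])
    also have "\<dots> = scale k (D n c)" using c by (intro D_scale) blast
    also have "D n c = d' u" using c uA by (intro d'[symmetric]) (simp_all add: subspace_0[OF J_subspace])
    finally show ?thesis .
  qed
  have d'_sum: "d' (sum f I) = (\<Sum>i\<in>I. d' (f i))" if "finite I" "\<And>i. i \<in> I \<Longrightarrow> f i \<in> adjoin B r"
    for f and I :: "nat set"
    using that
  proof (induction I rule: finite_induct)
    case empty
    have "d' 0 = d' 0 + d' 0" using d'_add[of 0 0] subspace_0[OF sA] by simp
    then show ?case by simp
  next
    case (insert i I)
    then show ?case using d'_add[of "f i" "sum f I"] subspace_sum[OF sA, of I f] by simp
  qed
  have d'_mono: "d' (b * r ^ k) = \<mu> * (r ^ k * d b) + of_nat k * b * r ^ (k - 1) * \<nu>" if b: "b \<in> B" for b k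
  proof -
    have "poly_eval r (Suc k) (\<lambda>i. if i = k then b else 0) = b * r ^ k"
    proof -
      have "(\<Sum>j<k. (if j = k then b else 0) * r ^ j) = 0" by (intro sum.neutral) auto
      then show ?thesis by (simp add: poly_eval_def)
    qed
    then have "d' (b * r ^ k) = D (Suc k) (\<lambda>i. if i = k then b else 0)"
      using b zB adjoin_monomial[OF sB b] by (intro d') (simp_all add: subspace_0[OF J_subspace])
    then show ?thesis using D_monomial[OF b] by simp
  qed
  have leib_mono: "d' (b * r ^ i * (c * r ^ j)) = b * r ^ i * d' (c * r ^ j) + c * r ^ j * d' (b * r ^ i)"
    if b: "b \<in> B" and c: "c \<in> B" for b c i j
  proof -
    have bc: "b * c \<in> B" using b c B by (simp add: subalgD)
    have "b * r ^ i * (c * r ^ j) - b * c * r ^ (i + j) = b * ((r ^ i * c - c * r ^ i) * r ^ j)"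
      by (simp add: algebra_simps power_add)
    also have "\<dots> \<in> P" by (intro J_left J_right commute_power)
    finally have "d' (b * r ^ i * (c * r ^ j)) = d' (b * c * r ^ (i + j))"
      by (intro d'_cong adjoin_monomial sB bc subalgD(3)[OF alg] b c)
    also have "\<dots> = \<mu> * (r ^ (i + j) * (b * d c + c * d b)) + of_nat (i + j) * (b * c) * r ^ (i + j - 1) * \<nu>"
      unfolding d'_mono[OF bc] dD(4)[OF b c] by (simp add: mult.assoc)
    also have "\<mu> * (r ^ (i + j) * (b * d c + c * d b))
        = b * (r ^ i * (\<mu> * (r ^ j * d c))) + c * (r ^ j * (\<mu> * (r ^ i * d b)))"
      using nu by (simp add: power_add mult.assoc distrib_left M_left_commute M_mult dD b c)
    also have "of_nat (i + j) * (b * c) * r ^ (i + j - 1) * \<nu>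
        = b * (r ^ i * (of_nat j * c * r ^ (j - 1) * \<nu>)) + c * (r ^ j * (of_nat i * b * r ^ (i - 1) * \<nu>))"
      using nu by (cases i; cases j)
        (simp_all add: power_add mult.assoc distrib_left distrib_right M_left_commute M_mult add_ac)
    finally show ?thesis unfolding d'_mono[OF b] d'_mono[OF c] by (simp add: distrib_left mult.assoc algebra_simps)
  qed
  have leib: "d' (x * y) = x * d' y + y * d' x" if xy: "x \<in> adjoin B r" "y \<in> adjoin B r" for x y
  proof -
    obtain n c where c: "\<forall>i. c i \<in> B" "x = poly_eval r n c" using rep[OF xy(1)] by blast
    obtain m e where e: "\<forall>i. e i \<in> B" "y = poly_eval r m e" using rep[OF xy(2)] by blast
    have mon: "c i * r ^ i \<in> adjoin B r" "e i * r ^ i \<in> adjoin B r" for i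
      using c(1) e(1) adjoin_monomial[OF sB] by blast+
    have dx: "d' x = (\<Sum>i<n. d' (c i * r ^ i))" unfolding c(2) poly_eval_def by (intro d'_sum mon) simp
    have dy: "d' y = (\<Sum>j<m. d' (e j * r ^ j))" unfolding e(2) poly_eval_def by (intro d'_sum mon) simp
    have "d' (x * y) = (\<Sum>i<n. d' (\<Sum>j<m. c i * r ^ i * (e j * r ^ j)))"
      unfolding c(2) e(2) poly_eval_def sum_product
      by (intro d'_sum subspace_sum[OF sA] subalgD(3)[OF alg] mon) simp
    also have "\<dots> = (\<Sum>i<n. \<Sum>j<m. d' (c i * r ^ i * (e j * r ^ j)))"
      by (intro sum.cong refl d'_sum subalgD(3)[OF alg] mon) simp
    also have "\<dots> = (\<Sum>i<n. \<Sum>j<m. c i * r ^ i * d' (e j * r ^ j) + e j * r ^ j * d' (c i * r ^ i))"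
      by (intro sum.cong refl leib_mono) (use c e in auto)
    also have "\<dots> = x * d' y + (\<Sum>i<n. \<Sum>j<m. e j * r ^ j * d' (c i * r ^ i))"
      unfolding dy c(2) poly_eval_def sum_product by (simp only: sum.distrib)
    also have "(\<Sum>i<n. \<Sum>j<m. e j * r ^ j * d' (c i * r ^ i)) = y * d' x"
      unfolding dx e(2) poly_eval_def sum_product by (rule sum.swap)
    finally show ?thesis .
  qed
  have d'_P: "d' p = 0" if "p \<in> P" for p
  proof -
    have "d' p = d' 0" using that subalgD(2)[OF alg] subspace_0[OF sA] by (intro d'_cong) auto
    also have "d' 0 = 0" using d'_sum[of "{}" "\<lambda>_. 0"] by simp
    finally show ?thesis .
  qed
  have "partial_derivation (adjoin B r) d'"
    unfolding partial_derivation_def using d'_M d'_P d'_add leib d'_scale by blast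
  moreover have "\<forall>b\<in>B. d' b = \<mu> * d b"
    using d'_mono[of _ 0] by simp
  moreover have "d' r = \<nu>"
    using d'_mono[OF B(2), of 1] dD(4)[OF B(2) B(2)] by simp
  ultimately show ?thesis by blast
qed

lemma extension_transcendental:
  assumes "transcendental B r"
  shows "\<exists>d'. partial_derivation (adjoin B r) d' \<and> (\<forall>b\<in>B. d' b = \<mu> * d b) \<and> d' r = \<nu>"
  using assms by (intro extension D_in_P) (auto simp: transcendental_def)

text \<open>Pseudo-division by a relation \<open>m\<close> of minimal degree: as B / P is merely a
  domain, a polynomial is first multiplied by the leading coefficient \<open>m e\<close>, after
  which a multiple of a shift of \<open>m\<close> lowers its degree. The factor \<open>m e\<close>
  cancels in the torsion-free module \<open>M\<close>.\<close>

lemma D_relation: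
  assumes m: "\<And>i. m i \<in> B" "poly_eval r (Suc e) m \<in> P" "m e \<notin> P"
    and min: "\<And>k c. k \<le> e \<Longrightarrow> (\<And>i. c i \<in> B) \<Longrightarrow> poly_eval r k c \<in> P \<Longrightarrow> \<forall>i<k. c i \<in> P"
    and Dm: "D (Suc e) m = 0"
  shows "(\<And>i. c i \<in> B) \<Longrightarrow> poly_eval r n c \<in> P \<Longrightarrow> D n c = 0"
proof (induction n arbitrary: c)
  case (Suc k)
  show ?case
  proof (cases "Suc k \<le> e")
    case True
    then show ?thesis using min[OF True Suc.prems] by (intro D_in_P) blast
  next
    case False
    define q where "q = k - e"
    have q: "q + Suc e = Suc k" "q + e = k" using False by (simp_all add: q_def)
    define m' where "m' = (shift ^^ q) m"
    have "(\<forall>i. (shift ^^ p) m i \<in> B) \<and> poly_eval r (p + Suc e) ((shift ^^ p) m) \<in> P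
        \<and> D (p + Suc e) ((shift ^^ p) m) = 0" for p
    proof (induction p)
      case 0
      then show ?case using m Dm by simp
    next
      case (Suc p)
      let ?m = "(shift ^^ p) m"
      have "shift ?m i \<in> B" for i using Suc B by (cases i) (auto simp: subalgD)
      moreover have "poly_eval r (Suc (p + Suc e)) (shift ?m) \<in> P"
        unfolding poly_eval_shift using Suc by (intro J_right) blast
      moreover have "D (Suc (p + Suc e)) (shift ?m) = 0"
        using Suc P_M[OF _ nu] by (subst D_shift) auto
      ultimately show ?case by simp
    qed
    from this[of q] have m': "\<And>i. m' i \<in> B" "poly_eval r (Suc k) m' \<in> P" "D (Suc k) m' = 0"
      unfolding m'_def q by auto
    have top: "m' k = m e" using shift_iterate[of q m e] unfolding m'_def q .
    define G where "G i = m e * c i - c k * m' i" for i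
    have GB: "G i \<in> B" for i using Suc.prems m m' B by (simp add: G_def subalgD)
    have Gk: "G k \<in> P" unfolding G_def top by (rule commutator_J)
    have evG: "poly_eval r (Suc k) G = m e * poly_eval r (Suc k) c - c k * poly_eval r (Suc k) m'"
      unfolding poly_eval_def G_def by (simp only: left_diff_distrib sum_subtractf sum_distrib_left mult.assoc)
    have "poly_eval r (Suc k) G - G k * r ^ k \<in> P"
      unfolding evG using Suc.prems m' Gk by (intro subspace_diff[OF J_subspace] J_left J_right)
    then have "poly_eval r k G \<in> P" by (simp add: poly_eval_def)
    then have "D k G = 0" using GB by (intro Suc.IH)
    moreover have "of_nat k * G k * r ^ (k - 1) \<in> P" using Gk by (intro J_left J_right)
    ultimately have "D (Suc k) G = 0" using P_M[OF _ nu] Gk by (simp add: D_Suc dD(2))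
    moreover have "D (Suc k) G = m e * D (Suc k) c"
    proof -
      have "D (Suc k) G = D (Suc k) (\<lambda>i. m e * c i) - D (Suc k) (\<lambda>i. c k * m' i)"
        unfolding G_def using Suc.prems m m' B by (intro D_diff) (simp_all add: subalgD)
      then show ?thesis
        using D_mult[OF m(1) Suc.prems(1)] D_mult[OF Suc.prems(1) m'(1)] m'
          P_M[OF Suc.prems(2) dD(1)[OF m(1)]] P_M[OF m'(2) dD(1)[OF Suc.prems(1)]] by simp
    qed
    ultimately show ?thesis using M_cancel[OF D_in_M] Suc.prems(1) m(3) by simp
  qed
qed (simp add: D_def poly_deriv_def)

end

context prime_element
begin

lemma of_nat_mult_scale: "of_nat k * a = scale (of_nat k) a"
  by (induction k) (simp_all add: distrib_right scale_left_distrib)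

lemma minimal_relation:
  assumes "\<not> transcendental B r"
  shows "\<exists>e m. (\<forall>i. m i \<in> B) \<and> poly_eval r (Suc e) m \<in> P \<and> m e \<notin> P
    \<and> (\<forall>k\<le>e. \<forall>c. (\<forall>i. c i \<in> B) \<longrightarrow> poly_eval r k c \<in> P \<longrightarrow> (\<forall>i<k. c i \<in> P))"
proof -
  let ?R = "\<lambda>n. \<exists>c. (\<forall>i. c i \<in> B) \<and> poly_eval r n c \<in> P \<and> \<not> (\<forall>i<n. c i \<in> P)"
  have "\<exists>n. ?R n" using assms unfolding transcendental_def by blast
  then obtain n where n: "?R n" and min: "\<And>k. k < n \<Longrightarrow> \<not> ?R k"
    using exists_least_iff[of ?R] by blast
  obtain m where m: "\<forall>i. m i \<in> B" "poly_eval r n m \<in> P" "\<not> (\<forall>i<n. m i \<in> P)" using n by blast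
  then obtain e where e: "n = Suc e" by (cases n) auto
  have "m e \<notin> P"
  proof
    assume me: "m e \<in> P"
    have "poly_eval r n m - m e * r ^ e \<in> P" using me m by (intro subspace_diff[OF J_subspace] J_right)
    then have "poly_eval r e m \<in> P" by (simp add: e poly_eval_def)
    then have "\<forall>i<e. m i \<in> P" using min[of e] m e by auto
    then show False using m(3) me less_Suc_eq by (auto simp: e)
  qed
  then show ?thesis using m min e by (metis le_imp_less_Suc)
qed

text \<open>The usual formula for the derivative of r divides by m'(r), for the minimal relation m.
  Multiplying d by \<mu> = m'(r) instead and sending r to \<nu> = - \<Sum> r^i d(m_i) gives D m = 0
  without division. Minimality and characteristic zero keep \<mu> outside \<open>P\<close>.\<close>

lemma extension_algebraic:
  assumes B: "subalg B" "1 \<in> B" and d: "partial_derivation B d" and alg: "\<not> transcendental B r"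
  shows "\<exists>d' \<mu>. \<mu> \<notin> P \<and> partial_derivation (adjoin B r) d' \<and> (\<forall>b\<in>B. d' b = \<mu> * d b)"
proof -
  obtain e m where m: "\<And>i. m i \<in> B" "poly_eval r (Suc e) m \<in> P" "m e \<notin> P"
    and min: "\<And>k c. k \<le> e \<Longrightarrow> (\<And>i. c i \<in> B) \<Longrightarrow> poly_eval r k c \<in> P \<Longrightarrow> \<forall>i<k. c i \<in> P"
    using minimal_relation[OF alg] by blast
  define \<mu> where "\<mu> = poly_deriv r (Suc e) m"
  define \<nu> where "\<nu> = - (\<Sum>i<Suc e. r ^ i * d (m i))"
  have "\<mu> \<notin> P"
  proof
    assume "\<mu> \<in> P"
    moreover have "\<mu> = poly_eval r e (\<lambda>i. of_nat (Suc i) * m (Suc i))"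
      unfolding \<mu>_def poly_deriv_def poly_eval_def sum.lessThan_Suc_shift by simp
    moreover have "of_nat (Suc i) * m (Suc i) \<in> B" for i
      unfolding of_nat_mult_scale using m(1) subspace_scale[OF subalgD(1)[OF B(1)]] by blast
    ultimately have *: "\<forall>i<e. of_nat (Suc i) * m (Suc i) \<in> P"
      using min[of e "\<lambda>i. of_nat (Suc i) * m (Suc i)"] by simp
    show False
    proof (cases e)
      case 0
      then show False using m by (simp add: poly_eval_def)
    next
      case (Suc i)
      then have "scale (of_nat e) (m e) \<in> P" using * by (metis lessI of_nat_mult_scale)
      then have "scale (1 / of_nat e) (scale (of_nat e) (m e)) \<in> P" by (rule subspace_scale[OF J_subspace])
      moreover have "(of_nat e :: 'k) \<noteq> 0" using Suc by (simp del: of_nat_Suc)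
      ultimately show False using m(3) by simp
    qed
  qed
  moreover have "\<nu> \<in> M"
    unfolding \<nu>_def using m(1) d
    by (intro subspace_neg[OF M_subspace] subspace_sum[OF M_subspace] M_mult)
      (simp add: partial_derivation_def)
  then interpret E: derivation_extension scale s B d r \<mu> \<nu>
    using B d by unfold_locales
  have "E.D (Suc e) m = 0" unfolding E.D_def unfolding \<mu>_def[symmetric] \<nu>_def mult_minus_right by (rule right_minus)
  note E.D_relation[OF m min this]
  from E.extension[OF this]
  have "\<exists>d'. partial_derivation (adjoin B r) d' \<and> (\<forall>b\<in>B. d' b = \<mu> * d b)" by blast
  ultimately show ?thesis by blast
qed

text \<open>Modulo \<open>P\<close> the minimal relation has scalar coefficients and expresses
  \<open>g ^ e\<close>, hence every power of g, by the powers below e. So finitely many translates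
  of B span \<open>adjoin B g\<close>.\<close>

lemma fd_mod_adjoin_algebraic:
  assumes alg: "\<not> transcendental (span (insert 1 P)) g" and B: "fd_mod P B"
  shows "fd_mod P (adjoin B g)"
proof -
  obtain e m where m: "\<And>i. m i \<in> span (insert 1 P)" "poly_eval g (Suc e) m \<in> P" "m e \<notin> P"
    using minimal_relation[OF alg] by blast
  have spP: "span P = P" using J_subspace by (simp add: span_eq_iff)
  obtain k where k: "\<And>i. m i - scale (k i) 1 \<in> P"
    using m(1) unfolding span_insert spP by simp metis
  define W where "W = span ((\<lambda>i. g ^ i) ` {..<e} \<union> P)"
  have PW: "P \<subseteq> W" by (auto simp: W_def intro: span_base)
  have W: "subspace W" by (simp add: W_def)
  have mono: "m i * g ^ i \<in> W" if "i < e" for i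
  proof -
    have "scale (k i) (g ^ i) \<in> W" unfolding W_def using that by (intro span_scale span_base) auto
    moreover have "(m i - scale (k i) 1) * g ^ i \<in> W" using J_right[OF k] PW by blast
    ultimately have "scale (k i) (g ^ i) + (m i - scale (k i) 1) * g ^ i \<in> W" by (rule subspace_add[OF W])
    then show ?thesis by (simp add: left_diff_distrib scale_mult_left)
  qed
  have "k e \<noteq> 0" using k[of e] m(3) by auto
  have top: "g ^ e \<in> W"
  proof -
    have "poly_eval g (Suc e) m - (\<Sum>i<e. m i * g ^ i) - (m e - scale (k e) 1) * g ^ e \<in> W"
      using m(2) PW J_right[OF k] mono by (intro subspace_diff[OF W] subspace_sum[OF W]) auto
    then have "scale (k e) (g ^ e) \<in> W" by (simp add: poly_eval_def left_diff_distrib scale_mult_left)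
    then have "scale (1 / k e) (scale (k e) (g ^ e)) \<in> W" by (rule subspace_scale[OF W])
    then show ?thesis using \<open>k e \<noteq> 0\<close> by simp
  qed
  have low: "g ^ i \<in> W" if "i \<le> e" for i
    using that top by (cases "i = e") (auto simp: W_def intro: span_base)
  have "subspace {w. w * g \<in> W}"
    using W by (intro subspaceI) (auto simp: distrib_right scale_mult_left subspace_0 subspace_add subspace_scale)
  moreover have "g ^ i * g \<in> W" if "i < e" for i using low[of "Suc i"] that by (simp add: power_commutes)
  ultimately have "W \<subseteq> {w. w * g \<in> W}"
    using J_right PW by (subst W_def, intro span_minimal) auto
  then have pow: "g ^ i \<in> W" for i
  proof (induction i)
    case (Suc i)
    then have "g ^ i * g \<in> W" by blast
    then show ?case by (simp add: power_commutes)
  qed (use low[of 0] in simp)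
  define U where "U = span ((\<Union>i<e. (\<lambda>b. b * g ^ i) ` B) \<union> P)"
  have "fd_mod P ((\<lambda>b. b * g ^ i) ` B)" for i
    using J_right by (intro endo.fd_mod_image[OF linear_mult_right B]) (auto intro: span_base)
  then have "fd_mod P U"
    unfolding U_def by (intro fd_mod_span fd_mod_Un fd_mod_UN fd_mod_self) auto
  have U: "subspace U" by (simp add: U_def)
  have bW: "b * w \<in> U" if b: "b \<in> B" and "w \<in> W" for b w
  proof -
    have "subspace {w. b * w \<in> U}"
      using U by (intro subspaceI) (auto simp: distrib_left scale_mult_right subspace_0 subspace_add subspace_scale)
    moreover have "b * p \<in> U" if "p \<in> P" for p using J_left[OF that] by (auto simp: U_def intro: span_base)
    moreover have "b * g ^ i \<in> U" if "i < e" for i using b that unfolding U_def by (intro span_base) auto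
    ultimately have "W \<subseteq> {w. b * w \<in> U}" unfolding W_def by (intro span_minimal) auto
    then show ?thesis using that by blast
  qed
  have "adjoin B g \<subseteq> U"
    unfolding adjoin_def using bW pow by (auto intro!: subspace_sum[OF U])
  then show ?thesis by (rule fd_mod_mono[OF \<open>fd_mod P U\<close>])
qed

lemma not_fd_mod_P: "\<not> fd_mod P UNIV"
proof
  assume "fd_mod P UNIV"
  then have "fd_mod {} (range (\<lambda>a. a * s))"
    by (rule endo.fd_mod_image[OF linear_mult_right]) (auto simp: P_def)
  then show False using s_large by (simp add: large_def)
qed

lemma exists_transcendental:
  assumes S: "finite S" "subalgebra hull S = UNIV"
  shows "\<exists>x. transcendental (span (insert 1 P)) x"
proof (rule ccontr)
  assume neg: "\<not> ?thesis"
  have "fd_mod P UNIV"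
  proof (rule adjoin_induct_generators[OF S])
    show "fd_mod P (span (insert 1 P))" by (rule fd_modI[of "{1}"]) auto
  qed (use neg in \<open>blast intro: fd_mod_adjoin_algebraic\<close>)
  then show False using not_fd_mod_P by blast
qed

text \<open>The induction over generators starts at the scalars, without x, so \<open>Q\<close>
  allows a larger subalgebra \<open>B'\<close> that contains x. The first derivation is s d/dx on
  polynomials in x. A transcendental generator is sent to 0; an algebraic one costs a factor \<mu>
  outside the prime \<open>P\<close>, so the value at x stays c s with c outside
  \<open>P\<close>.\<close>

lemma exists_derivation:
  assumes S: "finite S" "subalgebra hull S = UNIV"
  shows "\<exists>\<delta> x c. \<delta> \<in> Der scale \<and> (\<forall>a. \<delta> a \<in> M) \<and> (\<forall>p\<in>P. \<delta> p = 0) \<and> \<delta> x = c * s \<and> c \<notin> P"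
proof -
  let ?B0 = "span (insert 1 P)"
  obtain x where x: "transcendental ?B0 x" using exists_transcendental[OF S] by blast
  define Q where "Q B \<longleftrightarrow> (\<exists>B'. subalg B' \<and> 1 \<in> B' \<and> B \<subseteq> B' \<and> x \<in> B'
    \<and> (\<exists>d c. partial_derivation B' d \<and> d x = c * s \<and> c \<notin> P))" for B
  have one: "1 \<in> ?B0" by (auto intro: span_base)
  have "Q UNIV"
  proof (rule adjoin_induct_generators[OF S])
    have "s \<in> M" unfolding M_def by (rule range_eqI[of _ _ 1]) simp
    then interpret E: derivation_extension scale s ?B0 "\<lambda>_. 0" x 1 s
      using subalg_base one subspace_0[OF M_subspace]
      by unfold_locales (simp_all add: partial_derivation_def)
    obtain d where "partial_derivation (adjoin ?B0 x) d" "d x = s"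
      using E.extension_transcendental[OF x] by blast
    then have "\<exists>d c. partial_derivation (adjoin ?B0 x) d \<and> d x = c * s \<and> c \<notin> P"
      using one_notin_P by (intro exI[of _ d] exI[of _ 1]) simp
    moreover note adjoin_subalg[OF subalg_base, of x] adjoin_superset[OF subspace_span, of "insert 1 P" x]
      adjoin_element[OF subspace_span one, of x]
    ultimately show "Q ?B0" unfolding Q_def using one by (intro exI[of _ "adjoin ?B0 x"]) auto
  next
    fix B r assume "Q B"
    then obtain B' d c where B': "subalg B'" "1 \<in> B'" "B \<subseteq> B'" "x \<in> B'"
      and d: "partial_derivation B' d" "d x = c * s" "c \<notin> P" unfolding Q_def by blast
    note sB = subalgD(1)[OF B'(1)]
    have "\<exists>d' \<mu>. \<mu> \<notin> P \<and> partial_derivation (adjoin B' r) d' \<and> (\<forall>b\<in>B'. d' b = \<mu> * d b)"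
    proof (cases "transcendental B' r")
      case True
      interpret E: derivation_extension scale s B' d r 1 0
        using B' d subspace_0[OF M_subspace] by unfold_locales
      show ?thesis using E.extension_transcendental[OF True] one_notin_P by blast
    qed (rule extension_algebraic[OF B'(1,2) d(1)])
    then obtain d' \<mu> where d': "\<mu> \<notin> P" "partial_derivation (adjoin B' r) d'" "\<forall>b\<in>B'. d' b = \<mu> * d b"
      by blast
    have "d' x = \<mu> * c * s" "\<mu> * c \<notin> P" using d d' B'(4) prime by (auto simp: mult.assoc)
    then have "\<exists>d c. partial_derivation (adjoin B' r) d \<and> d x = c * s \<and> c \<notin> P" using d' by blast
    moreover have "adjoin B r \<subseteq> adjoin B' r" using B'(3) unfolding adjoin_def by blast
    ultimately show "Q (adjoin B r)"
      unfolding Q_def using adjoin_superset[OF sB, of r] B' adjoin_subalg[OF B'(1)]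
      by (intro exI[of _ "adjoin B' r"]) auto
  qed
  then obtain d c where d: "partial_derivation UNIV d" and c: "d x = c * s" "c \<notin> P"
    unfolding Q_def by (auto simp: top.extremum_unique)
  have "d \<in> Der scale"
  proof (rule DerI)
    fix a b
    have "d a \<in> core" using d M_core by (simp add: partial_derivation_def)
    then have "b * d a = d a * b" by (simp add: coreD(1))
    then show "d (a * b) = d a * b + a * d b" using d by (simp add: partial_derivation_def)
  qed (use d in \<open>simp_all add: partial_derivation_def\<close>)
  then show ?thesis using d c by (intro exI[of _ d] exI[of _ x] exI[of _ c]) (simp add: partial_derivation_def)
qed

section \<open>Lie algebras of multiples of one derivation\<close>

lemma scaled_derivation:
  assumes \<delta>: "\<delta> \<in> Der scale" and f: "f \<in> core"
  shows "(\<lambda>a. f * \<delta> a) \<in> Der scale"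
proof (rule DerI)
  fix a b
  have "f * (a * \<delta> b) = a * (f * \<delta> b)" using coreD(1)[OF f, of a] by (simp add: mult.assoc[symmetric])
  then show "f * \<delta> (a * b) = f * \<delta> a * b + a * (f * \<delta> b)"
    by (simp add: DerD(3)[OF \<delta>] distrib_left mult.assoc)
qed (simp_all add: DerD[OF \<delta>] distrib_left scale_mult_right)

text \<open>Here products of two elements of \<open>M\<close> vanish, so in f \<delta>(g \<delta> a)
  the term with \<delta> g drops out and the rest is symmetric in f and g. Evaluation at x shows
  infinite dimension: f c s = 0 only for f in \<open>P\<close>, and \<open>core\<close> has finite
  codimension whereas \<open>P\<close> has not.\<close>

lemma not_right_noetherian_Der_if_nilpotent:
  assumes core: "fd_mod core UNIV" and nil: "s * s = 0"
    and \<delta>: "\<delta> \<in> Der scale" "\<And>a. \<delta> a \<in> M" and x: "\<delta> x = c * s" "c \<notin> P"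
  shows "\<not> right_noetherian (uea (fun_scale scale) commutator (Der scale))"
proof (rule not_right_noetherian_if_abelian[OF lie_algebra_Der order_refl,
      where C = "(\<lambda>f a. f * \<delta> a) ` core"])
  show "(0 :: 'a) \<noteq> 1" using one_notin_P subspace_0[OF J_subspace] by auto
  show "(\<lambda>f a. f * \<delta> a) ` core \<subseteq> Der scale" using scaled_derivation[OF \<delta>(1)] by blast
  have MM: "v * w = 0" if vw: "v \<in> M" "w \<in> M" for v w
  proof -
    obtain a b where "v = a * s" "w = b * s" using vw by (auto simp: M_def)
    then have "v * w = a * b * (s * s)"
      using coreD(2)[OF s_core, of s b] by (simp add: mult.assoc)
    then show ?thesis using nil by simp
  qed
  show "commutator u v = 0" if uv: "u \<in> (\<lambda>f a. f * \<delta> a) ` core" "v \<in> (\<lambda>f a. f * \<delta> a) ` core" for u v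
  proof -
    obtain f g where fg: "f \<in> core" "g \<in> core" "u = (\<lambda>a. f * \<delta> a)" "v = (\<lambda>a. g * \<delta> a)" using uv by auto
    have "f * (g * \<delta> (\<delta> a)) = g * (f * \<delta> (\<delta> a))" for a by (rule M_left_commute[OF \<delta>(2)])
    then show ?thesis
      using MM \<delta> by (simp add: fg commutator_def fun_eq_iff DerD[OF \<delta>(1)] distrib_left)
  qed
  show "\<not> maps.fd_mod {} ((\<lambda>f a. f * \<delta> a) ` core)"
  proof
    assume fd: "maps.fd_mod {} ((\<lambda>f a. f * \<delta> a) ` core)"
    interpret ev: vector_space_pair "fun_scale scale" scale ..
    have "Vector_Spaces.linear (fun_scale scale) scale (\<lambda>E. E x)"
      by unfold_locales (simp_all add: fun_scale_def)
    then have "fd_mod {} ((\<lambda>E. E x) ` (\<lambda>f a. f * \<delta> a) ` core)"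
      using fd by (rule ev.fd_mod_image) simp
    then have "fd_mod {} ((\<lambda>f. f * (c * s)) ` core)" by (simp add: image_image x(1))
    moreover have "{f \<in> core. f * (c * s) \<in> span {}} \<subseteq> P"
      using s_prime x(2) by (auto simp: P_def mult.assoc[symmetric])
    then have "fd_mod P {f \<in> core. f * (c * s) \<in> span {}}" by (rule fd_mod_mono[OF fd_mod_self])
    ultimately have "fd_mod P core"
      by (rule endo.fd_mod_kernel[OF linear_mult_right core_subspace])
    then show False using fd_mod_trans[OF core] not_fd_mod_P by blast
  qed
qed

text \<open>The Lie algebra of derivations \<open>f \<delta>\<close> with \<open>f \<in> M\<close> has the cocycle \<open>f \<delta> \<mapsto> \<delta> f\<close>. In the
  extension that it defines, the quadratic differential operators \<open>w h\<close> below act as multiplication of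
  the trivial quotient by \<open>2 h s (\<delta> x)\<^sup>2\<close>: they are second differences of \<open>p \<mapsto> \<delta> \<circ> p \<delta>\<close>, which leave
  the leading coefficient of the cocycle only.\<close>

lemma not_right_noetherian_Der_if_not_nilpotent:
  assumes s: "s \<notin> P"
    and \<delta>: "\<delta> \<in> Der scale" "\<And>a. \<delta> a \<in> M" and x: "\<delta> x = c * s" "c \<notin> P"
  shows "\<not> right_noetherian (uea (fun_scale scale) commutator (Der scale))"
proof -
  define E where "E f = (\<lambda>a. f * \<delta> a)" for f
  note D = DerD[OF \<delta>(1)]
  \<comment> \<open>\<open>M\<close> and \<open>P\<close> meet only in 0 as s lies outside the prime
    \<open>P\<close>. Hence f in \<open>M\<close> is determined by f \<delta>, which makes
    \<open>\<kappa>\<close> well defined below.\<close>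
  have M_P: "v = 0" if v: "v \<in> M" "v \<in> P" for v
  proof -
    obtain b where b: "v = b * s" using v(1) by (auto simp: M_def)
    then have "b * s * s = 0" using v(2) by (simp add: P_def)
    then show ?thesis using s_prime s by (auto simp: b P_def)
  qed
  have E_inj: "f = g" if fg: "f \<in> M" "g \<in> M" "E f = E g" for f g
  proof -
    have "E f x = E g x" using fg by simp
    then have "(f - g) * c * s = 0" by (simp add: E_def x(1) left_diff_distrib mult.assoc)
    then have "f - g \<in> P" using s_prime x(2) by (auto simp: P_def)
    moreover have "f - g \<in> M" using fg M_subspace by (simp add: subspace_diff)
    ultimately show ?thesis using M_P[of "f - g"] by simp
  qed
  have E_Der: "E f \<in> Der scale" if "f \<in> M" for f
    unfolding E_def using scaled_derivation[OF \<delta>(1) M_core[OF that]] .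
  have E_add: "E f + E g = E (f + g)" and E_scale: "fun_scale scale k (E f) = E (scale k f)" for f g k
    by (auto simp: E_def fun_scale_def distrib_right scale_mult_left)
  have E_bracket: "commutator (E f) (E g) = E (f * \<delta> g - g * \<delta> f)" for f g
  proof
    fix a
    have "f * (\<delta> g * \<delta> a) + f * (g * \<delta> (\<delta> a)) - (g * (\<delta> f * \<delta> a) + g * (f * \<delta> (\<delta> a)))
        = (f * \<delta> g - g * \<delta> f) * \<delta> a"
      using M_left_commute[OF \<delta>(2), of f g] by (simp add: left_diff_distrib mult.assoc)
    then show "commutator (E f) (E g) a = E (f * \<delta> g - g * \<delta> f) a"
      by (simp add: commutator_def E_def D distrib_left)
  qed
  have bracket_M: "f * \<delta> g - g * \<delta> f \<in> M" for f g
    using \<delta>(2) by (intro subspace_diff[OF M_subspace] M_mult)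
  let ?H = "E ` M"
  have HD: "?H \<subseteq> Der scale" using E_Der by blast
  have "maps.subspace ?H"
  proof (rule maps.subspaceI)
    have "0 = E 0" by (simp add: E_def fun_eq_iff)
    then show "0 \<in> ?H" using subspace_0[OF M_subspace] by blast
  qed (use M_subspace in \<open>auto simp: E_add E_scale subspace_add subspace_scale\<close>)
  then interpret H: lie_algebra "fun_scale scale" commutator ?H
    using HD bracket_M by (intro lie_algebra_Der_subspace) (auto simp: E_bracket)
  define \<kappa> where "\<kappa> e = \<delta> (THE f. f \<in> M \<and> e = E f)" for e
  have kappa: "\<kappa> (E f) = \<delta> f" if f: "f \<in> M" for f
  proof -
    have "(THE g. g \<in> M \<and> E f = E g) = f" using f E_inj by (intro the_equality) auto
    then show ?thesis by (simp add: \<kappa>_def)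
  qed
  have coc: "lie_cocycle (fun_scale scale) commutator ?H scale (\<lambda>e. e) \<kappa>"
  proof unfold_locales
    fix e g k u v assume "e \<in> ?H"
    then obtain f where f: "f \<in> M" "e = E f" by blast
    show "e (v + u) = e v + e u" "e (scale k v) = scale k (e v)" "e v \<in> UNIV"
      using DerD[OF E_Der[OF f(1)]] by (simp_all add: f)
    show "fun_scale scale k e v = scale k (e v)" by (simp add: fun_scale_def)
    show "\<kappa> (fun_scale scale k e) = scale k (\<kappa> e)"
      using f M_subspace by (simp add: E_scale kappa subspace_scale D)
    assume "g \<in> ?H"
    then obtain h where h: "h \<in> M" "g = E h" by blast
    show "(e + g) v = e v + g v" by simp
    show "commutator e g v = e (g v) - g (e v)" by (simp add: commutator_def)
    show "\<kappa> (e + g) = \<kappa> e + \<kappa> g"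
      using f h M_subspace by (simp add: E_add kappa subspace_add D)
    have "\<delta> f * \<delta> h = \<delta> h * \<delta> f" using coreD(1)[OF M_core[OF \<delta>(2)]] .
    then show "\<kappa> (commutator e g) = e (\<kappa> g) - g (\<kappa> e)"
      using f h bracket_M by (simp add: E_bracket kappa D) (simp add: E_def)
  qed simp_all
  then interpret C: lie_cocycle "fun_scale scale" commutator ?H scale "\<lambda>e. e" \<kappa> .
  interpret X: lie_representation "fun_scale scale" commutator ?H "extension_scale scale" UNIV
    "extension_action scale (\<lambda>e. e) \<kappa>" by (rule C.lie_representation_extension)
  define y where "y = \<delta> x"
  have sM: "s \<in> M" unfolding M_def by (rule range_eqI[of _ _ 1]) simp
  \<comment> \<open>For T g = \<delta>(g \<delta> v + k \<delta> g), the element \<open>w h\<close>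
    yields h times x^2 T(s) - 2 x T(x s) + T(x^2 s), the double commutator of T with multiplication
    by x, applied to s. It removes the first-order part, which carries v, and turns k \<delta>^2
    into 2 k (\<delta> x)^2.\<close>
  define w :: "'a \<Rightarrow> ('a \<Rightarrow> 'a) free_monoid \<Rightarrow>\<^sub>0 'k"
    where "w h = word [E (x * (x * h)), E s] - word [E (x * h), E (x * s)] - word [E (x * h), E (x * s)]
    + word [E h, E (x * (x * s))]" for h
  have step: "extension_action scale (\<lambda>e. e) \<kappa> (E f) (v, k) = (f * \<delta> v + scale k (\<delta> f), 0)"
    if "f \<in> M" for f v k using kappa[OF that] by (simp add: extension_action_def E_def)
  have two: "X.act (word [E f, E g]) (v, k) = (f * \<delta> (g * \<delta> v + scale k (\<delta> g)), 0)"
    if "f \<in> M" "g \<in> M" for f g v k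
    using that by (simp add: X.act_word step)
  have act: "X.act (w h) (v, k) = (scale k (h * (s * (y * y)) + h * (s * (y * y))), 0)" if h: "h \<in> M" for h v k
  proof -
    have in_core: "h \<in> core" "s \<in> core" "y \<in> core" "\<delta> a \<in> core" for a
      using h sM \<delta>(2) M_core by (auto simp: y_def)
    have comm: "a * b = b * a" "a * (b * d) = b * (a * d)" if "a \<in> core \<or> b \<in> core" for a b d
    proof -
      show "a * b = b * a" using that coreD(1) by metis
      then show "a * (b * d) = b * (a * d)" by (simp add: mult.assoc[symmetric])
    qed
    have "X.act (w h) (v, k) = (x * (x * h) * \<delta> (s * \<delta> v + scale k (\<delta> s))
      - x * h * \<delta> (x * s * \<delta> v + scale k (\<delta> (x * s))) - x * h * \<delta> (x * s * \<delta> v + scale k (\<delta> (x * s)))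
      + h * \<delta> (x * (x * s) * \<delta> v + scale k (\<delta> (x * (x * s)))), 0)"
      using h sM by (simp add: w_def X.act_add X.act_diff two M_mult)
    also have "\<dots> = (scale k (h * (s * (y * y)) + h * (s * (y * y))), 0)"
      by (simp add: D y_def[symmetric] distrib_left distrib_right scale_mult_right scale_mult_left scale_right_distrib
          mult.assoc comm in_core)
    finally show ?thesis .
  qed
  let ?u = "\<lambda>h. h * (s * (y * y)) + h * (s * (y * y))"
  have fd: "\<not> fd_mod {} (?u ` M)"
  proof
    assume fd: "fd_mod {} (?u ` M)"
    have "Vector_Spaces.linear scale scale ?u"
      by unfold_locales (simp_all add: distrib_right scale_mult_left scale_right_distrib add_ac)
    moreover have "{h \<in> M. ?u h \<in> span {}} \<subseteq> {0}"
    proof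
      fix h assume "h \<in> {h \<in> M. ?u h \<in> span {}}"
      then have h: "h \<in> M" "?u h = 0" by auto
      have "scale 2 (h * (s * (y * y))) = ?u h" using scale_left_distrib[of 1 1 "h * (s * (y * y))"] by simp
      then have "h * s * y * c * s = 0" using h(2) by (simp add: mult.assoc y_def x(1))
      then have "h * s * y \<in> P" using s_prime x(2) by (auto simp: P_def)
      then have "h * s * (c * s) \<in> P" by (simp add: y_def x(1))
      then have "h \<in> P" using prime s x(2) by blast
      then show "h \<in> {0}" using M_P h by simp
    qed
    then have "fd_mod {} {h \<in> M. ?u h \<in> span {}}" by (rule fd_mod_zero)
    ultimately have "fd_mod {} M" using fd by (intro endo.fd_mod_kernel[OF _ M_subspace])
    then show False using s_large by (simp add: M_def large_def)
  qed
  have nontrivial: "(0 :: 'a) \<noteq> 1" using one_notin_P subspace_0[OF J_subspace] by auto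
  show ?thesis
  proof (rule not_right_noetherian_if_cocycle[OF lie_algebra_Der order_refl HD nontrivial coc _ act fd])
    show "w h \<in> free_carrier ?H" if "h \<in> M" for h
      unfolding w_def using that sM M_mult
      by (intro fa.subspace_add[OF subspace_free] fa.subspace_diff[OF subspace_free])
        (auto simp: word_in_free)
  qed
qed

lemma not_right_noetherian_Der:
  assumes S: "finite S" "subalgebra hull S = UNIV" and core: "fd_mod core UNIV"
  shows "\<not> right_noetherian (uea (fun_scale scale) commutator (Der scale))"
proof -
  obtain \<delta> x c where "\<delta> \<in> Der scale" "\<And>a. \<delta> a \<in> M" "\<delta> x = c * s" "c \<notin> P"
    using exists_derivation[OF S] by blast
  then show ?thesis
    using not_right_noetherian_Der_if_nilpotent[OF core] not_right_noetherian_Der_if_not_nilpotent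
    by (cases "s \<in> P") (simp_all add: P_def)
qed

end

theorem theorem1p1:
  fixes scale :: "'k::field_char_0 \<Rightarrow> 'a::ring_1 \<Rightarrow> 'a"
  assumes "assoc_algebra scale"
    and "assoc_algebra.finitely_generated scale"
    and "\<not> vector_space.fin_dim scale (UNIV :: 'a set)"
  shows "\<not> noetherian (uea (fun_scale scale) commutator (Der scale)) \<and>
    (\<not> vector_space.fin_dim (fun_scale scale) (Inn :: ('a \<Rightarrow> 'a) set) \<longrightarrow>
      \<not> noetherian (uea (fun_scale scale) commutator (Inn :: ('a \<Rightarrow> 'a) set)))"
proof -
  interpret char_0_algebra scale
    using assms(1) by (simp add: char_0_algebra_def)
  interpret I: lie_algebra "fun_scale scale" commutator "Inn :: ('a \<Rightarrow> 'a) set" by (rule lie_algebra_Inn)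
  have inf: "\<not> fd_mod {} (UNIV :: 'a set)"
    using assms(3) by (simp add: fin_dim_iff_fd_mod)
  have nontrivial: "(0 :: 'a) \<noteq> 1"
  proof
    assume "(0 :: 'a) = 1"
    then have "a = 0" for a :: 'a using mult_1_left[of a] by simp
    then have "(UNIV :: 'a set) \<subseteq> {0}" by blast
    then show False using fd_mod_zero inf by blast
  qed
  have Inn_Der: "(Inn :: ('a \<Rightarrow> 'a) set) \<subseteq> Der scale" by (auto simp: Inn_def ad_Der)
  show ?thesis
  proof (cases "maps.fd_mod {} (Inn :: ('a \<Rightarrow> 'a) set)")
    case True
    obtain S :: "'a set" where S: "finite S" "subalgebra hull S = UNIV"
      using assms(2) by (auto simp: finitely_generated_def)
    have core: "fd_mod core UNIV" by (rule Inn_finite_core[OF assms(2) True])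
    obtain s where "large s" "\<And>a b. a * b * s = 0 \<Longrightarrow> a * s = 0 \<or> b * s = 0"
      using prime_annihilator[OF S inf core] by blast
    then interpret prime_element scale s by unfold_locales
    show ?thesis
      using not_right_noetherian_Der[OF S core] True maps.fin_dim_iff_fd_mod[OF I.L_subspace]
      by (simp add: noetherian_def)
  next
    case False
    \<comment> \<open>One abelian family of inner derivations serves both enveloping
      algebras.\<close>
    obtain C :: "('a \<Rightarrow> 'a) set" where C: "C \<subseteq> Inn" "\<forall>x\<in>C. \<forall>y\<in>C. commutator x y = 0" "\<not> maps.fd_mod {} C"
      using Inn_infinite_abelian[OF assms(2) False] by blast
    then have "\<not> right_noetherian (uea (fun_scale scale) commutator (Der scale))"
      using Inn_Der by (intro not_right_noetherian_if_abelian[OF lie_algebra_Der order_refl nontrivial]) auto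
    moreover have "\<not> right_noetherian (uea (fun_scale scale) commutator (Inn :: ('a \<Rightarrow> 'a) set))"
      using C by (intro not_right_noetherian_if_abelian[OF lie_algebra_Inn Inn_Der nontrivial C(1)]) auto
    ultimately show ?thesis by (simp add: noetherian_def)
  qed
qed

end
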